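(* Let $b>1$, $R_{1b}=\{z\in\mathbb{C}:1\le|z|\le b\}$, and let $f$ be an orientation preserving $C^1$-smooth homeomorphism defined in a neighborhood of $R_{1b}$ with Jacobian $J_f>0$ on $R_{1b}$; let $R'=f(R_{1b})$. Then the conformal module $M(R')$ satisfies \[ \int_1^b\left(\int_0^{2\pi}D_{f,\theta+\frac{\pi}{2}}(re^{i\theta})\,d\theta\right)^{-1}\frac{dr}{r}\ \le\ M(R')\ \le\ \left(\int_0^{2\pi}\left(\int_1^b\frac{D_{f,\theta}(re^{i\theta})}{r}\,dr\right)^{-1}d\theta\right)^{-1}. \]
   Context: The conformal module of a ring domain $R$ which is a conformal image of the annulus $\{a\le|z|\le b\}$ is $M(R)=\frac{\log(b/a)}{2\pi}$. For $z=re^{i\theta}$, the complex dilatation is $\mu_f=f_{\bar z}/f_z$, $J_f=|f_z|^2-|f_{\bar z}|^2$, and the directional dilatation of $f$ in direction $\alpha$ is $D_{f,\alpha}=\frac{|1+e^{-2i\alpha}\mu_f|^2}{1-|\mu_f|^2}$; one has $D_{f,\theta}=|f_r|^2/J_f$ and $D_{f,\theta+\pi/2}=|f_\theta|^2/(r^2J_f)$, where $f_r,f_\theta$ are the partial derivatives of $f(re^{i\theta})$ in $r$ and $\theta$. *)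

theory Defs
  imports "HOL-Complex_Analysis.Complex_Analysis"
begin

definition closed_annulus :: "real \<Rightarrow> real \<Rightarrow> complex set" where
  "closed_annulus a c = {z. a \<le> cmod z \<and> cmod z \<le> c}"

definition open_annulus :: "real \<Rightarrow> real \<Rightarrow> complex set" where
  "open_annulus a c = {z. a < cmod z \<and> cmod z < c}"

definition conformal_annulus_image :: "complex set \<Rightarrow> real \<Rightarrow> real \<Rightarrow> (complex \<Rightarrow> complex) \<Rightarrow> bool" where
  "conformal_annulus_image R a c g \<longleftrightarrow>
     0 < a \<and> a < c \<and> (\<exists>g'. homeomorphism (closed_annulus a c) R g g') \<and>
     g holomorphic_on open_annulus a c"

definition conformal_module :: "complex set \<Rightarrow> real" where
  "conformal_module R =
     (THE m. \<exists>a c g. conformal_annulus_image R a c g \<and> m = ln (c / a) / (2 * pi))"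

text \<open>Complex dilatation mu_f = f_zbar / f_z, Jacobian, directional dilatation,
  expressed through the Wirtinger derivatives fz = f_z and fzb = f_zbar.\<close>
definition cdil :: "(complex \<Rightarrow> complex) \<Rightarrow> (complex \<Rightarrow> complex) \<Rightarrow> complex \<Rightarrow> complex" where
  "cdil fz fzb z = fzb z / fz z"

definition jac :: "(complex \<Rightarrow> complex) \<Rightarrow> (complex \<Rightarrow> complex) \<Rightarrow> complex \<Rightarrow> real" where
  "jac fz fzb z = (cmod (fz z))\<^sup>2 - (cmod (fzb z))\<^sup>2"

definition dir_dil :: "(complex \<Rightarrow> complex) \<Rightarrow> (complex \<Rightarrow> complex) \<Rightarrow> real \<Rightarrow> complex \<Rightarrow> real" where
  "dir_dil fz fzb \<alpha> z =
     (cmod (1 + exp (- 2 * \<i> * complex_of_real \<alpha>) * cdil fz fzb z))\<^sup>2 / (1 - (cmod (cdil fz fzb z))\<^sup>2)"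

end

theory Submission
  imports Defs
begin

text \<open>
  In logarithmic coordinates a ring domain becomes a vertical strip modulo \<open>2\<pi>i\<close>, and a map between
  ring domains becomes a map \<open>F\<close> of strips that commutes with this translation up to sign.
  Both inequalities are then the length-area method: horizontal segments (vertical segments
  of one period) have images of length at least \<open>M\<close> (at least \<open>2\<pi>\<close>), one applies
  Cauchy--Schwarz on each of them, and integrates the Jacobian over one period, whose image has area
  at most \<open>2\<pi>M\<close>. The upper bound with dilatation \<open>1\<close> also shows that the conformal module is unique.

  That a conformal annulus exists at all is obtained from the Riemann mapping theorem.
  Remove a point \<open>p\<close> in the hole; the set of logarithms of \<open>w - p\<close>, \<open>w\<close> in the open ring, is simply
  connected and invariant under translation by \<open>2\<pi>i\<close>. The Riemann map turns this translation into an
  automorphism of the disc without fixed points, which is conjugate to a translation of a strip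
  or of a half plane. The half plane is excluded because it has infinite module, whereas \<open>f\<close> is
  quasiconformal. Finally the map to the strip, composed with \<open>f\<close>, is quasiconformal between strips,
  so it extends homeomorphically to the boundary by the Courant--Lebesgue argument.
\<close>

section \<open>Area of images under injective maps\<close>

text \<open>A conformal map in the sense of \<open>conformal_annulus_image\<close> is merely
  continuous on the closed annulus, so the lifted map \<open>F\<close> has derivatives in the open
  strip only. Both bounds are therefore derived on \<open>d \<le> Re z \<le> L - d\<close> and
  completed by a limit. For the upper bound one must also know that each end of the strip goes to
  one end of the other strip, which is a purely topological fact. The sign \<open>k\<close> is
  carried along because a homeomorphism may exchange the two boundary components, as
  \<open>1/z\<close> does; the half turn \<open>M - z\<close> reduces that case to the other. As
  \<open>conformal_module\<close> is a definite description, nothing can be said about it before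
  existence and uniqueness are known. The quasiconformality constant comes from compactness of the
  closed annulus. It survives inversion and composition with holomorphic maps, so the boundary
  estimates hold for a map and its inverse alike, and this makes the extension a homeomorphism. The
  resulting annulus map is holomorphic inside although \<open>f\<close> occurs in it: there it
  equals \<open>exp (H' w) + p\<close> in the coordinate \<open>w\<close>.\<close>

definition v2 :: "real \<Rightarrow> real \<Rightarrow> real^2" where
  "v2 x y = (\<chi> i. if i = 1 then x else y)"

lemma v2_nth [simp]: "v2 x y $ 1 = x" "v2 x y $ 2 = y"
  by (auto simp: v2_def)

lemma v2_eq_iff: "v = w \<longleftrightarrow> v $ 1 = w $ 1 \<and> v $ 2 = (w::real^2) $ 2"
  by (auto simp: vec_eq_iff forall_2)

lemma v2_collapse [simp]: "v2 (v $ 1) (v $ 2) = v"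
  by (simp add: v2_eq_iff)

lemma cbox_v2: "cbox (v2 a c) (v2 b d) = {v. a \<le> v $ 1 \<and> v $ 1 \<le> b \<and> c \<le> v $ 2 \<and> v $ 2 \<le> d}"
  by (auto simp: mem_box_cart forall_2)

lemma box_v2: "box (v2 a c) (v2 b d) = {v. a < v $ 1 \<and> v $ 1 < b \<and> c < v $ 2 \<and> v $ 2 < d}"
  by (auto simp: mem_box_cart forall_2)

lemma content_v2: "a \<le> b \<Longrightarrow> c \<le> d \<Longrightarrow> measure lborel (cbox (v2 a c) (v2 b d)) = (b - a) * (d - c)"
proof -
  assume *: "a \<le> b" "c \<le> d"
  then have "v2 a c \<in> cbox (v2 a c) (v2 b d)" by (auto simp: cbox_v2)
  then have "cbox (v2 a c) (v2 b d) \<noteq> {}" by blast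
  then show ?thesis by (subst content_cbox_cart) (simp_all add: UNIV_2)
qed

text \<open>The change of variables for injective differentiable maps is applied on
  \<open>real^2\<close>, iterated integrals live on \<open>real \<times> real\<close>. Both
  coordinate maps send boxes to boxes of the same content, so integrals transfer with factor
  1.\<close>

lemma integral_v2:
  fixes f :: "real \<times> real \<Rightarrow> real"
  assumes "continuous_on (cbox (a,c) (b,d)) f"
  shows "((\<lambda>v::real^2. f (v $ 1, v $ 2)) has_integral integral (cbox (a,c) (b,d)) f) (cbox (v2 a c) (v2 b d))"
proof -
  let ?g = "\<lambda>v::real^2. (v $ 1, v $ 2)" and ?h = "\<lambda>p. v2 (fst p) (snd p)"
  have g_cbox: "?g ` cbox u v = cbox (u $ 1, u $ 2) (v $ 1, v $ 2)" for u v
    by (auto simp: mem_box_cart forall_2 image_iff cbox_Pair_eq intro!: bexI[of _ "v2 _ _"])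
  have h_cbox: "?h ` cbox u v = cbox (v2 (fst u) (snd u)) (v2 (fst v) (snd v))" for u v
  proof (cases u, cases v)
    fix u1 u2 w1 w2 assume uv: "u = (u1, u2)" "v = (w1, w2)"
    have "w \<in> ?h ` cbox u v" if "w \<in> cbox (v2 u1 u2) (v2 w1 w2)" for w
      using that by (intro image_eqI[of _ _ "(w $ 1, w $ 2)"]) (auto simp: cbox_v2 uv cbox_Pair_eq)
    then show ?thesis
      by (auto simp: cbox_v2 uv cbox_Pair_eq)
  qed
  have cont: "measure lborel (?g ` cbox u v) = 1 * measure lborel (cbox u v)" for u v :: "real^2"
  proof (cases "u $ 1 \<le> v $ 1 \<and> u $ 2 \<le> v $ 2")
    case True
    then show ?thesis
      using content_v2[of "u $ 1" "v $ 1" "u $ 2" "v $ 2"]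
      by (simp add: g_cbox content_Pair)
  next
    case False
    then have "cbox u v = {}" by (auto simp: mem_box_cart forall_2)
    then show ?thesis by simp
  qed
  have "((\<lambda>x. f (?g x)) has_integral (1 / 1) *\<^sub>R integral (cbox (a,c) (b,d)) f) (?h ` cbox (a,c) (b,d))"
  proof (rule has_integral_twiddle[where g = ?g and h = ?h])
    show "\<exists>w z. ?g ` cbox u v = cbox w z" "\<exists>w z. ?h ` cbox p q = cbox w z" for u v p q
      using g_cbox h_cbox by blast+
    show "(f has_integral integral (cbox (a, c) (b, d)) f) (cbox (a, c) (b, d))"
      using assms by (simp add: integrable_continuous integrable_integral)
    show "measure lborel (?g ` cbox u v) = 1 * measure lborel (cbox u v)" for u v :: "real^2"
      by (rule cont)
    show "isCont ?g x" for x by (intro continuous_intros)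
  qed auto
  then show ?thesis by (simp add: h_cbox)
qed

text \<open>The translates of \<open>E\<close> by \<open>0, \<tau>, \<dots>, (N-1)\<tau>\<close> are disjoint and lie in a box of area
  \<open>M (2C + N\<tau>)\<close>; divide by \<open>N\<close>.\<close>
lemma measure_injective_mod_translation:
  fixes E :: "(real^2) set"
  assumes E: "E \<in> lmeasurable" and "bounded E" and "\<tau> > 0" "M \<ge> 0"
    and box: "\<And>v::real^2. v \<in> E \<Longrightarrow> 0 \<le> v $ 1 \<and> v $ 1 \<le> M"
    and disj: "\<And>(v::real^2) w j. v \<in> E \<Longrightarrow> w \<in> E \<Longrightarrow> v $ 1 = w $ 1 \<Longrightarrow> v $ 2 - w $ 2 = \<tau> * of_int j \<Longrightarrow> j = 0"
  shows "measure lebesgue E \<le> \<tau> * M"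
proof -
  obtain C where C: "\<And>v. v \<in> E \<Longrightarrow> norm v \<le> C" and "C > 0"
    using \<open>bounded E\<close> bounded_pos by blast
  have C2: "\<bar>v $ 2\<bar> \<le> C" if "v \<in> E" for v :: "real^2"
    using component_le_norm_cart[of v 2] C[OF that] by linarith
  define T where "T j = (+) (v2 0 (\<tau> * real j)) ` E" for j
  have Tm: "T j \<in> lmeasurable" for j
    unfolding T_def using E by (simp add: measurable_translation)
  have mT: "measure lebesgue (T j) = measure lebesgue E" for j
    unfolding T_def by (rule measure_translation)
  have disjT: "T i \<inter> T j = {}" if "i \<noteq> j" for i j
  proof (rule ccontr)
    assume "T i \<inter> T j \<noteq> {}"
    then obtain v w where vw: "v \<in> E" "w \<in> E" "v2 0 (\<tau> * real i) + v = v2 0 (\<tau> * real j) + w"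
      by (auto simp: T_def)
    then have "v $ 1 = w $ 1" "v $ 2 - w $ 2 = \<tau> * of_int (int j - int i)"
      by (auto simp: v2_eq_iff algebra_simps)
    then have "int j - int i = 0" using disj vw by blast
    then show False using that by simp
  qed
  have main: "real N * measure lebesgue E \<le> M * (2 * C + \<tau> * real N)" for N
  proof -
    have "real N * measure lebesgue E = (\<Sum>j<N. measure lebesgue (T j))"
      by (simp add: mT)
    also have "\<dots> = measure lebesgue (\<Union>j<N. T j)"
      by (rule measure_UNION'[symmetric]) (auto simp: Tm pairwise_def disjnt_def disjT)
    also have "\<dots> \<le> measure lebesgue (cbox (v2 0 (-C)) (v2 M (C + \<tau> * real N)))"
    proof (rule measure_mono_fmeasurable)
      show "(\<Union>j<N. T j) \<subseteq> cbox (v2 0 (- C)) (v2 M (C + \<tau> * real N))"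
      proof clarify
        fix j v assume "j < N" "v \<in> T j"
        then obtain w where w: "w \<in> E" "v = v2 0 (\<tau> * real j) + w" by (auto simp: T_def)
        have "0 \<le> \<tau> * real j" "\<tau> * real j \<le> \<tau> * real N"
          using \<open>j < N\<close> \<open>\<tau> > 0\<close> by auto
        then show "v \<in> cbox (v2 0 (- C)) (v2 M (C + \<tau> * real N))"
          using box[OF w(1)] C2[OF w(1)] w(2) by (auto simp: cbox_v2)
      qed
      show "(\<Union>j<N. T j) \<in> sets lebesgue" using Tm by (auto intro: fmeasurableD)
    qed auto
    also have "\<dots> = M * (2 * C + \<tau> * real N)"
      using content_v2[of 0 M "-C" "C + \<tau> * real N"] \<open>C > 0\<close> \<open>\<tau> > 0\<close> \<open>M \<ge> 0\<close>
      by (simp add: )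
    finally show ?thesis .
  qed
  show ?thesis
  proof (rule ccontr)
    assume "\<not> ?thesis"
    then have d: "measure lebesgue E - \<tau> * M > 0" by simp
    then obtain N where "2 * C * M < real N * (measure lebesgue E - \<tau> * M)"
      using reals_Archimedean3 by blast
    then show False using main[of N] by (simp add: algebra_simps)
  qed
qed

section \<open>Wirtinger derivatives and the area of the image of a rectangle\<close>

definition has_wirtinger :: "(complex \<Rightarrow> complex) \<Rightarrow> complex \<Rightarrow> complex \<Rightarrow> complex \<Rightarrow> bool" where
  "has_wirtinger F a b z \<longleftrightarrow> (F has_derivative (\<lambda>h. a * h + b * cnj h)) (at z)"

definition C1_wirtinger_on where
  "C1_wirtinger_on U F fz fzb \<longleftrightarrow> open U \<and> continuous_on U fz \<and> continuous_on U fzb \<and>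
     (\<forall>z\<in>U. has_wirtinger F (fz z) (fzb z) z)"

lemma C1_wirtinger_on_continuous: "C1_wirtinger_on U F fz fzb \<Longrightarrow> continuous_on U F"
  unfolding C1_wirtinger_on_def has_wirtinger_def
  by (meson continuous_at_imp_continuous_on has_derivative_continuous)

lemma continuous_on_jac:
  "continuous_on U fz \<Longrightarrow> continuous_on U fzb \<Longrightarrow> continuous_on U (jac fz fzb)"
  unfolding jac_def by (intro continuous_intros)

text \<open>The hypothesis \<open>inj\<close> is used twice: with \<open>j = 0\<close> it makes the
  integral of the Jacobian the area of the image, with arbitrary \<open>j\<close> it makes the
  vertical translates of this image by multiples of 2 pi disjoint. It is imposed on the open box
  only, since a period cell has two sides that are identified.\<close>

lemma area_le_of_injective_mod_period:
  fixes P pz pzb :: "complex \<Rightarrow> complex" and \<alpha> \<beta> \<gamma> \<delta> M :: real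
  assumes "\<alpha> \<le> \<beta>" "\<gamma> \<le> \<delta>" "M \<ge> 0"
    and C1: "C1_wirtinger_on U P pz pzb"
    and sub: "cbox (Complex \<alpha> \<gamma>) (Complex \<beta> \<delta>) \<subseteq> U"
    and jac: "\<And>z. z \<in> cbox (Complex \<alpha> \<gamma>) (Complex \<beta> \<delta>) \<Longrightarrow> jac pz pzb z \<ge> 0"
    and inj: "\<And>z w j. z \<in> box (Complex \<alpha> \<gamma>) (Complex \<beta> \<delta>) \<Longrightarrow> w \<in> box (Complex \<alpha> \<gamma>) (Complex \<beta> \<delta>)
                \<Longrightarrow> P z = P w + 2 * pi * of_int j * \<i> \<Longrightarrow> z = w"
    and Re: "\<And>z. z \<in> cbox (Complex \<alpha> \<gamma>) (Complex \<beta> \<delta>) \<Longrightarrow> 0 \<le> Re (P z) \<and> Re (P z) \<le> M"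
  shows "integral {\<alpha>..\<beta>} (\<lambda>x. integral {\<gamma>..\<delta>} (\<lambda>y. jac pz pzb (Complex x y))) \<le> 2 * pi * M"
proof -
  let ?c = "\<lambda>v::real^2. Complex (v $ 1) (v $ 2)"
  define g where "g v = v2 (Re (P (?c v))) (Im (P (?c v)))" for v
  define g' where "g' v h = (let d = pz (?c v) * ?c h + pzb (?c v) * cnj (?c h) in v2 (Re d) (Im d))" for v h
  let ?Q = "box (v2 \<alpha> \<gamma>) (v2 \<beta> \<delta>)" and ?CQ = "cbox (v2 \<alpha> \<gamma>) (v2 \<beta> \<delta>)"
  have c_CQ: "?c v \<in> cbox (Complex \<alpha> \<gamma>) (Complex \<beta> \<delta>)" if "v \<in> ?CQ" for v
    using that by (auto simp: cbox_v2 in_cbox_complex_iff)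
  have c_Q: "?c v \<in> box (Complex \<alpha> \<gamma>) (Complex \<beta> \<delta>)" if "v \<in> ?Q" for v
    using that by (auto simp: box_v2 in_box_complex_iff)
  have linc: "linear ?c" by (intro linearI) (auto simp: complex_eq_iff)
  then have blc: "bounded_linear ?c" by (simp add: linear_linear)
  have bl2: "bounded_linear (\<lambda>z. v2 (Re z) (Im z))"
  proof -
    have "linear (\<lambda>z. v2 (Re z) (Im z))" by (intro linearI) (auto simp: v2_eq_iff)
    then show ?thesis by (simp add: linear_linear)
  qed
  have der: "(g has_derivative g' v) (at v)" if "v \<in> ?CQ" for v
  proof -
    have 1: "(P has_derivative (\<lambda>h. pz (?c v) * h + pzb (?c v) * cnj h)) (at (?c v))"
      using C1 c_CQ[OF that] sub unfolding C1_wirtinger_on_def has_wirtinger_def by blast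
    have 2: "(?c has_derivative ?c) (at v)"
      by (rule bounded_linear_imp_has_derivative[OF blc])
    have 3: "((\<lambda>v. P (?c v)) has_derivative (\<lambda>h. pz (?c v) * ?c h + pzb (?c v) * cnj (?c h))) (at v)"
      using has_derivative_compose[OF 2 1] by simp
    show ?thesis
      using has_derivative_compose[OF 3 bounded_linear_imp_has_derivative[OF bl2]]
      unfolding g_def g'_def Let_def by simp
  qed
  have det: "det (matrix (g' v)) = jac pz pzb (?c v)" for v
    unfolding det_2 matrix_def g'_def Let_def jac_def cmod_power2
    by (simp add: axis_def power2_eq_square algebra_simps)
  have contP: "continuous_on (cbox (Complex \<alpha> \<gamma>) (Complex \<beta> \<delta>)) P"
    using C1_wirtinger_on_continuous[OF C1] sub continuous_on_subset by blast
  have contJ: "continuous_on U (jac pz pzb)"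
    using C1 unfolding C1_wirtinger_on_def by (intro continuous_on_jac) auto
  have contJ2: "continuous_on (cbox (\<alpha>,\<gamma>) (\<beta>,\<delta>)) (\<lambda>p. jac pz pzb (Complex (fst p) (snd p)))"
  proof (rule continuous_on_compose2[OF contJ])
    show "continuous_on (cbox (\<alpha>,\<gamma>) (\<beta>,\<delta>)) (\<lambda>p. Complex (fst p) (snd p))"
      by (auto simp: Complex_eq intro!: continuous_intros)
    show "(\<lambda>p. Complex (fst p) (snd p)) ` cbox (\<alpha>, \<gamma>) (\<beta>, \<delta>) \<subseteq> U"
      using sub by (auto simp: cbox_Pair_eq in_cbox_complex_iff)
  qed
  let ?I = "integral (cbox (\<alpha>,\<gamma>) (\<beta>,\<delta>)) (\<lambda>p. jac pz pzb (Complex (fst p) (snd p)))"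
  have int1: "((\<lambda>v. jac pz pzb (?c v)) has_integral ?I) ?CQ"
    using integral_v2[OF contJ2] by simp
  then have "((\<lambda>v. \<bar>det (matrix (g' v))\<bar>) has_integral ?I) ?CQ"
    by (rule has_integral_eq[rotated]) (use jac c_CQ in \<open>auto simp: det\<close>)
  then have int2: "((\<lambda>v. \<bar>det (matrix (g' v))\<bar>) has_integral ?I) ?Q"
    using has_integral_open_interval by blast
  have injg: "v = w" if "v \<in> ?Q" "w \<in> ?Q" "g v $ 1 = g w $ 1" "g v $ 2 - g w $ 2 = 2 * pi * of_int j" for v w :: "real^2" and j
  proof -
    have "P (?c v) = P (?c w) + 2 * pi * of_int j * \<i>"
      using that(3,4) by (auto simp: g_def complex_eq_iff)
    then have "?c v = ?c w" using inj c_Q that by blast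
    then show ?thesis by (auto simp: v2_eq_iff)
  qed
  have "inj_on g ?Q"
    using injg[where j = 0] by (auto intro!: inj_onI)
  moreover have "(g has_derivative g' v) (at v within ?Q)" if "v \<in> ?Q" for v
    using der that box_subset_cbox by (blast intro: has_derivative_at_withinI)
  ultimately have E: "g ` ?Q \<in> lmeasurable" "measure lebesgue (g ` ?Q) = ?I"
    using has_measure_differentiable_image[of ?Q g g' ?I] int2 by simp_all
  have "bounded (g ` ?CQ)"
  proof (intro compact_imp_bounded compact_continuous_image)
    show "continuous_on ?CQ g"
      using der by (meson continuous_at_imp_continuous_on has_derivative_continuous)
  qed auto
  then have bnd: "bounded (g ` ?Q)"
    by (meson bounded_subset box_subset_cbox image_mono)
  have "measure lebesgue (g ` ?Q) \<le> 2 * pi * M"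
  proof (rule measure_injective_mod_translation[OF E(1) bnd])
    show "0 \<le> v $ 1 \<and> v $ 1 \<le> M" if "v \<in> g ` ?Q" for v :: "real^2"
    proof -
      obtain u where "u \<in> ?Q" "v = g u" using \<open>v \<in> g ` ?Q\<close> by blast
      then have "u \<in> ?CQ" using box_subset_cbox by blast
      from Re[OF c_CQ[OF this]] show ?thesis by (simp add: \<open>v = g u\<close> g_def)
    qed
    show "j = 0" if "v \<in> g ` ?Q" "w \<in> g ` ?Q" "v $ 1 = w $ 1" "v $ 2 - w $ 2 = 2 * pi * of_int j" for v w :: "real^2" and j
    proof -
      obtain u u' where u: "u \<in> ?Q" "v = g u" "u' \<in> ?Q" "w = g u'"
        using \<open>v \<in> g ` ?Q\<close> \<open>w \<in> g ` ?Q\<close> by blast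
      then have "u = u'" using injg[of u u' j] u \<open>v $ 1 = w $ 1\<close> \<open>v $ 2 - w $ 2 = 2 * pi * of_int j\<close> by simp
      then show "j = 0" using \<open>v $ 2 - w $ 2 = 2 * pi * of_int j\<close> u by simp
    qed
  qed (use \<open>M \<ge> 0\<close> in auto)
  moreover have "?I = integral {\<alpha>..\<beta>} (\<lambda>x. integral {\<gamma>..\<delta>} (\<lambda>y. jac pz pzb (Complex x y)))"
    using integral_prod_continuous[OF contJ2] by simp
  ultimately show ?thesis using E by simp
qed

section \<open>The length-area inequality on strips\<close>

text \<open>This is Cauchy-Schwarz, obtained from
  \<open>cmod (\<phi>' t) \<le> (c * D t + J t / c) / 2\<close> by integrating and taking
  \<open>c\<close> to be the length of the chord divided by the integral of \<open>D\<close>. This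
  choice avoids square roots and remains legitimate when \<open>J\<close> vanishes. The second
  conclusion is used later by itself, with \<open>\<phi>\<close> and \<open>J\<close> zero, as
  positivity of an integral.\<close>

lemma length_area:
  fixes \<phi> \<phi>' :: "real \<Rightarrow> complex" and D J :: "real \<Rightarrow> real"
  assumes "\<alpha> < \<beta>"
    and der: "\<And>t. t \<in> {\<alpha>..\<beta>} \<Longrightarrow> (\<phi> has_vector_derivative \<phi>' t) (at t within {\<alpha>..\<beta>})"
    and D: "continuous_on {\<alpha>..\<beta>} D" "\<And>t. t \<in> {\<alpha>..\<beta>} \<Longrightarrow> D t > 0"
    and J: "continuous_on {\<alpha>..\<beta>} J" "\<And>t. t \<in> {\<alpha>..\<beta>} \<Longrightarrow> J t \<ge> 0"
    and le: "\<And>t. t \<in> {\<alpha>..\<beta>} \<Longrightarrow> (cmod (\<phi>' t))\<^sup>2 \<le> D t * J t"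
  shows "(cmod (\<phi> \<beta> - \<phi> \<alpha>))\<^sup>2 \<le> integral {\<alpha>..\<beta>} D * integral {\<alpha>..\<beta>} J"
    and "integral {\<alpha>..\<beta>} D > 0"
proof -
  let ?X = "integral {\<alpha>..\<beta>} D" and ?Y = "integral {\<alpha>..\<beta>} J" and ?l = "cmod (\<phi> \<beta> - \<phi> \<alpha>)"
  have iD: "D integrable_on {\<alpha>..\<beta>}" and iJ: "J integrable_on {\<alpha>..\<beta>}"
    using D(1) J(1) by (simp_all add: integrable_continuous_real)
  show X: "?X > 0"
  proof -
    have "?X \<ge> 0" using iD D(2) by (intro integral_nonneg) (auto intro: less_imp_le)
    moreover have "?X \<noteq> 0"
      using integral_eq_0_iff[OF D(1) \<open>\<alpha> < \<beta>\<close>] D(2) \<open>\<alpha> < \<beta>\<close>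
      by (metis atLeastAtMost_iff less_eq_real_def less_irrefl)
    ultimately show ?thesis by simp
  qed
  have Y: "?Y \<ge> 0" using iJ J(2) by (intro integral_nonneg) auto
  have int\<phi>: "(\<phi>' has_integral (\<phi> \<beta> - \<phi> \<alpha>)) {\<alpha>..\<beta>}"
    using der \<open>\<alpha> < \<beta>\<close> by (intro fundamental_theorem_of_calculus) auto
  have amgm: "?l \<le> (c * ?X + ?Y / c) / 2" if "c > 0" for c
  proof -
    have i: "(\<lambda>t. (c * D t + J t / c) / 2) integrable_on {\<alpha>..\<beta>}"
      using iD iJ D(1) J(1) \<open>c > 0\<close> by (intro integrable_continuous_real continuous_intros) auto
    have "?l = norm (integral {\<alpha>..\<beta>} \<phi>')" using int\<phi> by (simp add: integral_unique)
    also have "\<dots> \<le> integral {\<alpha>..\<beta>} (\<lambda>t. (c * D t + J t / c) / 2)"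
    proof (rule Henstock_Kurzweil_Integration.integral_norm_bound_integral[OF _ i])
      show "\<phi>' integrable_on {\<alpha>..\<beta>}" using int\<phi> by blast
      fix t assume t: "t \<in> {\<alpha>..\<beta>}"
      have "(cmod (\<phi>' t))\<^sup>2 \<le> (c * D t) * (J t / c)" using le[OF t] \<open>c > 0\<close> by simp
      also have "\<dots> \<le> ((c * D t + J t / c) / 2)\<^sup>2"
      proof -
        have "x * y \<le> ((x + y) / 2)\<^sup>2" for x y :: real
        proof -
          have "4 * (x * y) \<le> (x + y)\<^sup>2"
            using sum_squares_bound[of x y] unfolding power2_sum by linarith
          then show ?thesis unfolding power_divide by simp
        qed
        then show ?thesis .
      qed
      finally show "cmod (\<phi>' t) \<le> (c * D t + J t / c) / 2"
        by (rule power2_le_imp_le) (use D(2)[OF t] J(2)[OF t] \<open>c > 0\<close> in simp)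
    qed
    also have "\<dots> = (c * ?X + ?Y / c) / 2"
      using integrable_on_mult_right[OF iD, of c] integrable_on_divide[OF iJ, of c]
      by (simp add: integral_add)
    finally show ?thesis .
  qed
  show "?l\<^sup>2 \<le> ?X * ?Y"
  proof (cases "?l = 0")
    case True
    then show ?thesis using X Y by simp
  next
    case False
    then have l: "?l > 0" by simp
    then have "?l \<le> (?l / ?X * ?X + ?Y / (?l / ?X)) / 2" using X by (intro amgm) auto
    then have "?l \<le> (?l + ?X * ?Y / ?l) / 2" using X by (simp add: field_simps)
    then have "?l \<le> ?X * ?Y / ?l" by simp
    then show ?thesis using l by (simp add: power2_eq_square field_simps)
  qed
qed

definition strip :: "real \<Rightarrow> complex set" where
  "strip L = {z. 0 < Re z \<and> Re z < L}"

abbreviation period :: complex where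
  "period \<equiv> 2 * pi * \<i>"

definition cstrip :: "real \<Rightarrow> real \<Rightarrow> complex set" where
  "cstrip \<alpha> \<beta> = {z. \<alpha> \<le> Re z \<and> Re z \<le> \<beta>}"

lemma open_strip [simp]: "open (strip L)"
  unfolding strip_def by (intro open_Collect_conj open_halfspace_Re_gt open_halfspace_Re_lt)

lemma convex_strip [simp]: "convex (strip L)"
  unfolding strip_def Collect_conj_eq by (intro convex_Int convex_halfspace_Re_gt convex_halfspace_Re_lt)

lemma convex_cstrip [simp]: "convex (cstrip a b)"
proof -
  have "cstrip a b = Re -` {a..b}" by (auto simp: cstrip_def)
  then show ?thesis by (simp add: convex_linear_vimage bounded_linear.linear[OF bounded_linear_Re])
qed

lemma closed_cstrip [simp]: "closed (cstrip a b)"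
  unfolding cstrip_def Collect_conj_eq by (intro closed_Int closed_halfspace_Re_ge closed_halfspace_Re_le)

text \<open>The transverse half of the length-area method: \<open>l\<close> is a lower bound for the
  squared length on each line, and dividing by \<open>X t\<close> before integrating over the lines
  yields the reciprocal of the inner integral.\<close>

lemma integral_inverse_le_of_square_le:
  fixes X Y :: "real \<Rightarrow> real"
  assumes cX: "continuous_on {c..d} X" and cY: "continuous_on {c..d} Y"
    and X: "\<And>t. t \<in> {c..d} \<Longrightarrow> X t > 0"
    and le: "\<And>t. t \<in> {c..d} \<Longrightarrow> l \<le> X t * Y t"
  shows "l * integral {c..d} (\<lambda>t. inverse (X t)) \<le> integral {c..d} Y"
proof -
  have "continuous_on {c..d} (\<lambda>t. inverse (X t))"
    using X by (intro continuous_intros cX) force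
  then have 1: "(\<lambda>t. inverse (X t)) integrable_on {c..d}" by (rule integrable_continuous_real)
  have "integral {c..d} (\<lambda>t. l * inverse (X t)) \<le> integral {c..d} Y"
  proof (rule integral_le)
    show "(\<lambda>t. l * inverse (X t)) integrable_on {c..d}" using 1 by (rule integrable_on_mult_right)
    show "Y integrable_on {c..d}" using cY by (rule integrable_continuous_real)
    show "l * inverse (X t) \<le> Y t" if "t \<in> {c..d}" for t
      using le[OF that] X[OF that] by (simp add: field_simps)
  qed
  then show ?thesis by simp
qed

lemma continuous_on_integral_Complex:
  fixes h :: "complex \<Rightarrow> real"
  assumes "continuous_on S h" and "\<And>x y. x \<in> {a..b} \<Longrightarrow> y \<in> {c..d} \<Longrightarrow> Complex x y \<in> S"
  shows "continuous_on {a..b} (\<lambda>x. integral {c..d} (\<lambda>y. h (Complex x y)))"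
    and "continuous_on {c..d} (\<lambda>y. integral {a..b} (\<lambda>x. h (Complex x y)))"
    and "integral {a..b} (\<lambda>x. integral {c..d} (\<lambda>y. h (Complex x y))) =
         integral {c..d} (\<lambda>y. integral {a..b} (\<lambda>x. h (Complex x y)))"
    and "\<And>x. x \<in> {a..b} \<Longrightarrow> continuous_on {c..d} (\<lambda>y. h (Complex x y))"
    and "\<And>y. y \<in> {c..d} \<Longrightarrow> continuous_on {a..b} (\<lambda>x. h (Complex x y))"
proof -
  have 1: "continuous_on ({a..b} \<times> {c..d}) (\<lambda>(x,y). h (Complex x y))"
    unfolding split_def using assms
    by (intro continuous_on_compose2[OF assms(1)]) (auto simp: Complex_eq intro!: continuous_intros)
  have 2: "continuous_on ({c..d} \<times> {a..b}) (\<lambda>(y,x). h (Complex x y))"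
    unfolding split_def using assms
    by (intro continuous_on_compose2[OF assms(1)]) (auto simp: Complex_eq intro!: continuous_intros)
  show "continuous_on {a..b} (\<lambda>x. integral {c..d} (\<lambda>y. h (Complex x y)))"
    using integral_continuous_on_param[of "{a..b}" c d "\<lambda>x y. h (Complex x y)"] 1 by simp
  show "continuous_on {c..d} (\<lambda>y. integral {a..b} (\<lambda>x. h (Complex x y)))"
    using integral_continuous_on_param[of "{c..d}" a b "\<lambda>y x. h (Complex x y)"] 2 by simp
  show "integral {a..b} (\<lambda>x. integral {c..d} (\<lambda>y. h (Complex x y))) =
         integral {c..d} (\<lambda>y. integral {a..b} (\<lambda>x. h (Complex x y)))"
    using integral_swap_continuous[of a c b d "\<lambda>x y. h (Complex x y)"] 1
    by (simp add: cbox_Pair_eq)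
  show "continuous_on {c..d} (\<lambda>y. h (Complex x y))" if "x \<in> {a..b}" for x
    using assms that
    by (intro continuous_on_compose2[OF assms(1)]) (auto simp: Complex_eq intro!: continuous_intros)
  show "continuous_on {a..b} (\<lambda>x. h (Complex x y))" if "y \<in> {c..d}" for y
    using assms that
    by (intro continuous_on_compose2[OF assms(1)]) (auto simp: Complex_eq intro!: continuous_intros)
qed

lemma has_wirtinger_horizontal:
  assumes "has_wirtinger F a b (Complex x y)"
  shows "((\<lambda>t. F (Complex t y)) has_vector_derivative (a + b)) (at x within S)"
proof -
  have 1: "((\<lambda>t. Complex t y) has_derivative (\<lambda>t. of_real t)) (at x within S)"
    unfolding Complex_eq by (auto intro!: derivative_eq_intros)
  have 2: "(F has_derivative (\<lambda>h. a * h + b * cnj h)) (at (Complex x y))"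
    using assms by (simp add: has_wirtinger_def)
  show ?thesis
    using has_derivative_compose[OF 1 2] unfolding has_vector_derivative_def
    by (simp add: scaleR_conv_of_real algebra_simps)
qed

lemma has_wirtinger_vertical:
  assumes "has_wirtinger F a b (Complex x y)"
  shows "((\<lambda>t. F (Complex x t)) has_vector_derivative (\<i> * (a - b))) (at y within S)"
proof -
  have 1: "((\<lambda>t. Complex x t) has_derivative (\<lambda>t. \<i> * of_real t)) (at y within S)"
    unfolding Complex_eq by (auto intro!: derivative_eq_intros)
  have 2: "(F has_derivative (\<lambda>h. a * h + b * cnj h)) (at (Complex x y))"
    using assms by (simp add: has_wirtinger_def)
  show ?thesis
    using has_derivative_compose[OF 1 2] unfolding has_vector_derivative_def
    by (simp add: scaleR_conv_of_real algebra_simps)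
qed

lemma periodic_int:
  fixes F :: "complex \<Rightarrow> complex" and c d :: complex
  assumes per: "\<And>z. z \<in> S \<Longrightarrow> F (z + c) = F z + d"
    and S: "\<And>z. z + c \<in> S \<longleftrightarrow> z \<in> S" and "z \<in> S"
  shows "z + of_int n * c \<in> S" "F (z + of_int n * c) = F z + of_int n * d"
proof -
  have "z + of_int n * c \<in> S \<and> F (z + of_int n * c) = F z + of_int n * d"
  proof (induction n rule: int_induct[of _ 0])
    case base
    then show ?case using assms by simp
  next
    case (step1 i)
    then show ?case using per[of "z + of_int i * c"] S[of "z + of_int i * c"] by (simp add: algebra_simps)
  next
    case (step2 i)
    then show ?case using per[of "z + of_int (i - 1) * c"] S[of "z + of_int (i - 1) * c"]
      by (simp add: algebra_simps)
  qed
  then show "z + of_int n * c \<in> S" "F (z + of_int n * c) = F z + of_int n * d" by blast+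
qed

lemma strip_shift [simp]:
  "z + period \<in> strip L \<longleftrightarrow> z \<in> strip L"
  "z + period \<in> cstrip \<alpha> \<beta> \<longleftrightarrow> z \<in> cstrip \<alpha> \<beta>"
  by (simp_all add: strip_def cstrip_def)

text \<open>As \<open>k * k = 1\<close>, shifting \<open>w\<close> by \<open>k * j\<close> periods
  shifts \<open>F w\<close> by \<open>j\<close> periods. A coincidence modulo periods thus becomes a
  genuine one in the strip, where \<open>F\<close> is injective; heights in the open cell differ by
  less than 2 pi, which forces \<open>j = 0\<close>.\<close>

lemma cell_area_le:
  assumes "\<alpha> \<le> \<beta>" "M \<ge> 0" and C1: "C1_wirtinger_on U F fz fzb" and sub: "cstrip \<alpha> \<beta> \<subseteq> U"
    and jac: "\<And>z. z \<in> cstrip \<alpha> \<beta> \<Longrightarrow> jac fz fzb z \<ge> 0"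
    and inj: "inj_on F (cstrip \<alpha> \<beta>)"
    and per: "\<And>z. z \<in> cstrip \<alpha> \<beta> \<Longrightarrow> F (z + period) = F z + of_int k * period"
    and k: "k = 1 \<or> k = -1"
    and Re: "\<And>z. z \<in> cstrip \<alpha> \<beta> \<Longrightarrow> 0 \<le> Re (F z) \<and> Re (F z) \<le> M"
  shows "integral {\<alpha>..\<beta>} (\<lambda>x. integral {0..2*pi} (\<lambda>y. jac fz fzb (Complex x y))) \<le> 2 * pi * M"
proof (rule area_le_of_injective_mod_period[OF \<open>\<alpha> \<le> \<beta>\<close> _ \<open>M \<ge> 0\<close> C1])
  have sub': "cbox (Complex \<alpha> 0) (Complex \<beta> (2*pi)) \<subseteq> cstrip \<alpha> \<beta>"
    by (auto simp: in_cbox_complex_iff cstrip_def)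
  show "cbox (Complex \<alpha> 0) (Complex \<beta> (2*pi)) \<subseteq> U" using sub sub' by blast
  show "0 \<le> jac fz fzb z" if "z \<in> cbox (Complex \<alpha> 0) (Complex \<beta> (2 * pi))" for z
    using that jac sub' by blast
  show "0 \<le> Re (F z) \<and> Re (F z) \<le> M" if "z \<in> cbox (Complex \<alpha> 0) (Complex \<beta> (2 * pi))" for z
    using that Re sub' by blast
  fix z w j
  assume z: "z \<in> box (Complex \<alpha> 0) (Complex \<beta> (2 * pi))" and w: "w \<in> box (Complex \<alpha> 0) (Complex \<beta> (2 * pi))"
    and eq: "F z = F w + 2 * pi * of_int j * \<i>"
  have zw: "z \<in> cstrip \<alpha> \<beta>" "w \<in> cstrip \<alpha> \<beta>"
    using z w by (auto simp: in_box_complex_iff cstrip_def)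
  let ?w = "w + of_int (k * j) * period"
  note w' = periodic_int[where S = "cstrip \<alpha> \<beta>" and F = F, OF per strip_shift(2) zw(2), of "k * j"]
  have "F ?w = F w + of_int (k * k * j) * period" using w'(2) by (simp add: mult_ac)
  also have "k * k = 1" using k by auto
  finally have "F ?w = F z" by (simp add: eq mult_ac)
  then have "z = ?w" using inj w'(1) zw by (metis inj_on_eq_iff)
  then have "Im z - Im w = 2 * pi * of_int (k * j)" by simp
  moreover have "\<bar>Im z - Im w\<bar> < 2 * pi" using z w by (auto simp: in_box_complex_iff)
  ultimately have "\<bar>of_int (k * j)\<bar> < (1::real)" by (simp add: abs_mult)
  then have "k * j = 0" by linarith
  then show "z = w" using \<open>z = ?w\<close> by simp
qed simp

text \<open>The ends of a vertical segment of one period have images that differ by plus or minus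
  one period. \<open>D\<close> may be any continuous majorant of the squared vertical stretch
  divided by the Jacobian, so a directional dilatation and a constant \<open>K\<close> are both
  admissible, and \<open>F\<close> need only map into a strip of width \<open>M\<close>, not onto
  it.\<close>

lemma lower_module_bound:
  assumes "\<alpha> < \<beta>" "M \<ge> 0" and C1: "C1_wirtinger_on U F fz fzb" and sub: "cstrip \<alpha> \<beta> \<subseteq> U"
    and jac: "\<And>z. z \<in> cstrip \<alpha> \<beta> \<Longrightarrow> jac fz fzb z \<ge> 0"
    and inj: "inj_on F (cstrip \<alpha> \<beta>)"
    and per: "\<And>z. z \<in> cstrip \<alpha> \<beta> \<Longrightarrow> F (z + period) = F z + of_int k * period"
    and k: "k = 1 \<or> k = -1"
    and Re: "\<And>z. z \<in> cstrip \<alpha> \<beta> \<Longrightarrow> 0 \<le> Re (F z) \<and> Re (F z) \<le> M"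
    and D: "continuous_on (cstrip \<alpha> \<beta>) D" "\<And>z. z \<in> cstrip \<alpha> \<beta> \<Longrightarrow> D z > 0"
    and le: "\<And>z. z \<in> cstrip \<alpha> \<beta> \<Longrightarrow> (cmod (fz z - fzb z))\<^sup>2 \<le> D z * jac fz fzb z"
  shows "2 * pi * integral {\<alpha>..\<beta>} (\<lambda>x. inverse (integral {0..2*pi} (\<lambda>y. D (Complex x y)))) \<le> M"
proof -
  have S: "Complex x y \<in> cstrip \<alpha> \<beta>" if "x \<in> {\<alpha>..\<beta>}" for x y
    using that by (auto simp: cstrip_def)
  have cJ: "continuous_on (cstrip \<alpha> \<beta>) (jac fz fzb)"
    using C1 sub unfolding C1_wirtinger_on_def by (meson continuous_on_jac continuous_on_subset)
  have la: "(cmod (F (Complex x (2*pi)) - F (Complex x 0)))\<^sup>2 \<le>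
        integral {0..2*pi} (\<lambda>y. D (Complex x y)) * integral {0..2*pi} (\<lambda>y. jac fz fzb (Complex x y))"
      "integral {0..2*pi} (\<lambda>y. D (Complex x y)) > 0" if x: "x \<in> {\<alpha>..\<beta>}" for x
  proof -
    have *: "((\<lambda>t. F (Complex x t)) has_vector_derivative (\<i> * (fz (Complex x y) - fzb (Complex x y)))) (at y within {0..2*pi})" for y
      using C1 sub S[OF x] unfolding C1_wirtinger_on_def by (intro has_wirtinger_vertical) blast
    show "(cmod (F (Complex x (2*pi)) - F (Complex x 0)))\<^sup>2 \<le>
        integral {0..2*pi} (\<lambda>y. D (Complex x y)) * integral {0..2*pi} (\<lambda>y. jac fz fzb (Complex x y))"
      "integral {0..2*pi} (\<lambda>y. D (Complex x y)) > 0"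
      using length_area[OF _ *, of "\<lambda>y. D (Complex x y)" "\<lambda>y. jac fz fzb (Complex x y)"]
        continuous_on_integral_Complex(4)[OF cJ S x] continuous_on_integral_Complex(4)[OF D(1) S x]
        D(2) S x le jac by (simp_all add: norm_mult)
  qed
  have "(2 * pi)\<^sup>2 * integral {\<alpha>..\<beta>} (\<lambda>x. inverse (integral {0..2*pi} (\<lambda>y. D (Complex x y))))
     \<le> integral {\<alpha>..\<beta>} (\<lambda>x. integral {0..2*pi} (\<lambda>y. jac fz fzb (Complex x y)))"
  proof (rule integral_inverse_le_of_square_le)
    fix x assume x: "x \<in> {\<alpha>..\<beta>}"
    show "integral {0..2*pi} (\<lambda>y. D (Complex x y)) > 0" by (rule la[OF x])
    have "Complex x (2*pi) = Complex x 0 + period" by (simp add: complex_eq_iff)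
    then have "F (Complex x (2*pi)) - F (Complex x 0) = of_int k * period"
      using per[OF S[OF x]] by simp
    then have "cmod (F (Complex x (2*pi)) - F (Complex x 0)) = 2 * pi"
      using k by (auto simp: norm_mult)
    then show "(2*pi)\<^sup>2 \<le> integral {0..2*pi} (\<lambda>y. D (Complex x y)) * integral {0..2*pi} (\<lambda>y. jac fz fzb (Complex x y))"
      using la(1)[OF x] by simp
  qed (use continuous_on_integral_Complex(1)[OF cJ S] continuous_on_integral_Complex(1)[OF D(1) S] in auto)
  also have "\<dots> \<le> 2 * pi * M"
    using cell_area_le[OF _ \<open>M \<ge> 0\<close> C1 sub jac inj per k Re] \<open>\<alpha> < \<beta>\<close> by simp
  finally have "2 * pi * (2 * pi * integral {\<alpha>..\<beta>} (\<lambda>x. inverse (integral {0..2*pi} (\<lambda>y. D (Complex x y))))) \<le> 2 * pi * M"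
    by (simp add: power2_eq_square mult_ac)
  then show ?thesis by simp
qed

section \<open>Periodic homeomorphisms of strips\<close>

lemma image_cbox_Re_bounds:
  assumes "continuous_on S G" "cbox a b \<subseteq> S" "G ` S \<subseteq> strip L" "cbox a b \<noteq> {}"
  obtains m where "0 < m" "\<And>z. z \<in> cbox a b \<Longrightarrow> m < Re (G z) \<and> Re (G z) < L - m"
proof -
  let ?f = "\<lambda>z. min (Re (G z)) (L - Re (G z))"
  have "continuous_on (cbox a b) ?f"
    using continuous_on_subset[OF assms(1,2)] by (intro continuous_intros)
  then obtain z0 where z0: "z0 \<in> cbox a b" "\<And>z. z \<in> cbox a b \<Longrightarrow> ?f z0 \<le> ?f z"
    using continuous_attains_inf[of "cbox a b" ?f] assms(4) by (auto simp: compact_cbox)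
  have pos: "?f z0 > 0" using z0(1) assms by (auto simp: strip_def)
  define c where "c = ?f z0"
  have c: "c > 0" "\<And>z. z \<in> cbox a b \<Longrightarrow> c \<le> Re (G z) \<and> c \<le> L - Re (G z)"
    using pos z0(2) unfolding c_def by (auto simp only: min.bounded_iff)
  show ?thesis
  proof
    show "c / 2 > 0" using c by simp
    show "c / 2 < Re (G z) \<and> Re (G z) < L - c / 2" if "z \<in> cbox a b" for z
      using c(2)[OF that] c(1) by linarith
  qed
qed

text \<open>The logarithmic picture of a homeomorphism between two open annuli. \<open>k\<close> is
  its degree on the translation group; both signs occur. Nothing is assumed on the boundary
  lines.\<close>

locale strip_homeo =
  fixes L M :: real and F G :: "complex \<Rightarrow> complex" and k :: int
  assumes L: "L > 0" and M: "M > 0"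
    and contF: "continuous_on (strip L) F" and contG: "continuous_on (strip M) G"
    and F: "z \<in> strip L \<Longrightarrow> F z \<in> strip M" and GF: "z \<in> strip L \<Longrightarrow> G (F z) = z"
    and G: "w \<in> strip M \<Longrightarrow> G w \<in> strip L" and FG: "w \<in> strip M \<Longrightarrow> F (G w) = w"
    and per: "z \<in> strip L \<Longrightarrow> F (z + period) = F z + of_int k * period"
    and k: "k = 1 \<or> k = -1"
begin

lemma per_int:
  assumes "z \<in> strip L"
  shows "F (z + of_int n * period) = F z + of_int (n * k) * period"
  using periodic_int(2)[where S = "strip L" and F = F, OF per strip_shift(1) assms, of n] by (simp add: mult_ac)

lemma inverse_strip_homeo: "strip_homeo M L G F k"
proof
  fix w assume w: "w \<in> strip M"
  have kk: "k * k = 1" using k by auto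
  have "F (G w + of_int k * period) = w + period"
    using per_int[OF G[OF w], of k] by (simp add: kk FG[OF w] del: of_int_mult)
  moreover have "G w + of_int k * period \<in> strip L"
    using G[OF w] by (simp add: strip_def)
  ultimately show "G (w + period) = G w + of_int k * period"
    by (metis GF)
qed (use L M contF contG F G FG GF k in auto)

text \<open>\<open>M - w\<close> is a half turn about the centre of the strip, hence holomorphic. It
  exchanges the two ends and reverses the period, and it leaves Jacobian and dilatation alone, so
  statements about one end can be transported to the other.\<close>

lemma flip_target: "strip_homeo L M (\<lambda>z. M - F z) (\<lambda>w. G (M - w)) (-k)"
proof
  have *: "of_real M - w \<in> strip M" if "w \<in> strip M" for w
    using that by (auto simp: strip_def)
  show "continuous_on (strip L) (\<lambda>z. M - F z)" by (intro continuous_intros contF)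
  show "continuous_on (strip M) (\<lambda>w. G (M - w))"
    by (intro continuous_on_compose2[OF contG] continuous_intros) (use * in auto)
  show "- k = 1 \<or> - k = -1" using k by auto
  show "M - F (z + period) = M - F z + of_int (- k) * period" if "z \<in> strip L" for z
    using per[OF that] by simp
qed (use L M F G FG GF in \<open>auto simp: strip_def\<close>)

lemma flip_source: "strip_homeo L M (\<lambda>z. F (L - z)) (\<lambda>w. L - G w) (-k)"
  using strip_homeo.inverse_strip_homeo[OF strip_homeo.flip_target[OF inverse_strip_homeo]] .

section \<open>Behaviour of a strip homeomorphism at the two ends\<close>

lemma Re_periodic: "z \<in> strip L \<Longrightarrow> Re (F (z + of_int n * period)) = Re (F z)"
  by (subst per_int) simp_all

text \<open>The middle part of the strip is not compact, but \<open>Re (F z)\<close> is periodic, so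
  its values there are already taken on one compact rectangle of height 2 pi.\<close>

lemma Re_bounds_inside:
  assumes "0 < e" "2 * e < L"
  obtains m where "0 < m" "\<And>z. e \<le> Re z \<Longrightarrow> Re z \<le> L - e \<Longrightarrow> m < Re (F z) \<and> Re (F z) < M - m"
proof -
  let ?a = "Complex e 0" and ?b = "Complex (L - e) (2 * pi)"
  have "cbox ?a ?b \<subseteq> strip L" using assms by (auto simp: in_cbox_complex_iff strip_def)
  moreover have "?a \<in> cbox ?a ?b" using assms by (auto simp: in_cbox_complex_iff)
  ultimately obtain m where m: "0 < m" "\<And>z. z \<in> cbox ?a ?b \<Longrightarrow> m < Re (F z) \<and> Re (F z) < M - m"
    using image_cbox_Re_bounds[OF contF, of ?a ?b M] F by (metis empty_iff image_subsetI)
  show ?thesis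
  proof
    fix z assume z: "e \<le> Re z" "Re z \<le> L - e"
    define n where "n = - \<lfloor>Im z / (2 * pi)\<rfloor>"
    let ?z = "z + of_int n * period"
    have "0 \<le> Im z / (2*pi) + of_int n" "Im z / (2*pi) + of_int n \<le> 1"
      unfolding n_def by linarith+
    then have "0 \<le> Im ?z" "Im ?z \<le> 2 * pi"
      by (simp_all add: field_simps)
    then have "?z \<in> cbox ?a ?b" using z by (simp add: in_cbox_complex_iff)
    moreover have "z \<in> strip L" using z assms by (simp add: strip_def)
    ultimately show "m < Re (F z) \<and> Re (F z) < M - m"
      using m(2)[of ?z] Re_periodic by simp
  qed (rule m(1))
qed

text \<open>The preceding bound for \<open>G\<close>, read backwards: a point whose image lies in
  the middle of the target keeps a fixed distance from both ends of the source.\<close>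

lemma near_boundary:
  assumes "0 < e" "2 * e < M"
  obtains m where "0 < m" "\<And>z. z \<in> strip L \<Longrightarrow> Re z < m \<Longrightarrow> Re (F z) < e \<or> Re (F z) > M - e"
proof -
  obtain m where m: "0 < m" "\<And>z. e \<le> Re z \<Longrightarrow> Re z \<le> M - e \<Longrightarrow> m < Re (G z) \<and> Re (G z) < L - m"
    using strip_homeo.Re_bounds_inside[OF inverse_strip_homeo assms] by blast
  show ?thesis
  proof
    show "Re (F z) < e \<or> Re (F z) > M - e" if "z \<in> strip L" "Re z < m" for z
      using m(2)[of "F z"] that by (force simp: GF)
  qed (rule m(1))
qed

text \<open>The four possible limits at an end, uniformly in \<open>Im z\<close>. They are phrased
  inside the open strip because \<open>F\<close> is not yet known to extend. The two that end in
  \<open>left\<close> do not involve \<open>M\<close>, so outside the locale they take one argument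
  fewer.\<close>

definition left_to_left :: bool where
  "left_to_left \<longleftrightarrow> (\<forall>e>0. \<exists>d>0. \<forall>z\<in>strip L. Re z < d \<longrightarrow> Re (F z) < e)"

definition left_to_right :: bool where
  "left_to_right \<longleftrightarrow> (\<forall>e>0. \<exists>d>0. \<forall>z\<in>strip L. Re z < d \<longrightarrow> Re (F z) > M - e)"

definition right_to_left :: bool where
  "right_to_left \<longleftrightarrow> (\<forall>e>0. \<exists>d>0. \<forall>z\<in>strip L. Re z > L - d \<longrightarrow> Re (F z) < e)"

definition right_to_right :: bool where
  "right_to_right \<longleftrightarrow> (\<forall>e>0. \<exists>d>0. \<forall>z\<in>strip L. Re z > L - d \<longrightarrow> Re (F z) > M - e)"

text \<open>For small \<open>e\<close>, \<open>near_boundary\<close> leaves only values below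
  \<open>e\<close> or close to \<open>M\<close>; the latter contradict the crude bound
  \<open>e0\<close>, since \<open>e0 < M - e0\<close>.\<close>

lemma left_to_left_if_low:
  assumes e0: "0 < e0" "2 * e0 < M" and m0: "0 < m0"
    and low: "\<And>z. z \<in> strip L \<Longrightarrow> Re z < m0 \<Longrightarrow> Re (F z) < e0"
  shows left_to_left
  unfolding left_to_left_def
proof (intro allI impI)
  fix e :: real assume "e > 0"
  then have e: "0 < min e e0" "2 * min e e0 < M" using e0 by auto
  obtain m where m: "0 < m" "\<And>z. z \<in> strip L \<Longrightarrow> Re z < m \<Longrightarrow> Re (F z) < min e e0 \<or> Re (F z) > M - min e e0"
    using near_boundary[OF e] by blast
  have "Re (F z) < e" if "z \<in> strip L" "Re z < min m m0" for z
    using m(2)[of z] low[of z] that e0 by fastforce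
  then show "\<exists>d>0. \<forall>z\<in>strip L. Re z < d \<longrightarrow> Re (F z) < e"
    using m(1) m0 by (intro exI[of _ "min m m0"]) auto
qed

lemma flip_target_iff:
  shows "strip_homeo.left_to_left L (\<lambda>z. M - F z) \<longleftrightarrow> left_to_right"
    and "strip_homeo.left_to_right L M (\<lambda>z. M - F z) \<longleftrightarrow> left_to_left"
    and "strip_homeo.right_to_left L (\<lambda>z. M - F z) \<longleftrightarrow> right_to_right"
    and "strip_homeo.right_to_right L M (\<lambda>z. M - F z) \<longleftrightarrow> right_to_left"
proof -
  interpret s: strip_homeo L M "\<lambda>z. M - F z" "\<lambda>w. G (M - w)" "-k" by (rule flip_target)
  show "s.left_to_left \<longleftrightarrow> left_to_right"
    unfolding s.left_to_left_def left_to_right_def by (simp add: algebra_simps)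
  show "s.left_to_right \<longleftrightarrow> left_to_left"
    unfolding s.left_to_right_def left_to_left_def by (simp add: algebra_simps)
  show "s.right_to_left \<longleftrightarrow> right_to_right"
    unfolding s.right_to_left_def right_to_right_def by (simp add: algebra_simps)
  show "s.right_to_right \<longleftrightarrow> right_to_left"
    unfolding s.right_to_right_def right_to_left_def by (simp add: algebra_simps)
qed

lemma left_to_right_if_high:
  assumes e0: "0 < e0" "2 * e0 < M" and m0: "0 < m0"
    and high: "\<And>z. z \<in> strip L \<Longrightarrow> Re z < m0 \<Longrightarrow> Re (F z) > M - e0"
  shows left_to_right
proof -
  have "strip_homeo.left_to_left L (\<lambda>z. M - F z)"
    by (rule strip_homeo.left_to_left_if_low[OF flip_target e0 m0]) (use high in force)
  then show ?thesis by (simp add: flip_target_iff)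
qed

text \<open>The part of the strip near its left end is convex, hence connected, and
  \<open>Re (F z)\<close> avoids the middle third of the target there. If both outer thirds were
  met, the value \<open>M / 2\<close> would be attained.\<close>

lemma left_cases: "left_to_left \<or> left_to_right"
proof -
  define e0 where "e0 = M / 3"
  have e0: "0 < e0" "2 * e0 < M" using M by (auto simp: e0_def)
  obtain m0 where m0: "0 < m0" "\<And>z. z \<in> strip L \<Longrightarrow> Re z < m0 \<Longrightarrow> Re (F z) < e0 \<or> Re (F z) > M - e0"
    using near_boundary[OF e0] by blast
  let ?S = "{z \<in> strip L. Re z < m0}"
  have "?S = strip L \<inter> {z. Re z < m0}" by auto
  then have "convex ?S" by (simp add: convex_Int convex_halfspace_Re_lt)
  then have "connected ?S" by (rule convex_connected)
  moreover have "continuous_on ?S (\<lambda>z. Re (F z))"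
    by (intro continuous_intros continuous_on_subset[OF contF]) auto
  ultimately have "connected ((\<lambda>z. Re (F z)) ` ?S)" by (rule connected_continuous_image[rotated])
  then have int: "is_interval ((\<lambda>z. Re (F z)) ` ?S)" by (simp add: is_interval_connected_1)
  have "(\<forall>z\<in>?S. Re (F z) < e0) \<or> (\<forall>z\<in>?S. Re (F z) > M - e0)"
  proof (rule ccontr)
    assume "\<not> ?thesis"
    then obtain z w where zw: "z \<in> ?S" "w \<in> ?S" "Re (F z) < e0" "Re (F w) > M - e0"
      using m0(2) by blast
    have "Re (F z) \<in> (\<lambda>z. Re (F z)) ` ?S" "Re (F w) \<in> (\<lambda>z. Re (F z)) ` ?S"
      using zw by blast+
    moreover have "Re (F z) \<le> M / 2" "M / 2 \<le> Re (F w)" using zw e0 by linarith+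
    ultimately have "M / 2 \<in> (\<lambda>z. Re (F z)) ` ?S"
      using int unfolding is_interval_1 by blast
    then obtain v where "v \<in> ?S" "Re (F v) = M / 2" by auto
    then show False using m0(2)[of v] e0 by auto
  qed
  then show ?thesis
  proof
    assume "\<forall>z\<in>?S. Re (F z) < e0"
    then have left_to_left using left_to_left_if_low e0 m0 by blast
    then show ?thesis ..
  next
    assume "\<forall>z\<in>?S. Re (F z) > M - e0"
    then have left_to_right using left_to_right_if_high e0 m0 by blast
    then show ?thesis ..
  qed
qed

lemma flip_source_iff:
  shows "strip_homeo.left_to_left L (\<lambda>z. F (L - z)) \<longleftrightarrow> right_to_left"
    and "strip_homeo.left_to_right L M (\<lambda>z. F (L - z)) \<longleftrightarrow> right_to_right"
proof -
  interpret s: strip_homeo L M "\<lambda>z. F (L - z)" "\<lambda>w. L - G w" "-k" by (rule flip_source)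
  have *: "(\<forall>z\<in>strip L. Re z < d \<longrightarrow> P (F (L - z))) \<longleftrightarrow> (\<forall>z\<in>strip L. Re z > L - d \<longrightarrow> P (F z))" for d P
  proof (intro iffI ballI impI)
    fix z assume "\<forall>z\<in>strip L. Re z < d \<longrightarrow> P (F (L - z))" "z \<in> strip L" "Re z > L - d"
    then show "P (F z)" by (auto simp: strip_def dest!: spec[of _ "of_real L - z"] bspec[of _ _ "of_real L - z"])
  next
    fix z assume "\<forall>z\<in>strip L. Re z > L - d \<longrightarrow> P (F z)" "z \<in> strip L" "Re z < d"
    then show "P (F (L - z))" by (auto simp: strip_def dest!: bspec[of _ _ "of_real L - z"])
  qed
  show "s.left_to_left \<longleftrightarrow> right_to_left"
    unfolding s.left_to_left_def right_to_left_def using *[where P = "\<lambda>w. Re w < _"] by simp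
  show "s.left_to_right \<longleftrightarrow> right_to_right"
    unfolding s.left_to_right_def right_to_right_def using *[where P = "\<lambda>w. Re w > _"] by simp
qed

lemma right_cases: "right_to_left \<or> right_to_right"
  using strip_homeo.left_cases[OF flip_source] by (simp add: flip_source_iff)

text \<open>Otherwise \<open>Re (F z)\<close> stays away from \<open>M\<close> near both ends and,
  by compactness modulo the period, also in the middle. Then \<open>F\<close> misses a point close
  to the right side, although it is onto.\<close>

lemma not_both_left: "\<not> (left_to_left \<and> right_to_left)"
proof
  assume *: "left_to_left \<and> right_to_left"
  define e0 where "e0 = M / 3"
  have e0: "0 < e0" "2 * e0 < M" using M by (auto simp: e0_def)
  obtain d1 where d1: "d1 > 0" "\<forall>z\<in>strip L. Re z < d1 \<longrightarrow> Re (F z) < e0"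
    using * e0(1) unfolding left_to_left_def by blast
  obtain d2 where d2: "d2 > 0" "\<forall>z\<in>strip L. Re z > L - d2 \<longrightarrow> Re (F z) < e0"
    using * e0(1) unfolding right_to_left_def by blast
  note d = d1(1) d2(1) d1(2)[rule_format] d2(2)[rule_format]
  define d where "d = min (min d1 d2) (L / 3)"
  have d': "0 < d" "2 * d < L" "d \<le> d1" "d \<le> d2" using d L by (auto simp: d_def)
  obtain m where m: "0 < m" "\<And>z. d \<le> Re z \<Longrightarrow> Re z \<le> L - d \<Longrightarrow> m < Re (F z) \<and> Re (F z) < M - m"
    using Re_bounds_inside[OF d'(1,2)] by blast
  define m' where "m' = min m e0"
  have bound: "Re (F z) < M - m'" if "z \<in> strip L" for z
  proof -
    consider "Re z < d1" | "Re z > L - d2" | "d \<le> Re z" "Re z \<le> L - d" using d' by linarith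
    then show ?thesis using d(3,4)[OF that] m(2)[of z] e0 by cases (auto simp: m'_def)
  qed
  define w where "w = complex_of_real (M - m' / 2)"
  have m': "0 < m'" "m' < M" using m e0 by (auto simp: m'_def)
  then have w: "w \<in> strip M" by (auto simp: strip_def w_def)
  show False using bound[OF G[OF w]] m' by (simp add: FG[OF w]) (simp add: w_def)
qed

lemma ends: "left_to_left \<and> right_to_right \<or> left_to_right \<and> right_to_left"
  using left_cases right_cases not_both_left strip_homeo.not_both_left[OF flip_target]
  by (auto simp: flip_target_iff)

text \<open>Horizontal segments are cut at distance \<open>d\<close> from both ends because
  \<open>F\<close> has no boundary values yet; each end costs at most \<open>e / 2\<close>. The
  uniformity of the end conditions lets one \<open>d\<close> serve all heights
  \<open>y\<close>.\<close>

lemma crossing_length_aux: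
  assumes "0 < e" and *: left_to_left right_to_right
  shows "\<exists>d>0. 2 * d < L \<and> (\<forall>y. M - e \<le> cmod (F (Complex (L - d) y) - F (Complex d y)))"
proof -
  have e: "e / 2 > 0" using assms by simp
  obtain d1 where d1: "d1 > 0" "\<forall>z\<in>strip L. Re z < d1 \<longrightarrow> Re (F z) < e / 2"
    using * e unfolding left_to_left_def by blast
  obtain d2 where d2: "d2 > 0" "\<forall>z\<in>strip L. L - d2 < Re z \<longrightarrow> M - e / 2 < Re (F z)"
    using * e unfolding right_to_right_def by blast
  define d where "d = min (min d1 d2) (L / 2) / 2"
  have d: "0 < d" "2 * d < L" "d < d1" "d < d2" using d1 d2 L by (auto simp: d_def min_def)
  have "M - e \<le> cmod (F (Complex (L - d) y) - F (Complex d y))" for y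
    using d1(2)[rule_format, of "Complex d y"] d2(2)[rule_format, of "Complex (L - d) y"] d
      abs_Re_le_cmod[of "F (Complex (L - d) y) - F (Complex d y)"] by (simp add: strip_def)
  then show ?thesis using d by blast
qed

lemma crossing_length:
  assumes "0 < e"
  obtains d where "0 < d" "2 * d < L"
    "\<And>y. M - e \<le> cmod (F (Complex (L - d) y) - F (Complex d y))"
proof -
  have "\<exists>d>0. 2 * d < L \<and> (\<forall>y. M - e \<le> cmod (F (Complex (L - d) y) - F (Complex d y)))"
    using ends
  proof
    assume "left_to_left \<and> right_to_right"
    then show ?thesis using crossing_length_aux[OF assms] by blast
  next
    assume "left_to_right \<and> right_to_left"
    then show ?thesis
      using strip_homeo.crossing_length_aux[OF flip_target assms]
      by (simp add: flip_target_iff norm_minus_commute)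
  qed
  then show ?thesis using that by blast
qed

text \<open>The stretch condition holds in the open strip only, so one works on the shortened
  segments of \<open>crossing_length\<close> and loses \<open>e\<close> in the image length. The
  integral of \<open>D\<close> is nevertheless taken over the full width: the bound then contains
  the same \<open>?Y\<close> for every \<open>e\<close>, and \<open>e\<close> may tend to 0.\<close>

lemma upper_module_bound:
  assumes C1: "C1_wirtinger_on (strip L) F fz fzb"
    and jac: "\<And>z. z \<in> strip L \<Longrightarrow> jac fz fzb z \<ge> 0"
    and D: "continuous_on (cstrip 0 L) D" "\<And>z. z \<in> cstrip 0 L \<Longrightarrow> D z > 0"
    and le: "\<And>z. z \<in> strip L \<Longrightarrow> (cmod (fz z + fzb z))\<^sup>2 \<le> D z * jac fz fzb z"
  shows "M * integral {0..2*pi} (\<lambda>y. inverse (integral {0..L} (\<lambda>x. D (Complex x y)))) \<le> 2 * pi"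
proof -
  let ?Y = "integral {0..2*pi} (\<lambda>y. inverse (integral {0..L} (\<lambda>x. D (Complex x y))))"
  have S: "Complex x y \<in> cstrip 0 L" if "x \<in> {0..L}" for x y
    using that by (auto simp: cstrip_def)
  have main: "(M - e)\<^sup>2 * ?Y \<le> 2 * pi * M" if e: "0 < e" "e < M" for e
  proof -
    obtain d where d: "0 < d" "2 * d < L" and cr: "\<And>y. M - e \<le> cmod (F (Complex (L - d) y) - F (Complex d y))"
      using crossing_length[OF e(1)] by blast
    have sub: "cstrip d (L - d) \<subseteq> strip L" using d by (auto simp: cstrip_def strip_def)
    have sub2: "cstrip d (L - d) \<subseteq> cstrip 0 L" using d by (auto simp: cstrip_def strip_def)
    have Sd: "Complex x y \<in> cstrip d (L - d)" if "x \<in> {d..L - d}" for x y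
      using that by (auto simp: cstrip_def)
    have cJ: "continuous_on (cstrip d (L - d)) (jac fz fzb)"
      using C1 sub unfolding C1_wirtinger_on_def by (meson continuous_on_jac continuous_on_subset)
    have cD: "continuous_on (cstrip d (L - d)) D"
      by (rule continuous_on_subset[OF D(1) sub2])
    have "(M - e)\<^sup>2 * ?Y \<le> integral {0..2*pi} (\<lambda>y. integral {d..L-d} (\<lambda>x. jac fz fzb (Complex x y)))"
    proof (rule integral_inverse_le_of_square_le)
      fix y :: real assume "y \<in> {0..2*pi}"
      have *: "((\<lambda>t. F (Complex t y)) has_vector_derivative (fz (Complex x y) + fzb (Complex x y))) (at x within {d..L-d})"
        if "x \<in> {d..L-d}" for x
        using C1 sub Sd[OF that] unfolding C1_wirtinger_on_def by (intro has_wirtinger_horizontal) blast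
      have la: "(cmod (F (Complex (L - d) y) - F (Complex d y)))\<^sup>2 \<le>
        integral {d..L-d} (\<lambda>x. D (Complex x y)) * integral {d..L-d} (\<lambda>x. jac fz fzb (Complex x y))"
      proof (rule length_area(1)[OF _ *])
        show "continuous_on {d..L - d} (\<lambda>x. D (Complex x y))"
          "continuous_on {d..L - d} (\<lambda>x. jac fz fzb (Complex x y))"
          by (auto intro!: continuous_on_integral_Complex(5)[OF cJ, where c = y and d = y]
              continuous_on_integral_Complex(5)[OF cD, where c = y and d = y] Sd)
      qed ((use d in linarith), (use Sd sub sub2 D(2) jac le in blast)+)
      have pos: "integral {d..L-d} (\<lambda>x. jac fz fzb (Complex x y)) \<ge> 0"
      proof (rule Henstock_Kurzweil_Integration.integral_nonneg)
        show "(\<lambda>x. jac fz fzb (Complex x y)) integrable_on {d..L - d}"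
          by (auto intro!: integrable_continuous_real continuous_on_integral_Complex(5)[OF cJ, where c = y and d = y] Sd)
        show "0 \<le> jac fz fzb (Complex x y)" if "x \<in> {d..L - d}" for x
          using jac sub Sd[OF that] by blast
      qed
      have cDy: "continuous_on {0..L} (\<lambda>x. D (Complex x y))"
        by (auto intro!: continuous_on_integral_Complex(5)[OF D(1), where c = y and d = y] S)
      have le: "integral {d..L-d} (\<lambda>x. D (Complex x y)) \<le> integral {0..L} (\<lambda>x. D (Complex x y))"
      proof (rule integral_subset_le)
        show "(\<lambda>x. D (Complex x y)) integrable_on {d..L - d}" "(\<lambda>x. D (Complex x y)) integrable_on {0..L}"
          using cDy d by (auto intro!: integrable_continuous_real intro: continuous_on_subset)
        show "\<forall>x\<in>{0..L}. 0 \<le> D (Complex x y)" using D(2) S by (meson less_imp_le)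
      qed (use d in auto)
      have "(M - e)\<^sup>2 \<le> (cmod (F (Complex (L - d) y) - F (Complex d y)))\<^sup>2"
        using cr e by (intro power_mono) auto
      also note la
      also have "integral {d..L-d} (\<lambda>x. D (Complex x y)) * integral {d..L-d} (\<lambda>x. jac fz fzb (Complex x y)) \<le>
         integral {0..L} (\<lambda>x. D (Complex x y)) * integral {d..L-d} (\<lambda>x. jac fz fzb (Complex x y))"
        using le pos by (rule mult_right_mono)
      finally show "(M - e)\<^sup>2 \<le> integral {0..L} (\<lambda>x. D (Complex x y)) * integral {d..L-d} (\<lambda>x. jac fz fzb (Complex x y))" .
      show "integral {0..L} (\<lambda>x. D (Complex x y)) > 0"
      proof (rule length_area(2)[OF L, where \<phi> = "\<lambda>_. 0" and \<phi>' = "\<lambda>_. 0" and J = "\<lambda>_. 0"])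
      qed (use cDy D(2) S in auto)
    qed (use continuous_on_integral_Complex(2)[OF cJ Sd] continuous_on_integral_Complex(2)[OF D(1) S] in auto)
    also have "\<dots> = integral {d..L-d} (\<lambda>x. integral {0..2*pi} (\<lambda>y. jac fz fzb (Complex x y)))"
      using continuous_on_integral_Complex(3)[OF cJ Sd] by simp
    also have "\<dots> \<le> 2 * pi * M"
    proof (rule cell_area_le[OF _ _ C1 sub])
      show "inj_on F (cstrip d (L - d))" using GF sub by (metis inj_onI subsetD)
      show "F (z + period) = F z + of_int k * period" if "z \<in> cstrip d (L - d)" for z
        using that sub by (intro per) auto
      show "0 \<le> Re (F z) \<and> Re (F z) \<le> M" if "z \<in> cstrip d (L - d)" for z
        using that sub F by (force simp: strip_def)
    qed (use d M k jac sub in auto)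
    finally show ?thesis .
  qed
  have "((\<lambda>e. (M - e)\<^sup>2 * ?Y) \<longlongrightarrow> (M - 0)\<^sup>2 * ?Y) (at_right 0)"
    by (intro tendsto_intros)
  moreover have "eventually (\<lambda>e. (M - e)\<^sup>2 * ?Y \<le> 2 * pi * M) (at_right 0)"
    using M main by (auto simp: eventually_at_right[of 0 1] intro!: exI[of _ M])
  ultimately have "(M - 0)\<^sup>2 * ?Y \<le> 2 * pi * M"
    by (intro tendsto_upperbound) auto
  then have "M * (M * ?Y) \<le> M * (2 * pi)" by (simp add: power2_eq_square mult_ac)
  then show ?thesis using M by simp
qed

end

section \<open>Boundary behaviour of quasiconformal maps\<close>

lemma C1_wirtinger_on_flip_target:
  assumes "C1_wirtinger_on U F fz fzb"
  shows "C1_wirtinger_on U (\<lambda>z. c - F z) (\<lambda>z. - fz z) (\<lambda>z. - fzb z)"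
  using assms unfolding C1_wirtinger_on_def has_wirtinger_def
  by (auto intro!: continuous_intros derivative_eq_intros simp: algebra_simps)

lemma has_wirtinger_compose_holomorphic:
  assumes h: "(h has_field_derivative h') (at z)" and F: "has_wirtinger F a b (h z)"
  shows "has_wirtinger (\<lambda>z. F (h z)) (a * h') (b * cnj h') z"
proof -
  have "(h has_derivative (\<lambda>t. h' * t)) (at z)" using h by (simp add: has_field_derivative_def)
  from has_derivative_compose[OF this F[unfolded has_wirtinger_def]] show ?thesis
    unfolding has_wirtinger_def by (simp add: mult_ac)
qed

lemma has_wirtinger_holomorphic_compose:
  assumes h: "(h has_field_derivative h') (at (F z))" and F: "has_wirtinger F a b z"
  shows "has_wirtinger (\<lambda>z. h (F z)) (h' * a) (h' * b) z"
proof -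
  have "(h has_derivative (\<lambda>t. h' * t)) (at (F z))" using h by (simp add: has_field_derivative_def)
  from has_derivative_compose[OF F[unfolded has_wirtinger_def] this] show ?thesis
    unfolding has_wirtinger_def by (simp add: algebra_simps)
qed

lemma C1_wirtinger_on_flip_source:
  assumes "C1_wirtinger_on (strip L) F fz fzb"
  shows "C1_wirtinger_on (strip L) (\<lambda>z. F (L - z)) (\<lambda>z. - fz (L - z)) (\<lambda>z. - fzb (L - z))"
proof -
  have *: "of_real L - z \<in> strip L" if "z \<in> strip L" for z using that by (simp add: strip_def)
  have "continuous_on (strip L) (\<lambda>z. fz (L - z))" "continuous_on (strip L) (\<lambda>z. fzb (L - z))"
    using assms unfolding C1_wirtinger_on_def
    by (auto intro!: continuous_intros * intro: continuous_on_compose2[where t = "strip L"])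
  moreover have "has_wirtinger (\<lambda>z. F (L - z)) (- fz (L - z)) (- fzb (L - z)) z" if "z \<in> strip L" for z :: complex
  proof -
    have 1: "((\<lambda>z. complex_of_real L - z) has_field_derivative -1) (at z)"
      by (auto intro!: derivative_eq_intros)
    show ?thesis
      using has_wirtinger_compose_holomorphic[OF 1, of F] assms *[OF that]
      unfolding C1_wirtinger_on_def by force
  qed
  ultimately show ?thesis unfolding C1_wirtinger_on_def by (auto intro: continuous_on_minus)
qed

lemma closure_strip:
  assumes "L > 0" shows "closure (strip L) = cstrip 0 L"
proof
  have "strip L \<subseteq> cstrip 0 L" by (auto simp: strip_def cstrip_def)
  then show "closure (strip L) \<subseteq> cstrip 0 L" by (simp add: closure_minimal)
  show "cstrip 0 L \<subseteq> closure (strip L)"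
  proof
    fix z assume z: "z \<in> cstrip 0 L"
    \<comment> \<open>The point \<open>z\<close> is moved horizontally towards the middle line by
      the fraction \<open>1 / (n + 2)\<close> of its distance to it, which lands strictly
      inside.\<close>
    define w where "w n = z + of_real ((L / 2 - Re z) / (real n + 2))" for n :: nat
    have "w n \<in> strip L" for n
    proof -
      have "Re (w n) = Re z + (L / 2 - Re z) / (real n + 2)" by (simp add: w_def del: of_real_divide of_real_diff)
      also have "\<dots> = (Re z * (real n + 1) + L / 2) / (real n + 2)"
        by (simp add: field_simps)
      finally have eq: "Re (w n) = (Re z * (real n + 1) + L / 2) / (real n + 2)" .
      have "0 < Re z * (real n + 1) + L / 2" using z assms by (auto simp: cstrip_def add_nonneg_pos)
      moreover have "Re z * (real n + 1) \<le> L * (real n + 1)"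
        using z by (intro mult_right_mono) (auto simp: cstrip_def)
      ultimately show ?thesis
        using assms by (simp add: strip_def eq field_simps)
    qed
    moreover have "w \<longlonglongrightarrow> z + of_real 0"
      unfolding w_def
    proof (intro tendsto_intros)
      have "(\<lambda>n. inverse (real n + 2)) \<longlonglongrightarrow> 0"
        using LIMSEQ_ignore_initial_segment[OF lim_inverse_n, of 2] by (simp add: algebra_simps)
      from tendsto_mult[OF tendsto_const[of "L / 2 - Re z"] this]
      show "(\<lambda>n. (L / 2 - Re z) / (real n + 2)) \<longlonglongrightarrow> 0" by (simp add: field_simps)
    qed
    ultimately show "z \<in> closure (strip L)" unfolding closure_sequential by auto
  qed
qed

context strip_homeo
begin

text \<open>Pull back by \<open>G\<close> the horizontal ray from \<open>F z\<close> to the right.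
  It starts in the truncated half disc \<open>A\<close> and must leave it, since
  \<open>Re (F w)\<close> has a maximum below \<open>M\<close> on the compact set \<open>K\<close>.
  It cannot leave through the line \<open>Re w = d\<close>, where the images lie to the left of
  \<open>F z\<close>; so it leaves through the arc.\<close>

lemma ray_hits_arc:
  fixes \<eta> \<rho> :: real
  assumes z: "z \<in> strip L" "cmod (z - \<i> * \<eta>) < \<rho>" and "\<rho> < L" and d: "d > 0"
    and low: "\<And>w. w \<in> strip L \<Longrightarrow> Re w \<le> d \<Longrightarrow> Re (F w) < Re (F z)"
  obtains w where "w \<in> strip L" "Re w > d" "cmod (w - \<i> * \<eta>) = \<rho>" "Im (F w) = Im (F z)"
proof -
  define A where "A = {w. d < Re w} \<inter> ball (\<i> * \<eta>) \<rho>"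
  define K where "K = {w. d \<le> Re w} \<inter> cball (\<i> * \<eta>) \<rho>"
  have "d < Re z" using low[OF z(1)] by force
  then have zA: "z \<in> A" using z by (simp add: A_def dist_norm norm_minus_commute)
  have openA: "open A" unfolding A_def by (intro open_Int open_halfspace_Re_gt open_ball)
  have compK: "compact K"
    unfolding K_def by (intro closed_Int_compact closed_halfspace_Re_ge compact_cball)
  have AK: "A \<subseteq> K" by (auto simp: A_def K_def)
  have KL: "K \<subseteq> strip L"
  proof
    fix w assume w: "w \<in> K"
    have "Re w = Re (w - \<i> * \<eta>)" by simp
    also have "\<dots> \<le> cmod (w - \<i> * \<eta>)" by (rule complex_Re_le_cmod)
    also have "\<dots> \<le> \<rho>" using w by (simp add: K_def dist_norm norm_minus_commute)
    finally show "w \<in> strip L" using w d \<open>\<rho> < L\<close> by (simp add: K_def strip_def)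
  qed
  have "continuous_on K (\<lambda>w. Re (F w))"
    by (intro continuous_intros continuous_on_subset[OF contF KL])
  then obtain w0 where w0: "w0 \<in> K" "\<And>w. w \<in> K \<Longrightarrow> Re (F w) \<le> Re (F w0)"
    using continuous_attains_sup[OF compK] zA AK by (metis empty_iff subsetD)
  have m: "Re (F w0) < M" using F KL w0(1) by (auto simp: strip_def)
  have Fz: "F z \<in> strip M" by (rule F[OF z(1)])
  define T where "T = {0..<M - Re (F z)}"
  define \<gamma> where "\<gamma> t = G (F z + of_real t)" for t :: real
  have T: "F z + of_real t \<in> strip M" if "t \<in> T" for t
    using that Fz by (auto simp: strip_def T_def)
  have "continuous_on T \<gamma>"
    unfolding \<gamma>_def by (intro continuous_on_compose2[OF contG] continuous_intros) (use T in auto)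
  moreover have "connected T" unfolding T_def by (rule convex_connected) (rule convex_real_interval)
  ultimately have conn: "connected (\<gamma> ` T)" by (rule connected_continuous_image)
  have "0 \<in> T" using Fz by (auto simp: T_def strip_def)
  then have "\<gamma> ` T \<inter> A \<noteq> {}" using zA GF[OF z(1)] by (auto simp: \<gamma>_def intro!: exI[of _ z] image_eqI[of _ _ 0])
  moreover have "\<gamma> ` T - A \<noteq> {}"
  proof -
    \<comment> \<open>Halfway between the maximum of \<open>Re (F w)\<close> on \<open>K\<close> and
      the right side of the target strip.\<close>
    define t where "t = (M + Re (F w0)) / 2 - Re (F z)"
    have "Re (F z) \<le> Re (F w0)" using w0 zA AK by auto
    then have t: "t \<in> T" using m by (auto simp: T_def t_def)
    have "Re (F (\<gamma> t)) = (M + Re (F w0)) / 2"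
      using FG[OF T[OF t]] by (simp add: \<gamma>_def t_def)
    then have "\<gamma> t \<notin> K" using w0(2)[of "\<gamma> t"] m by auto
    then show ?thesis using t AK by blast
  qed
  ultimately obtain w where w: "w \<in> \<gamma> ` T" "w \<in> frontier A"
    using connected_Int_frontier[OF conn] by blast
  have "w \<in> K - A"
    using w(2) openA closure_minimal[OF AK compact_imp_closed[OF compK]]
    by (auto simp: frontier_def interior_open)
  obtain t where t: "t \<in> T" "w = \<gamma> t" using w by blast
  have Fw: "F w = F z + of_real t" using FG[OF T[OF t(1)]] t by (simp add: \<gamma>_def)
  have wL: "w \<in> strip L" using \<open>w \<in> K - A\<close> KL by blast
  have "Re w > d" using low[OF wL] Fw t(1) by (force simp: T_def)
  moreover have "cmod (w - \<i> * \<eta>) = \<rho>"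
    using \<open>w \<in> K - A\<close> calculation by (auto simp: K_def A_def dist_norm norm_minus_commute)
  ultimately show ?thesis using that[of w] wL Fw by simp
qed

text \<open>Courant--Lebesgue: some half circle with centre \<open>i\<eta>\<close> and radius between \<open>exp s0\<close> and
  \<open>exp s1\<close> has a short image, and horizontal rays from the image of the smaller half disc have
  to cross it.\<close>
lemma boundary_oscillation:
  fixes \<eta> s0 s1 K :: real
  assumes C1: "C1_wirtinger_on (strip L) F fz fzb"
    and jac: "\<And>z. z \<in> strip L \<Longrightarrow> jac fz fzb z \<ge> 0"
    and K: "K > 0" "\<And>z. z \<in> strip L \<Longrightarrow> (cmod (fz z) + cmod (fzb z))\<^sup>2 \<le> K * jac fz fzb z"
    and left: left_to_left
    and s: "s0 < s1" "exp s1 < L" "exp s1 \<le> 3"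
    and z1: "z1 \<in> strip L" "cmod (z1 - \<i> * \<eta>) < exp s0"
    and z2: "z2 \<in> strip L" "cmod (z2 - \<i> * \<eta>) < exp s0"
  shows "(Im (F z1) - Im (F z2))\<^sup>2 \<le> pi * K * (2 * pi * M / (s1 - s0))"
proof -
  let ?e = "min (Re (F z1)) (Re (F z2))"
  \<comment> \<open>\<open>?e\<close> is the smaller of the two real parts. Points with
    \<open>Re w \<le> d\<close> will have images to the left of both \<open>F z1\<close> and
    \<open>F z2\<close>, so \<open>ray_hits_arc\<close> applies to either with the same
    \<open>d\<close>.\<close>
  have "?e > 0" using F[OF z1(1)] F[OF z2(1)] by (auto simp: strip_def)
  then obtain d0 where d0: "d0 > 0" "\<forall>z\<in>strip L. Re z < d0 \<longrightarrow> Re (F z) < ?e"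
    using left unfolding left_to_left_def by blast
  define d where "d = d0 / 2"
  have d: "d > 0" using d0 by (simp add: d_def)
  have low: "Re (F w) < ?e" if "w \<in> strip L" "Re w \<le> d" for w
    using d0 that by (auto simp: d_def)
  have "d < Re z1" using low[OF z1(1)] by force
  also have "\<dots> = Re (z1 - \<i> * \<eta>)" by simp
  also have "\<dots> < exp s0" using complex_Re_le_cmod[of "z1 - \<i> * \<eta>"] z1(2) by linarith
  finally have ds0: "d < exp s0" .
  \<comment> \<open>A point at distance at most \<open>exp s1\<close> from the centre whose real
    part exceeds that of the centre by more than \<open>d\<close> is seen from there under an angle
    below \<open>\<phi>0\<close>. As \<open>\<phi>0 < pi / 2\<close>, the rectangle
    \<open>?Q\<close> is mapped into the strip.\<close>
  define \<phi>0 where "\<phi>0 = arccos (d * exp (- s1))"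
  have dl: "0 < d * exp (- s1)" "d * exp (- s1) < 1"
    using d ds0 s(1) less_trans[OF ds0, of "exp s1"] by (auto simp: exp_minus field_simps)
  have cos\<phi>0: "cos \<phi>0 = d * exp (- s1)" unfolding \<phi>0_def using dl by (intro cos_arccos) auto
  have \<phi>0: "0 < \<phi>0" "\<phi>0 < pi / 2"
  proof -
    have "arccos 1 < \<phi>0" unfolding \<phi>0_def using dl by (intro arccos_less_arccos) auto
    then show "0 < \<phi>0" by simp
    have "\<phi>0 < arccos 0" unfolding \<phi>0_def using dl by (intro arccos_less_arccos) auto
    then show "\<phi>0 < pi / 2" by simp
  qed
  \<comment> \<open>Logarithmic polar coordinates about the boundary point: half circles become
    vertical segments, and since \<open>c\<close> is holomorphic the constant \<open>K\<close> does
    not change.\<close>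
  define c where "c w = \<i> * \<eta> + exp w" for w
  define P where "P w = F (c w)" for w
  define pz where "pz w = fz (c w) * exp w" for w
  define pzb where "pzb w = fzb (c w) * cnj (exp w)" for w
  define U where "U = c -` strip L"
  have contc: "continuous_on A c" for A unfolding c_def by (intro continuous_intros)
  have "open U" unfolding U_def by (rule open_vimage[OF open_strip contc])
  have C1P: "C1_wirtinger_on U P pz pzb"
    unfolding C1_wirtinger_on_def
  proof (intro conjI ballI)
    show "open U" by fact
    show "continuous_on U pz" "continuous_on U pzb" unfolding pz_def pzb_def
      using C1 unfolding C1_wirtinger_on_def
      by (auto intro!: continuous_intros continuous_on_compose2[OF _ contc] simp: U_def)
    fix w assume w: "w \<in> U"
    have "(c has_field_derivative exp w) (at w)" unfolding c_def by (auto intro!: derivative_eq_intros)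
    then show "has_wirtinger P (pz w) (pzb w) w"
      unfolding P_def pz_def pzb_def using C1 w unfolding C1_wirtinger_on_def U_def
      by (intro has_wirtinger_compose_holomorphic) auto
  qed
  let ?Q = "cbox (Complex s0 (-\<phi>0)) (Complex s1 \<phi>0)"
  have QU: "?Q \<subseteq> U"
  proof
    fix w assume w: "w \<in> ?Q"
    then have w': "s0 \<le> Re w" "Re w \<le> s1" "\<bar>Im w\<bar> \<le> \<phi>0" by (auto simp: in_cbox_complex_iff)
    then have "cos (Im w) > 0" using \<phi>0 by (intro cos_gt_zero_pi) auto
    moreover have "exp (Re w) * cos (Im w) \<le> exp s1 * 1"
      using w' \<open>cos (Im w) > 0\<close> by (intro mult_mono) auto
    ultimately show "w \<in> U" using s by (simp add: U_def c_def strip_def Re_exp)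
  qed
  have jacP: "jac pz pzb w = (cmod (exp w))\<^sup>2 * jac fz fzb (c w)" for w
    by (simp add: jac_def pz_def pzb_def norm_mult power_mult_distrib algebra_simps)
  have jacP0: "jac pz pzb w \<ge> 0" if "w \<in> U" for w
    using jac that by (simp add: jacP U_def)
  have contJ: "continuous_on U (jac pz pzb)"
    using C1P unfolding C1_wirtinger_on_def by (intro continuous_on_jac) auto
  have QC: "Complex x y \<in> U" if "x \<in> {s0..s1}" "y \<in> {-\<phi>0..\<phi>0}" for x y
    using that QU by (auto simp: in_cbox_complex_iff)
  define I where "I = (\<lambda>x. integral {-\<phi>0..\<phi>0} (\<lambda>y. jac pz pzb (Complex x y)))"
  have contI: "continuous_on {s0..s1} I"
    unfolding I_def by (rule continuous_on_integral_Complex(1)[OF contJ QC])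
  have area: "integral {s0..s1} I \<le> 2 * pi * M"
    unfolding I_def
  proof (rule area_le_of_injective_mod_period[OF _ _ _ C1P QU])
    show "0 \<le> jac pz pzb w" if "w \<in> ?Q" for w using that jacP0 QU by blast
    show "0 \<le> Re (P w) \<and> Re (P w) \<le> M" if "w \<in> ?Q" for w
      using that QU F by (force simp: P_def U_def strip_def)
    fix z w j
    assume z: "z \<in> box (Complex s0 (- \<phi>0)) (Complex s1 \<phi>0)"
      and w: "w \<in> box (Complex s0 (- \<phi>0)) (Complex s1 \<phi>0)"
      and eq: "P z = P w + 2 * pi * of_int j * \<i>"
    have zU: "c z \<in> strip L" "c w \<in> strip L"
      using z w QU box_subset_cbox[of "Complex s0 (- \<phi>0)"] by (auto simp: U_def)
    have kk: "j * k * k = j" using k by auto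
    let ?w = "c w + of_int (j * k) * period"
    have "?w \<in> strip L" using zU by (simp add: strip_def)
    moreover have "F ?w = F (c w) + of_int (j * k * k) * period"
      by (rule per_int[OF zU(2)])
    then have "F ?w = F (c z)" using eq unfolding kk by (simp add: P_def mult_ac)
    ultimately have "?w = c z" using GF zU by metis
    then have "exp z = exp w + of_int (j * k) * period" by (simp add: c_def algebra_simps)
    \<comment> \<open>This is what \<open>exp s1 \<le> 3\<close> is for: a half disc of radius at
      most 3 has diameter at most 6, less than 2 pi, so it contains no two points that differ by a
      nonzero multiple of the period.\<close>
    then have "cmod (of_int (j * k) * period) = cmod (exp z - exp w)" by simp
    also have "\<dots> \<le> exp (Re z) + exp (Re w)" by (metis norm_exp_eq_Re norm_triangle_ineq4)
    also have "\<dots> \<le> exp s1 + exp s1" using z w by (intro add_mono) (auto simp: in_box_complex_iff)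
    also have "\<dots> < 2 * pi" using s(3) pi_gt3 by simp
    finally have "\<bar>of_int (j * k)\<bar> < (1::real)" by (simp add: norm_mult abs_mult)
    then have "j * k = 0" by linarith
    then have "?w = c w" by (simp only: of_int_0 mult_zero_left add_0_right)
    then have "c w = c z" using \<open>?w = c z\<close> by (rule subst)
    then have "exp z = exp w" by (simp add: c_def)
    moreover have "\<bar>Im z - Im w\<bar> < 2 * pi" using z w \<phi>0 by (auto simp: in_box_complex_iff)
    ultimately show "z = w" by (simp add: exp_complex_eqI)
  qed (use s \<phi>0 M in auto)
  \<comment> \<open>\<open>C\<close> is an upper bound for the mean of \<open>I\<close> over the
    logarithmic radii, so some radius has at most this value.\<close>
  define C where "C = 2 * pi * M / (s1 - s0)"
  obtain x where x: "x \<in> {s0..s1}" "I x \<le> C"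
  proof -
    have False if *: "\<And>x. x \<in> {s0..s1} \<Longrightarrow> I x > C"
    proof -
      have "integral {s0..s1} (\<lambda>_. C) < integral {s0..s1} I"
        using contI s(1) * by (intro integral_less_real) auto
      moreover have "(s1 - s0) * C = 2 * pi * M"
        using C_def s(1) by (simp add: eq_divide_eq mult.commute)
      ultimately show False using area s(1) by simp
    qed
    then show ?thesis using that by force
  qed
  \<comment> \<open>The length-area inequality on the chosen arc with \<open>D\<close> constantly
    \<open>K\<close>. The angle \<open>b - a\<close> is at most \<open>2 * \<phi>0 < pi\<close>,
    whence the factor \<open>pi * K\<close>.\<close>
  have osc: "(cmod (P (Complex x b) - P (Complex x a)))\<^sup>2 \<le> pi * K * C"
    if ab: "a < b" "a \<in> {-\<phi>0..\<phi>0}" "b \<in> {-\<phi>0..\<phi>0}" for a b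
  proof -
    have y: "Complex x y \<in> U" if "y \<in> {a..b}" for y using that ab x by (intro QC) auto
    have contJx: "continuous_on {-\<phi>0..\<phi>0} (\<lambda>y. jac pz pzb (Complex x y))"
      by (rule continuous_on_integral_Complex(4)[OF contJ QC x(1)])
    have sub: "{a..b} \<subseteq> {-\<phi>0..\<phi>0}" using ab by auto
    have "(cmod (P (Complex x b) - P (Complex x a)))\<^sup>2
      \<le> integral {a..b} (\<lambda>_. K) * integral {a..b} (\<lambda>y. jac pz pzb (Complex x y))"
    proof (rule length_area(1)[where \<phi>' = "\<lambda>y. \<i> * (pz (Complex x y) - pzb (Complex x y))"])
      show "((\<lambda>t. P (Complex x t)) has_vector_derivative \<i> * (pz (Complex x t) - pzb (Complex x t))) (at t within {a..b})"
        if "t \<in> {a..b}" for t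
        using C1P y[OF that] unfolding C1_wirtinger_on_def by (intro has_wirtinger_vertical) blast
      show "0 \<le> jac pz pzb (Complex x t)" if "t \<in> {a..b}" for t using y[OF that] by (rule jacP0)
      show "(cmod (\<i> * (pz (Complex x t) - pzb (Complex x t))))\<^sup>2 \<le> K * jac pz pzb (Complex x t)"
        if "t \<in> {a..b}" for t
      proof -
        let ?w = "Complex x t"
        have "(cmod (\<i> * (pz ?w - pzb ?w)))\<^sup>2 \<le> (cmod (pz ?w) + cmod (pzb ?w))\<^sup>2"
          by (intro power_mono) (simp_all add: norm_mult norm_triangle_ineq4)
        also have "\<dots> = (cmod (exp ?w))\<^sup>2 * (cmod (fz (c ?w)) + cmod (fzb (c ?w)))\<^sup>2"
          unfolding pz_def pzb_def norm_mult complex_mod_cnj power_mult_distrib[symmetric]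
          by (simp add: algebra_simps)
        also have "\<dots> \<le> (cmod (exp ?w))\<^sup>2 * (K * jac fz fzb (c ?w))"
          using K(2)[of "c ?w"] y[OF that] by (intro mult_left_mono) (auto simp: U_def)
        finally show ?thesis by (simp add: jacP mult_ac)
      qed
    qed (use ab K continuous_on_subset[OF contJx sub] in auto)
    also have "integral {a..b} (\<lambda>_. K) * integral {a..b} (\<lambda>y. jac pz pzb (Complex x y)) \<le> (pi * K) * C"
    proof (rule mult_mono)
      show "integral {a..b} (\<lambda>_. K) \<le> pi * K" using ab \<phi>0 K(1) by (simp add: mult_right_mono)
      have "integral {a..b} (\<lambda>y. jac pz pzb (Complex x y)) \<le> I x"
        unfolding I_def
      proof (rule integral_subset_le[OF sub])
        show "(\<lambda>y. jac pz pzb (Complex x y)) integrable_on {a..b}"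
          "(\<lambda>y. jac pz pzb (Complex x y)) integrable_on {-\<phi>0..\<phi>0}"
          using contJx continuous_on_subset[OF contJx sub] by (auto intro: integrable_continuous_real)
      qed (use jacP0 QC x in auto)
      then show "integral {a..b} (\<lambda>y. jac pz pzb (Complex x y)) \<le> C" using x by simp
      show "0 \<le> integral {a..b} (\<lambda>y. jac pz pzb (Complex x y))"
        using jacP0 y continuous_on_subset[OF contJx sub]
        by (intro Henstock_Kurzweil_Integration.integral_nonneg integrable_continuous_real) auto
    qed (use K in auto)
    finally show ?thesis .
  qed
  \<comment> \<open>The ray from \<open>F z\<close> crosses the image of the chosen arc, so the
    ordinate of \<open>F z\<close> is attained on the arc. The two ordinates in question can then be
    compared by \<open>osc\<close>.\<close>
  have hit: "\<exists>\<phi>\<in>{-\<phi>0..\<phi>0}. Im (P (Complex x \<phi>)) = Im (F z)"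
    if z: "z \<in> strip L" "cmod (z - \<i> * \<eta>) < exp s0" "?e \<le> Re (F z)" for z
  proof -
    have "cmod (z - \<i> * \<eta>) < exp x" "exp x < L"
      using x z(2) s le_less_trans[of "exp x" "exp s1" L] less_le_trans[of _ "exp s0" "exp x"] by auto
    then obtain w where w: "w \<in> strip L" "Re w > d" "cmod (w - \<i> * \<eta>) = exp x" "Im (F w) = Im (F z)"
      using ray_hits_arc[OF z(1) _ _ d] low z(3) by (metis less_le_trans)
    define u where "u = w - \<i> * \<eta>"
    have "u \<noteq> 0" using w(3) by (auto simp: u_def)
    define \<phi> where "\<phi> = Im (Ln u)"
    have Lnu: "Ln u = Complex x \<phi>"
      using \<open>u \<noteq> 0\<close> w(3) by (simp add: complex_eq_iff \<phi>_def u_def)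
    then have exp: "exp (Complex x \<phi>) = u" using \<open>u \<noteq> 0\<close> by (metis exp_Ln)
    have "exp x * cos \<phi> = Re u" by (subst exp[symmetric]) (simp add: Re_exp)
    also have "\<dots> > d" using w(2) by (simp add: u_def)
    finally have "cos \<phi> > d * exp (- x)" by (simp add: exp_minus field_simps)
    moreover have "d * exp (- s1) \<le> d * exp (- x)" using d x by simp
    ultimately have "cos \<phi>0 \<le> cos \<bar>\<phi>\<bar>" using cos\<phi>0 by simp
    moreover have "\<bar>\<phi>\<bar> \<le> pi" unfolding \<phi>_def using mpi_less_Im_Ln[OF \<open>u \<noteq> 0\<close>] Im_Ln_le_pi[OF \<open>u \<noteq> 0\<close>] by linarith
    ultimately have "\<bar>\<phi>\<bar> \<le> \<phi>0" using \<phi>0 by (subst (asm) cos_mono_le_eq) auto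
    moreover have "P (Complex x \<phi>) = F w" by (simp add: P_def c_def exp u_def)
    ultimately show ?thesis using w(4) by (intro bexI[of _ \<phi>]) auto
  qed
  obtain a where a: "a \<in> {-\<phi>0..\<phi>0}" "Im (P (Complex x a)) = Im (F z1)" using hit[OF z1] by auto
  obtain b where b: "b \<in> {-\<phi>0..\<phi>0}" "Im (P (Complex x b)) = Im (F z2)" using hit[OF z2] by auto
  have sq: "(Im u)\<^sup>2 \<le> (cmod u)\<^sup>2" for u by (simp add: cmod_power2)
  consider "a < b" | "b < a" | "a = b" by linarith
  then have "(Im (F z1) - Im (F z2))\<^sup>2 \<le> pi * K * C"
  proof cases
    case 1
    then show ?thesis using osc[OF 1 a(1) b(1)] sq[of "P (Complex x b) - P (Complex x a)"] a b
      by (simp add: power2_commute)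
  next
    case 2
    then show ?thesis using osc[OF 2 b(1) a(1)] sq[of "P (Complex x a) - P (Complex x b)"] a b
      by simp
  next
    case 3
    have "C \<ge> 0" using s M by (simp add: C_def)
    then show ?thesis using 3 a b K by simp
  qed
  then show ?thesis by (simp add: C_def)
qed

end

text \<open>\<open>cmod (fz z) + cmod (fzb z)\<close> is the operator norm of the real derivative,
  so this is quasiconformality with constant \<open>K\<close> for C1 maps. The derivatives are bound
  existentially because only \<open>K\<close> has to be tracked through inverses and
  compositions.\<close>

definition qc_on :: "real \<Rightarrow> complex set \<Rightarrow> (complex \<Rightarrow> complex) \<Rightarrow> bool" where
  "qc_on K U F \<longleftrightarrow> (\<exists>fz fzb. C1_wirtinger_on U F fz fzb \<and>
     (\<forall>z\<in>U. jac fz fzb z > 0 \<and> (cmod (fz z) + cmod (fzb z))\<^sup>2 \<le> K * jac fz fzb z))"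

lemma jac_uminus [simp]: "jac (\<lambda>z. - fz z) (\<lambda>z. - fzb z) z = jac fz fzb z"
  by (simp add: jac_def)

lemma qc_on_flip_target: "qc_on K U F \<Longrightarrow> qc_on K U (\<lambda>z. c - F z)"
  unfolding qc_on_def using C1_wirtinger_on_flip_target by fastforce

lemma qc_on_flip_source:
  assumes "qc_on K (strip L) F" shows "qc_on K (strip L) (\<lambda>z. F (L - z))"
proof -
  obtain fz fzb where *: "C1_wirtinger_on (strip L) F fz fzb"
    "\<forall>z\<in>strip L. jac fz fzb z > 0 \<and> (cmod (fz z) + cmod (fzb z))\<^sup>2 \<le> K * jac fz fzb z"
    using assms by (auto simp: qc_on_def)
  have L: "complex_of_real L - z \<in> strip L" if "z \<in> strip L" for z
    using that by (simp add: strip_def)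
  have jac: "jac (\<lambda>z. fz (of_real L - z)) (\<lambda>z. fzb (of_real L - z)) z = jac fz fzb (of_real L - z)" for z
    by (simp add: jac_def)
  show ?thesis
    unfolding qc_on_def
  proof (rule exI[of _ "\<lambda>z. - fz (of_real L - z)"], rule exI[of _ "\<lambda>z. - fzb (of_real L - z)"], intro conjI ballI)
    show "C1_wirtinger_on (strip L) (\<lambda>z. F (of_real L - z)) (\<lambda>z. - fz (of_real L - z)) (\<lambda>z. - fzb (of_real L - z))"
      by (rule C1_wirtinger_on_flip_source[OF *(1)])
  qed (use *(2) L in \<open>auto simp: jac\<close>)
qed

text \<open>Inverting the real linear map gives \<open>cnj fz / J\<close> and
  \<open>- fzb / J\<close>, evaluated at \<open>G w\<close>. The maximal stretch becomes the old one
  divided by \<open>J\<close> and the Jacobian becomes \<open>1 / J\<close>, so the same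
  \<open>K\<close> works.\<close>

lemma qc_on_inverse:
  assumes S: "open S" "continuous_on S F" "\<And>z. z \<in> S \<Longrightarrow> G (F z) = z"
    and T: "open T" "continuous_on T G" "\<And>w. w \<in> T \<Longrightarrow> G w \<in> S" "\<And>w. w \<in> T \<Longrightarrow> F (G w) = w"
    and qc: "qc_on K S F"
  shows "qc_on K T G"
proof -
  note contF = S(2) and GF = S(3) and contG = T(2) and G = T(3) and FG = T(4)
  obtain fz fzb where C1: "C1_wirtinger_on S F fz fzb"
    and qc1: "\<And>z. z \<in> S \<Longrightarrow> jac fz fzb z > 0"
    and qc2: "\<And>z. z \<in> S \<Longrightarrow> (cmod (fz z) + cmod (fzb z))\<^sup>2 \<le> K * jac fz fzb z"
    using qc by (auto simp: qc_on_def)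
  define J where "J w = jac fz fzb (G w)" for w
  define gz where "gz w = cnj (fz (G w)) / of_real (J w)" for w
  define gzb where "gzb w = - fzb (G w) / of_real (J w)" for w
  have J: "J w > 0" if "w \<in> T" for w using qc1[OF G[OF that]] by (simp add: J_def)
  have cont: "continuous_on T (\<lambda>w. fz (G w))" "continuous_on T (\<lambda>w. fzb (G w))"
    using C1 G unfolding C1_wirtinger_on_def by (auto intro!: continuous_on_compose2[OF _ contG])
  have contJ: "continuous_on T J"
    unfolding J_def jac_def by (intro continuous_intros cont)
  have C1G: "C1_wirtinger_on T G gz gzb"
    unfolding C1_wirtinger_on_def
  proof (intro conjI ballI)
    show "continuous_on T gz" "continuous_on T gzb"
      unfolding gz_def gzb_def using J by (auto intro!: continuous_intros cont contJ simp: less_le)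
    fix w assume w: "w \<in> T"
    let ?a = "fz (G w)" and ?b = "fzb (G w)"
    have Jeq: "complex_of_real (J w) = ?a * cnj ?a - ?b * cnj ?b"
      by (simp add: J_def jac_def complex_norm_square[symmetric])
    have nz: "?a * cnj ?a - ?b * cnj ?b \<noteq> 0" unfolding Jeq[symmetric] using J[OF w] by simp
    have "(G has_derivative (\<lambda>h. gz w * h + gzb w * cnj h)) (at w)"
    proof (rule has_derivative_inverse_strong_x[OF S(1) G[OF w] contF GF _ _ FG[OF w]])
      show "(F has_derivative (\<lambda>h. ?a * h + ?b * cnj h)) (at (G w))"
        using C1 G[OF w] unfolding C1_wirtinger_on_def has_wirtinger_def by blast
      have "?a * (gz w * h + gzb w * cnj h) + ?b * cnj (gz w * h + gzb w * cnj h) = h" for h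
      proof -
        have "?a * (gz w * h + gzb w * cnj h) + ?b * cnj (gz w * h + gzb w * cnj h)
          = ((?a * cnj ?a - ?b * cnj ?b) * h) / of_real (J w)"
          using J[OF w] by (simp add: gz_def gzb_def field_simps)
        then show ?thesis using nz unfolding Jeq by simp
      qed
      then show "(\<lambda>h. ?a * h + ?b * cnj h) \<circ> (\<lambda>h. gz w * h + gzb w * cnj h) = id"
        by (auto simp: fun_eq_iff)
    qed
    then show "has_wirtinger G (gz w) (gzb w) w" by (simp add: has_wirtinger_def)
  qed (rule T(1))
  have jacG: "jac gz gzb w = 1 / J w" if "w \<in> T" for w
  proof -
    have "jac gz gzb w = ((cmod (fz (G w)))\<^sup>2 - (cmod (fzb (G w)))\<^sup>2) / (J w)\<^sup>2"
      using J[OF that] by (simp add: jac_def gz_def gzb_def norm_divide power_divide diff_divide_distrib)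
    also have "\<dots> = J w / (J w)\<^sup>2" by (simp add: J_def jac_def)
    finally show ?thesis using J[OF that] by (simp add: power2_eq_square)
  qed
  show ?thesis unfolding qc_on_def
  proof (rule exI[of _ gz], rule exI[of _ gzb], intro conjI ballI)
    show "C1_wirtinger_on T G gz gzb" by (rule C1G)
  next
    fix w assume w: "w \<in> T"
    show "jac gz gzb w > 0" using J[OF w] by (simp add: jacG[OF w])
    have "cmod (gz w) + cmod (gzb w) = (cmod (fz (G w)) + cmod (fzb (G w))) / J w"
      using J[OF w] by (simp add: gz_def gzb_def norm_divide add_divide_distrib)
    then have "(cmod (gz w) + cmod (gzb w))\<^sup>2 = (cmod (fz (G w)) + cmod (fzb (G w)))\<^sup>2 / (J w)\<^sup>2"
      by (simp add: power_divide)
    also have "\<dots> \<le> K * J w / (J w)\<^sup>2"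
      using qc2[OF G[OF w]] by (intro divide_right_mono) (auto simp: J_def)
    also have "\<dots> = K * jac gz gzb w" using J[OF w] by (simp add: jacG[OF w] power2_eq_square)
    finally show "(cmod (gz w) + cmod (gzb w))\<^sup>2 \<le> K * jac gz gzb w" .
  qed
qed

context strip_homeo
begin

text \<open>\<open>boundary_oscillation\<close>, centred at height \<open>Im z\<close>, controls the
  imaginary parts; the real parts are small because the left end goes to the left end. The
  oscillation decays like \<open>c / m\<close> in the logarithmic width \<open>m\<close> of the
  family of arcs, and \<open>m\<close> is taken so large that this is below
  \<open>(e / 2)\<^sup>2\<close>.\<close>

lemma uniform_near_left_aux:
  assumes qc: "qc_on K (strip L) F" "K > 0" and left: left_to_left and "e > 0"
  shows "\<exists>d>0. \<forall>z\<in>strip L. \<forall>w\<in>strip L. Re z < d \<longrightarrow> dist z w < d \<longrightarrow> dist (F z) (F w) < e"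
proof -
  obtain fz fzb where C1: "C1_wirtinger_on (strip L) F fz fzb"
    and qc': "\<And>z. z \<in> strip L \<Longrightarrow> jac fz fzb z \<ge> 0"
      "\<And>z. z \<in> strip L \<Longrightarrow> (cmod (fz z) + cmod (fzb z))\<^sup>2 \<le> K * jac fz fzb z"
    using qc(1) by (force simp: qc_on_def)
  define s1 where "s1 = ln (min (L / 2) 3)"
  have s1: "exp s1 < L" "exp s1 \<le> 3" using L by (auto simp: s1_def)
  define c where "c = pi * K * (2 * pi * M)"
  have c: "c > 0" using qc(2) M by (simp add: c_def)
  define m where "m = c / (e / 2)\<^sup>2 + 1"
  have m: "m > 0" using c by (simp add: m_def add_nonneg_pos)
  have cm: "c / m < (e / 2)\<^sup>2"
  proof -
    have "c < (e / 2)\<^sup>2 * m" using \<open>e > 0\<close> by (simp add: m_def algebra_simps)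
    then show ?thesis using m by (simp add: divide_less_eq)
  qed
  define s0 where "s0 = s1 - m"
  obtain d1 where d1: "d1 > 0" "\<forall>z\<in>strip L. Re z < d1 \<longrightarrow> Re (F z) < e / 2"
    using left \<open>e > 0\<close> unfolding left_to_left_def by (metis half_gt_zero)
  \<comment> \<open>The halving gives \<open>cmod (w - z) + Re z < 2 * d \<le> exp s0\<close>, so
    both points lie in the smallest half disc.\<close>
  define d where "d = min d1 (exp s0) / 2"
  have d: "d > 0" "2 * d \<le> d1" "2 * d \<le> exp s0" using d1 by (auto simp: d_def)
  have "dist (F z) (F w) < e" if z: "z \<in> strip L" and w: "w \<in> strip L" and "Re z < d" "dist z w < d" for z w
  proof -
    have zw: "cmod (w - z) < d" using that by (simp add: dist_norm norm_minus_commute)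
    have "z - \<i> * complex_of_real (Im z) = of_real (Re z)" by (simp add: complex_eq_iff)
    then have z': "cmod (z - \<i> * complex_of_real (Im z)) = Re z" using z by (simp add: strip_def)
    have "w - \<i> * complex_of_real (Im z) = (w - z) + (z - \<i> * complex_of_real (Im z))" by simp
    then have "cmod (w - \<i> * complex_of_real (Im z)) \<le> cmod (w - z) + Re z"
      using z' norm_triangle_ineq by metis
    then have w': "cmod (w - \<i> * complex_of_real (Im z)) < exp s0" using zw \<open>Re z < d\<close> d by linarith
    have "(Im (F z) - Im (F w))\<^sup>2 \<le> pi * K * (2 * pi * M / (s1 - s0))"
      by (rule boundary_oscillation[OF C1 qc'(1) qc(2) qc'(2) left _ s1 z _ w w'])
         (use m z' \<open>Re z < d\<close> d in \<open>auto simp: s0_def\<close>)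
    also have "\<dots> = c / m" by (simp add: c_def s0_def)
    finally have "\<bar>Im (F z) - Im (F w)\<bar>\<^sup>2 < (e / 2)\<^sup>2" using cm by simp
    then have Im: "\<bar>Im (F z) - Im (F w)\<bar> < e / 2" using \<open>e > 0\<close> by (intro power2_less_imp_less[of _ "e / 2"]) auto
    have "Re w < d1" using zw \<open>Re z < d\<close> d abs_Re_le_cmod[of "w - z"] by simp
    then have "Re (F z) < e / 2" "Re (F w) < e / 2" "0 < Re (F z)" "0 < Re (F w)"
      using d1 z w \<open>Re z < d\<close> d F by (auto simp: strip_def)
    then have "\<bar>Re (F z) - Re (F w)\<bar> < e / 2" by linarith
    then show ?thesis using Im cmod_le[of "F z - F w"] by (simp add: dist_norm)
  qed
  then show ?thesis using d(1) by blast
qed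

lemma uniform_near_left:
  assumes qc: "qc_on K (strip L) F" "K > 0" and "e > 0"
  shows "\<exists>d>0. \<forall>z\<in>strip L. \<forall>w\<in>strip L. Re z < d \<longrightarrow> dist z w < d \<longrightarrow> dist (F z) (F w) < e"
  using left_cases
proof
  assume left_to_left
  then show ?thesis using uniform_near_left_aux assms by blast
next
  assume left_to_right
  then have "strip_homeo.left_to_left L (\<lambda>z. M - F z)" by (simp add: flip_target_iff)
  from strip_homeo.uniform_near_left_aux[OF flip_target qc_on_flip_target[OF qc(1)] qc(2) this \<open>e > 0\<close>]
  show ?thesis by (simp add: dist_norm norm_minus_commute)
qed

lemma uniform_near_right:
  assumes qc: "qc_on K (strip L) F" "K > 0" and "e > 0"
  shows "\<exists>d>0. \<forall>z\<in>strip L. \<forall>w\<in>strip L. Re z > L - d \<longrightarrow> dist z w < d \<longrightarrow> dist (F z) (F w) < e"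
proof -
  have *: "of_real L - z \<in> strip L" if "z \<in> strip L" for z using that by (simp add: strip_def)
  obtain d where d: "d > 0" "\<forall>z\<in>strip L. \<forall>w\<in>strip L. Re z < d \<longrightarrow> dist z w < d
      \<longrightarrow> dist (F (L - z)) (F (L - w)) < e"
    using strip_homeo.uniform_near_left[OF flip_source qc_on_flip_source[OF qc(1)] qc(2) \<open>e > 0\<close>] by blast
  have "dist (F z) (F w) < e" if "z \<in> strip L" "w \<in> strip L" "Re z > L - d" "dist z w < d" for z w
    using d(2)[rule_format, OF *[OF that(1)] *[OF that(2)]] that by (simp add: dist_norm norm_minus_commute)
  then show ?thesis using d(1) by blast
qed

text \<open>Uniform continuity on one compact rectangle suffices, as a common translation by periods
  brings \<open>z\<close> to height between 0 and 2 pi. The rectangle exceeds this cell by 1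
  vertically and by \<open>d / 2\<close> horizontally to contain the nearby point \<open>w\<close>
  too.\<close>

lemma uniform_inside:
  assumes "d > 0" "e > 0"
  shows "\<exists>d'>0. \<forall>z\<in>strip L. \<forall>w\<in>strip L. d \<le> Re z \<longrightarrow> Re z \<le> L - d \<longrightarrow> dist z w < d' \<longrightarrow> dist (F z) (F w) < e"
proof -
  let ?C = "cbox (Complex (d/2) (-1)) (Complex (L - d/2) (2*pi + 1))"
  have C: "?C \<subseteq> strip L" using assms by (auto simp: in_cbox_complex_iff strip_def)
  have "uniformly_continuous_on ?C F"
    by (intro compact_uniformly_continuous continuous_on_subset[OF contF C] compact_cbox)
  then obtain d1 where d1: "d1 > 0" "\<forall>z\<in>?C. \<forall>w\<in>?C. dist w z < d1 \<longrightarrow> dist (F w) (F z) < e"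
    using \<open>e > 0\<close> unfolding uniformly_continuous_on_def by blast
  define d' where "d' = min d1 (min 1 (d / 2))"
  have "dist (F z) (F w) < e" if z: "z \<in> strip L" "w \<in> strip L" "d \<le> Re z" "Re z \<le> L - d" "dist z w < d'" for z w
  proof -
    define n where "n = - \<lfloor>Im z / (2 * pi)\<rfloor>"
    let ?t = "of_int n * period"
    have "0 \<le> Im z / (2*pi) + of_int n" "Im z / (2*pi) + of_int n \<le> 1"
      unfolding n_def by linarith+
    then have Im: "0 \<le> Im (z + ?t)" "Im (z + ?t) \<le> 2 * pi"
      by (simp_all add: field_simps)
    have zC: "z + ?t \<in> ?C" using Im z assms by (auto simp: in_cbox_complex_iff)
    have "\<bar>Re (z - w)\<bar> < d'" "\<bar>Im (z - w)\<bar> < d'"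
      using z(5) abs_Re_le_cmod[of "z - w"] abs_Im_le_cmod[of "z - w"] by (simp_all add: dist_norm)
    then have "\<bar>Re z - Re w\<bar> < d / 2" "\<bar>Im z - Im w\<bar> < 1" by (auto simp: d'_def)
    then have "d / 2 \<le> Re w" "Re w \<le> L - d / 2" "- 1 \<le> Im (w + ?t)" "Im (w + ?t) \<le> 2 * pi + 1"
      subgoal using z(3) by linarith
      subgoal using z(4) \<open>\<bar>Re z - Re w\<bar> < d / 2\<close> by linarith
      subgoal using Im(1) \<open>\<bar>Im z - Im w\<bar> < 1\<close> by simp
      subgoal using Im(2) \<open>\<bar>Im z - Im w\<bar> < 1\<close> by simp
      done
    then have wC: "w + ?t \<in> ?C" by (simp add: in_cbox_complex_iff)
    have "dist (F (z + ?t)) (F (w + ?t)) < e"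
      using d1(2)[rule_format, OF wC zC] z(5) by (simp add: d'_def dist_norm)
    then show ?thesis unfolding per_int[OF z(1)] per_int[OF z(2)] by (simp add: dist_norm)
  qed
  moreover have "d' > 0" using d1 assms by (simp add: d'_def)
  ultimately show ?thesis by blast
qed

lemma qc_uniformly_continuous:
  assumes qc: "qc_on K (strip L) F" "K > 0"
  shows "uniformly_continuous_on (strip L) F"
  unfolding uniformly_continuous_on_def
proof (intro allI impI)
  fix e :: real assume e: "e > 0"
  obtain d1 where d1: "d1 > 0" "\<forall>z\<in>strip L. \<forall>w\<in>strip L. Re z < d1 \<longrightarrow> dist z w < d1 \<longrightarrow> dist (F z) (F w) < e"
    using uniform_near_left[OF qc e] by blast
  obtain d2 where d2: "d2 > 0" "\<forall>z\<in>strip L. \<forall>w\<in>strip L. Re z > L - d2 \<longrightarrow> dist z w < d2 \<longrightarrow> dist (F z) (F w) < e"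
    using uniform_near_right[OF qc e] by blast
  define d where "d = min d1 d2"
  have "d > 0" using d1 d2 by (simp add: d_def)
  obtain d3 where d3: "d3 > 0" "\<forall>z\<in>strip L. \<forall>w\<in>strip L. d \<le> Re z \<longrightarrow> Re z \<le> L - d \<longrightarrow> dist z w < d3 \<longrightarrow> dist (F z) (F w) < e"
    using uniform_inside[OF \<open>d > 0\<close> e] by blast
  have "dist (F w) (F z) < e" if "z \<in> strip L" "w \<in> strip L" "dist w z < min d d3" for z w
  proof -
    have dist: "dist z w < d1" "dist z w < d2" "dist z w < d3"
      using that by (auto simp: d_def dist_commute)
    consider "Re z < d1" | "Re z > L - d2" | "d \<le> Re z" "Re z \<le> L - d"
      unfolding d_def by linarith
    then have "dist (F z) (F w) < e"
      using d1(2) d2(2) d3(2) that(1,2) dist by cases blast+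
    then show ?thesis by (simp add: dist_commute)
  qed
  then show "\<exists>d>0. \<forall>z\<in>strip L. \<forall>w\<in>strip L. dist w z < d \<longrightarrow> dist (F w) (F z) < e"
    using \<open>d > 0\<close> d3(1) by (intro exI[of _ "min d d3"]) auto
qed

text \<open>\<open>G\<close> is quasiconformal with the same \<open>K\<close>, so both maps are
  uniformly continuous and extend to the closed strips. The inverse relations and the period
  relation persist on the closure by continuity; in particular the extension cannot collapse
  boundary arcs.\<close>

lemma qc_boundary_extension:
  assumes qc: "qc_on K (strip L) F" "K > 0"
  shows "\<exists>Fb Gb. continuous_on (cstrip 0 M) Gb \<and> (\<forall>w\<in>strip M. Gb w = G w) \<and>
    (\<forall>z\<in>cstrip 0 L. Fb z \<in> cstrip 0 M \<and> Gb (Fb z) = z) \<and>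
    (\<forall>w\<in>cstrip 0 M. Gb w \<in> cstrip 0 L \<and> Fb (Gb w) = w) \<and>
    (\<forall>w\<in>cstrip 0 M. Gb (w + period) = Gb w + of_int k * period)"
proof -
  interpret inv: strip_homeo M L G F k by (rule inverse_strip_homeo)
  have qcG: "qc_on K (strip M) G"
    by (rule qc_on_inverse[OF open_strip contF GF open_strip contG G FG qc(1)])
  obtain Fb where "uniformly_continuous_on (closure (strip L)) Fb" and Fb: "\<And>z. z \<in> strip L \<Longrightarrow> F z = Fb z"
    using uniformly_continuous_on_extension_on_closure[OF qc_uniformly_continuous[OF qc]] by metis
  then have cFb: "continuous_on (closure (strip L)) Fb" by (simp add: uniformly_continuous_imp_continuous)
  obtain Gb where "uniformly_continuous_on (closure (strip M)) Gb" and Gb: "\<And>w. w \<in> strip M \<Longrightarrow> G w = Gb w"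
    using uniformly_continuous_on_extension_on_closure[OF inv.qc_uniformly_continuous[OF qcG qc(2)]]
    by metis
  then have cGb: "continuous_on (closure (strip M)) Gb" by (simp add: uniformly_continuous_imp_continuous)
  have clL: "closure (strip L) = cstrip 0 L" and clM: "closure (strip M) = cstrip 0 M"
    using L M by (simp_all add: closure_strip)
  have imF: "Fb ` closure (strip L) \<subseteq> closure (strip M)"
    using Fb F closure_subset by (intro image_closure_subset[OF cFb]) force+
  have imG: "Gb ` closure (strip M) \<subseteq> closure (strip L)"
    using Gb G closure_subset by (intro image_closure_subset[OF cGb]) force+
  have "Gb (Fb z) - z = 0" if "z \<in> closure (strip L)" for z
  proof (rule continuous_constant_on_closure[OF _ _ that])
    show "continuous_on (closure (strip L)) (\<lambda>z. Gb (Fb z) - z)"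
      by (intro continuous_intros continuous_on_compose2[OF cGb cFb imF])
    show "Gb (Fb z) - z = 0" if "z \<in> strip L" for z
      using GF[OF that] Gb[OF F[OF that]] Fb[OF that] by simp
  qed
  moreover have "Fb (Gb w) - w = 0" if "w \<in> closure (strip M)" for w
  proof (rule continuous_constant_on_closure[OF _ _ that])
    show "continuous_on (closure (strip M)) (\<lambda>w. Fb (Gb w) - w)"
      by (intro continuous_intros continuous_on_compose2[OF cFb cGb imG])
    show "Fb (Gb w) - w = 0" if "w \<in> strip M" for w
      using FG[OF that] Fb[OF G[OF that]] Gb[OF that] by simp
  qed
  moreover have "Gb (w + period) - Gb w = of_int k * period" if "w \<in> closure (strip M)" for w
  proof (rule continuous_constant_on_closure[OF _ _ that])
    show "continuous_on (closure (strip M)) (\<lambda>w. Gb (w + period) - Gb w)"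
      by (intro continuous_intros cGb continuous_on_compose2[OF cGb])
         (auto simp: clM cstrip_def)
    show "Gb (w + period) - Gb w = of_int k * period" if "w \<in> strip M" for w
    proof -
      have "w + period \<in> strip M" using that by (simp add: strip_def)
      then have "Gb (w + period) = Gb w + of_int k * period"
        using inv.per[OF that] Gb[OF that] Gb[of "w + period"] by metis
      then show ?thesis by (simp only: add_diff_cancel_left')
    qed
  qed
  ultimately show ?thesis
    using imF imG cGb Gb unfolding clL clM
    by (intro exI[of _ Fb] exI[of _ Gb]) (auto simp: image_subset_iff algebra_simps)
qed

end

section \<open>Lifting homeomorphisms of annuli\<close>

lemma exp_open_annulus: "exp z \<in> open_annulus 1 (exp L) \<longleftrightarrow> z \<in> strip L"
  by (simp add: open_annulus_def strip_def norm_exp_eq_Re)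

lemma exp_closed_annulus: "exp z \<in> closed_annulus 1 (exp L) \<longleftrightarrow> z \<in> cstrip 0 L"
  by (simp add: closed_annulus_def cstrip_def norm_exp_eq_Re)

lemma open_annulus_subset: "open_annulus a c \<subseteq> closed_annulus a c"
  by (auto simp: open_annulus_def closed_annulus_def)

lemma open_open_annulus: "open (open_annulus a c)"
proof -
  have "open_annulus a c = - cball 0 a \<inter> ball 0 c" by (auto simp: open_annulus_def)
  then show ?thesis by (auto intro: open_Int)
qed

lemma compact_closed_annulus: "compact (closed_annulus a c)"
proof -
  have "closed_annulus a c = cball 0 c - ball 0 a" by (auto simp: closed_annulus_def)
  then show ?thesis by (simp add: compact_diff)
qed

text \<open>The possible values are 2 pi apart, so a continuous function on a connected set cannot
  change between them.\<close>

lemma integer_period_constant: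
  assumes "connected S" "continuous_on S u" "\<And>z. z \<in> S \<Longrightarrow> exp (u z) = (1::complex)"
  shows "\<exists>n::int. \<forall>z\<in>S. u z = of_int n * period"
proof -
  have int: "\<exists>n::int. u z = of_int n * period" if "z \<in> S" for z
    using assms(3)[OF that] unfolding exp_eq_1 by (auto simp: complex_eq_iff)
  have "u constant_on S"
  proof (rule continuous_discrete_range_constant[OF assms(1,2)])
    fix x assume x: "x \<in> S"
    have "2 * pi \<le> norm (u y - u x)" if y: "y \<in> S" "u y \<noteq> u x" for y
    proof -
      obtain m n :: int where mn: "u y = of_int m * period" "u x = of_int n * period"
        using int x y by meson
      then have "m \<noteq> n" using y by auto
      then have "1 \<le> \<bar>real_of_int (m - n)\<bar>" by linarith
      then have "2 * pi * 1 \<le> 2 * pi * \<bar>real_of_int (m - n)\<bar>" by (intro mult_left_mono) auto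
      also have "\<dots> = norm (of_int (m - n) * period)" by (simp only: norm_mult norm_of_int) simp
      also have "of_int (m - n) * period = u y - u x" by (simp add: mn left_diff_distrib)
      finally show ?thesis by simp
    qed
    then show "\<exists>e>0. \<forall>y. y \<in> S \<and> u y \<noteq> u x \<longrightarrow> e \<le> norm (u y - u x)"
      by (intro exI[of _ "2 * pi"]) auto
  qed
  then obtain c where c: "\<And>z. z \<in> S \<Longrightarrow> u z = c" by (auto simp: constant_on_def)
  show ?thesis
  proof (cases "S = {}")
    case False
    then obtain z where "z \<in> S" by auto
    then show ?thesis using int c by metis
  qed auto
qed

text \<open>On a convex set a nonvanishing function has a continuous logarithm. Its increment over
  one period is a locally constant, hence constant, multiple of the period; \<open>k\<close> is this
  degree.\<close>

lemma periodic_logarithm: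
  assumes S: "convex S" "\<And>z. z \<in> S \<Longrightarrow> z + period \<in> S"
    and \<phi>: "continuous_on S \<phi>" "\<And>z. z \<in> S \<Longrightarrow> \<phi> z \<noteq> 0" "\<And>z. z \<in> S \<Longrightarrow> \<phi> (z + period) = \<phi> z"
  shows "\<exists>F k. continuous_on S F \<and> (\<forall>z\<in>S. exp (F z) = \<phi> z) \<and>
    (\<forall>z\<in>S. F (z + period) = F z + of_int k * period)"
proof -
  obtain F where F: "continuous_on S F" "\<And>z. z \<in> S \<Longrightarrow> \<phi> z = exp (F z)"
    using continuous_logarithm_on_contractible[OF \<phi>(1) convex_imp_contractible[OF S(1)] \<phi>(2)] by blast
  let ?u = "\<lambda>z. F (z + period) - F z"
  have "continuous_on S ?u"
    by (intro continuous_intros F(1) continuous_on_compose2[OF F(1)]) (use S(2) in auto)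
  moreover have "exp (?u z) = 1" if "z \<in> S" for z
    using F(2)[OF that] F(2)[OF S(2)[OF that]] \<phi>(2,3)[OF that] by (simp add: exp_diff)
  ultimately obtain k :: int where "\<forall>z\<in>S. ?u z = of_int k * period"
    using integer_period_constant[OF convex_connected[OF S(1)], of ?u] by blast
  then show ?thesis using F by (intro exI[of _ F] exI[of _ k]) (simp add: algebra_simps)
qed

text \<open>\<open>h\<close> and \<open>h'\<close> are lifted independently, so \<open>G0\<close>
  inverts \<open>F\<close> only up to a constant number \<open>n\<close> of periods, which is
  subtracted. The other composition is also off by a constant, and that constant is seen to be 0 at
  a single point of the form \<open>F z\<close>. The degrees of the two lifts multiply to 1, which
  leaves only plus or minus 1.\<close>

lemma lift_annulus_homeomorphism:
  assumes L: "L > 0" and M: "M > 0"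
    and h: "homeomorphism (open_annulus 1 (exp L)) (open_annulus 1 (exp M)) h h'"
  obtains F G k where "strip_homeo L M F G k" "\<And>z. z \<in> strip L \<Longrightarrow> exp (F z) = h (exp z)"
proof -
  have period: "exp (z + period) = exp z" for z
    by (simp add: exp_add)
  have shift: "z + period \<in> strip N" if "z \<in> strip N" for z N using that by (simp add: strip_def)
  have hh: "h (exp z) \<in> open_annulus 1 (exp M)" "h' (h (exp z)) = exp z" if "z \<in> strip L" for z
    using h that unfolding exp_open_annulus[symmetric] homeomorphism_def by auto
  have hh': "h' (exp w) \<in> open_annulus 1 (exp L)" "h (h' (exp w)) = exp w" if "w \<in> strip M" for w
    using h that unfolding exp_open_annulus[symmetric] homeomorphism_def by auto
  have nz: "u \<noteq> 0" if "u \<in> open_annulus 1 c" for u c using that by (auto simp: open_annulus_def)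
  have ch: "continuous_on (strip L) (\<lambda>z. h (exp z))" "continuous_on (strip M) (\<lambda>w. h' (exp w))"
    subgoal by (rule continuous_on_compose2[OF homeomorphism_cont1[OF h]])
        (auto intro!: continuous_intros simp: exp_open_annulus)
    subgoal by (rule continuous_on_compose2[OF homeomorphism_cont2[OF h]])
        (auto intro!: continuous_intros simp: exp_open_annulus)
    done
  have nz1: "h (exp z) \<noteq> 0" if "z \<in> strip L" for z using nz[OF hh(1)[OF that]] .
  have nz2: "h' (exp w) \<noteq> 0" if "w \<in> strip M" for w using nz[OF hh'(1)[OF that]] .
  have period1: "h (exp (z + period)) = h (exp z)" and period2: "h' (exp (z + period)) = h' (exp z)"
    for z by (simp_all only: period)
  obtain F k where "continuous_on (strip L) F \<and> (\<forall>z\<in>strip L. exp (F z) = h (exp z)) \<and>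
    (\<forall>z\<in>strip L. F (z + period) = F z + of_int k * period)"
    using periodic_logarithm[OF convex_strip shift ch(1) nz1 period1] by blast
  then have F: "continuous_on (strip L) F" "\<And>z. z \<in> strip L \<Longrightarrow> exp (F z) = h (exp z)"
    "\<And>z. z \<in> strip L \<Longrightarrow> F (z + period) = F z + of_int k * period" by blast+
  obtain G0 l where "continuous_on (strip M) G0 \<and> (\<forall>w\<in>strip M. exp (G0 w) = h' (exp w)) \<and>
    (\<forall>w\<in>strip M. G0 (w + period) = G0 w + of_int l * period)"
    using periodic_logarithm[OF convex_strip shift ch(2) nz2 period2] by blast
  then have G0: "continuous_on (strip M) G0" "\<And>w. w \<in> strip M \<Longrightarrow> exp (G0 w) = h' (exp w)"
    "\<And>w. w \<in> strip M \<Longrightarrow> G0 (w + period) = G0 w + of_int l * period" by blast+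
  have FM: "F z \<in> strip M" if "z \<in> strip L" for z
    using hh(1)[OF that] unfolding F(2)[OF that, symmetric] exp_open_annulus .
  have GL: "G0 w \<in> strip L" if "w \<in> strip M" for w
    using hh'(1)[OF that] unfolding G0(2)[OF that, symmetric] exp_open_annulus .
  have "continuous_on (strip L) (\<lambda>z. G0 (F z) - z)"
    by (intro continuous_intros continuous_on_compose2[OF G0(1) F(1)]) (use FM in auto)
  moreover have "exp (G0 (F z) - z) = 1" if "z \<in> strip L" for z
    using G0(2)[OF FM[OF that]] F(2)[OF that] hh(2)[OF that] by (simp add: exp_diff)
  ultimately obtain n :: int where "\<forall>z\<in>strip L. G0 (F z) - z = of_int n * period"
    using integer_period_constant[OF convex_connected[OF convex_strip]] by blast
  then have n: "G0 (F z) - z = of_int n * period" if "z \<in> strip L" for z using that by blast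
  define G where "G w = G0 w - of_int n * period" for w
  have cG: "continuous_on (strip M) G" unfolding G_def by (intro continuous_intros G0(1))
  have GF: "G (F z) = z" if "z \<in> strip L" for z using n[OF that] by (simp add: G_def algebra_simps)
  have G: "G w \<in> strip L" if "w \<in> strip M" for w using GL[OF that] by (simp add: G_def strip_def)
  have expG: "exp (G w) = h' (exp w)" if "w \<in> strip M" for w
  proof -
    have "exp (of_int n * period) = 1" unfolding exp_eq_1 by auto
    then show ?thesis using G0(2)[OF that] unfolding G_def exp_diff by simp
  qed
  have "continuous_on (strip M) (\<lambda>w. F (G w) - w)"
    by (intro continuous_intros continuous_on_compose2[OF F(1) cG]) (use G in auto)
  moreover have "exp (F (G w) - w) = 1" if "w \<in> strip M" for w
    using F(2)[OF G[OF that]] expG[OF that] hh'(2)[OF that] by (simp add: exp_diff)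
  ultimately obtain m :: int where "\<forall>w\<in>strip M. F (G w) - w = of_int m * period"
    using integer_period_constant[OF convex_connected[OF convex_strip]] by blast
  then have m: "F (G w) - w = of_int m * period" if "w \<in> strip M" for w using that by blast
  have z0: "complex_of_real (L / 2) \<in> strip L" (is "?z0 \<in> _") using L by (simp add: strip_def)
  have m0: "of_int m * period = 0" using m[OF FM[OF z0]] unfolding GF[OF z0] by simp
  have FG: "F (G w) = w" if "w \<in> strip M" for w using m[OF that] unfolding m0 by simp
  have "k * l = 1"
  proof -
    have "G0 (F ?z0 + of_int k * period) = G0 (F ?z0) + of_int k * (of_int l * period)"
      by (rule periodic_int(2)[where S = "strip M" and F = G0, OF G0(3) strip_shift(1) FM[OF z0]])
    moreover have "G0 (F ?z0 + of_int k * period) = G0 (F ?z0) + period"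
      using n[OF z0] n[OF shift[OF z0]] F(3)[OF z0] by (simp add: algebra_simps)
    ultimately have "of_int k * (of_int l * period) = period" by simp
    then have "complex_of_int (k * l) * period = of_int 1 * period" by (simp add: mult_ac)
    then have "complex_of_int (k * l) = of_int 1" by (subst (asm) mult_cancel_right) auto
    then show ?thesis using of_int_eq_iff by blast
  qed
  then have "k = 1 \<or> k = -1" by (auto simp: zmult_eq_1_iff)
  then have "strip_homeo L M F G k"
    using L M F(1,3) cG FM GF G FG by unfold_locales auto
  then show ?thesis using that F(2) by blast
qed

text \<open>A point of an open set can be moved a little along its radius in both directions; on a
  bounding circle one of these moves would leave the annulus.\<close>

lemma open_subset_closed_annulus:
  assumes "open U" "U \<subseteq> closed_annulus 1 c" shows "U \<subseteq> open_annulus 1 c"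
proof
  fix u assume u: "u \<in> U"
  then obtain e where e: "e > 0" "ball u e \<subseteq> U" using assms(1) by (auto simp: open_contains_ball)
  have u1: "1 \<le> cmod u" "cmod u \<le> c" using u assms(2) by (auto simp: closed_annulus_def)
  define t where "t = min (e / (2 * cmod u)) (1 / 2)"
  have "cmod u > 0" using u1 by linarith
  then have t: "0 < t" "t < 1" using e(1) by (auto simp: t_def)
  have "t * cmod u \<le> e / (2 * cmod u) * cmod u"
    using \<open>cmod u > 0\<close> by (intro mult_right_mono) (auto simp: t_def)
  then have tu: "t * cmod u < e" using \<open>cmod u > 0\<close> e(1) by simp
  have "of_real (1 + t) * u \<in> ball u e" "of_real (1 - t) * u \<in> ball u e"
    using t tu by (auto simp: dist_norm algebra_simps norm_mult)
  then have "of_real (1 + t) * u \<in> closed_annulus 1 c" "of_real (1 - t) * u \<in> closed_annulus 1 c"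
    using e(2) assms(2) by blast+
  then have "(1 + t) * cmod u \<le> c" "1 \<le> (1 - t) * cmod u"
    using t by (simp_all add: closed_annulus_def norm_mult del: of_real_add of_real_diff)
  moreover have "t * cmod u > 0" using t \<open>cmod u > 0\<close> by simp
  ultimately show "u \<in> open_annulus 1 c" by (simp add: open_annulus_def algebra_simps)
qed

text \<open>Invariance of domain makes the image of the open annulus open, and an open part of the
  closed annulus avoids the bounding circles. The same holds for the inverse.\<close>

lemma homeomorphism_open_annulus:
  assumes h: "homeomorphism (closed_annulus 1 b) (closed_annulus 1 c) h h'"
  shows "homeomorphism (open_annulus 1 b) (open_annulus 1 c) h h'"
proof -
  have *: "g ` open_annulus 1 s \<subseteq> open_annulus 1 t"
    if g: "homeomorphism (closed_annulus 1 s) (closed_annulus 1 t) g g'" for g g' s t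
  proof (rule open_subset_closed_annulus)
    show "open (g ` open_annulus 1 s)"
      using g open_annulus_subset[of 1 s]
      by (intro invariance_of_domain)
        (auto simp: open_open_annulus homeomorphism_def intro: continuous_on_subset inj_on_inverseI[of _ g'])
    show "g ` open_annulus 1 s \<subseteq> closed_annulus 1 t"
      using g open_annulus_subset[of 1 s] by (auto simp: homeomorphism_def)
  qed
  have 1: "h ` open_annulus 1 b \<subseteq> open_annulus 1 c" by (rule *[OF h])
  have 2: "h' ` open_annulus 1 c \<subseteq> open_annulus 1 b" by (rule *[OF homeomorphism_symD[OF h]])
  show ?thesis
  proof (rule homeomorphismI)
    show "continuous_on (open_annulus 1 b) h" "continuous_on (open_annulus 1 c) h'"
      using h open_annulus_subset by (auto simp: homeomorphism_def intro: continuous_on_subset)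
    show "h' (h x) = x" if "x \<in> open_annulus 1 b" for x
      using h that open_annulus_subset[of 1 b] by (auto simp: homeomorphism_def)
    show "h (h' x) = x" if "x \<in> open_annulus 1 c" for x
      using h that open_annulus_subset[of 1 c] by (auto simp: homeomorphism_def)
  qed (use 1 2 in auto)
qed

section \<open>Transition maps between parametrised rings and their derivatives\<close>

lemma conformal_annulus_image_normalized:
  assumes "conformal_annulus_image R a c g"
  obtains M g1 where "M > 0" "M = ln (c / a)" "conformal_annulus_image R 1 (exp M) g1"
proof -
  obtain g' where ac: "0 < a" "a < c" and g: "homeomorphism (closed_annulus a c) R g g'"
    and hol: "g holomorphic_on open_annulus a c"
    using assms by (auto simp: conformal_annulus_image_def)
  have expM: "exp (ln (c / a)) = c / a" using ac by simp
  have sc: "homeomorphism (closed_annulus 1 (c / a)) (closed_annulus a c) (\<lambda>z. of_real a * z) (\<lambda>z. z / of_real a)"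
  proof (rule homeomorphismI)
    show "(*) (complex_of_real a) ` closed_annulus 1 (c / a) \<subseteq> closed_annulus a c"
      "(\<lambda>z. z / complex_of_real a) ` closed_annulus a c \<subseteq> closed_annulus 1 (c / a)"
      using ac by (auto simp: closed_annulus_def norm_mult norm_divide field_simps)
  qed (use ac in \<open>auto intro!: continuous_intros\<close>)
  have "conformal_annulus_image R 1 (exp (ln (c / a))) (g \<circ> (\<lambda>z. of_real a * z))"
    unfolding conformal_annulus_image_def expM
  proof (intro conjI exI)
    show "homeomorphism (closed_annulus 1 (c / a)) R (g \<circ> (*) (complex_of_real a)) ((\<lambda>z. z / complex_of_real a) \<circ> g')"
      using homeomorphism_compose[OF sc g] .
    show "g \<circ> (*) (complex_of_real a) holomorphic_on open_annulus 1 (c / a)"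
    proof (rule holomorphic_on_compose_gen[OF _ hol])
      show "(*) (complex_of_real a) ` open_annulus 1 (c / a) \<subseteq> open_annulus a c"
        using ac by (auto simp: open_annulus_def norm_mult field_simps)
    qed (intro holomorphic_intros)
  qed (use ac in auto)
  moreover have "ln (c / a) > 0" using ac by simp
  ultimately show ?thesis using that by blast
qed

text \<open>\<open>\<Gamma>\<close> is the holomorphic inverse of \<open>g\<close> on the image
  \<open>V\<close> of the open annulus, and \<open>F\<close> lifts \<open>g' \<circ> f\<close>. Only
  the relation \<open>exp (F z) = \<Gamma> (f (exp z))\<close> and the nonvanishing of
  \<open>\<Gamma>\<close> and its derivative are passed on; the derivatives of \<open>F\<close> can
  be computed from these alone.\<close>

lemma conformal_transition:
  assumes L: "L > 0" and M: "M > 0"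
    and f: "homeomorphism (closed_annulus 1 (exp L)) R f f'"
    and g: "conformal_annulus_image R 1 (exp M) g"
  obtains F G k V \<Gamma> where "strip_homeo L M F G k" "open V" "\<Gamma> holomorphic_on V"
    "\<And>v. v \<in> V \<Longrightarrow> deriv \<Gamma> v \<noteq> 0 \<and> \<Gamma> v \<noteq> 0"
    "\<And>z. z \<in> strip L \<Longrightarrow> f (exp z) \<in> V \<and> exp (F z) = \<Gamma> (f (exp z))"
proof -
  obtain g' where g1: "homeomorphism (closed_annulus 1 (exp M)) R g g'"
    and hol: "g holomorphic_on open_annulus 1 (exp M)"
    using g by (auto simp: conformal_annulus_image_def)
  have h: "homeomorphism (open_annulus 1 (exp L)) (open_annulus 1 (exp M)) (g' \<circ> f) (f' \<circ> g)"
    using homeomorphism_compose[OF f homeomorphism_symD[OF g1]] by (rule homeomorphism_open_annulus)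
  obtain F G k where FG: "strip_homeo L M F G k" "\<And>z. z \<in> strip L \<Longrightarrow> exp (F z) = (g' \<circ> f) (exp z)"
    using lift_annulus_homeomorphism[OF L M h] by blast
  let ?A = "open_annulus 1 (exp M)"
  have inj: "inj_on g ?A"
    using g1 open_annulus_subset[of 1 "exp M"] by (auto simp: homeomorphism_def intro!: inj_on_inverseI[of _ g'])
  have gg: "g' (g z) = z" if "z \<in> ?A" for z
    using g1 that open_annulus_subset[of 1 "exp M"] by (auto simp: homeomorphism_def)
  obtain \<Gamma> where \<Gamma>: "\<Gamma> holomorphic_on g ` ?A" "\<And>z. z \<in> ?A \<Longrightarrow> deriv g z * deriv \<Gamma> (g z) = 1"
    "\<And>z. z \<in> ?A \<Longrightarrow> \<Gamma> (g z) = z"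
    using holomorphic_has_inverse[OF hol open_open_annulus inj] by metis
  show ?thesis
  proof
    show "strip_homeo L M F G k" by fact
    show "open (g ` ?A)"
      using hol by (intro invariance_of_domain holomorphic_on_imp_continuous_on inj open_open_annulus)
    show "\<Gamma> holomorphic_on g ` ?A" by fact
    show "deriv \<Gamma> v \<noteq> 0 \<and> \<Gamma> v \<noteq> 0" if "v \<in> g ` ?A" for v
    proof -
      obtain z where "z \<in> ?A" "v = g z" using \<open>v \<in> g ` ?A\<close> by blast
      then show ?thesis using \<Gamma>(2,3)[of z] by (auto simp: open_annulus_def)
    qed
    show "f (exp z) \<in> g ` ?A \<and> exp (F z) = \<Gamma> (f (exp z))" if z: "z \<in> strip L" for z
    proof -
      have A: "(g' \<circ> f) (exp z) \<in> ?A"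
        using z h unfolding exp_open_annulus[symmetric] by (auto simp: homeomorphism_def)
      have "exp z \<in> closed_annulus 1 (exp L)"
        using z open_annulus_subset unfolding exp_open_annulus[symmetric] by blast
      then have "f (exp z) \<in> R" using f by (auto simp: homeomorphism_def)
      then have *: "g ((g' \<circ> f) (exp z)) = f (exp z)" using g1 by (auto simp: homeomorphism_def)
      then show ?thesis using A FG(2)[OF z] \<Gamma>(3)[OF A] by (metis image_eqI)
    qed
  qed
qed

text \<open>Near \<open>z\<close> a continuous logarithm of \<open>\<phi>\<close> is
  \<open>F z + Ln (\<phi> w / \<phi> z)\<close>: the quotient is close to 1, away from the cut, and
  \<open>Ln\<close> undoes \<open>exp\<close> as long as \<open>F\<close> moves by less than
  pi.\<close>

lemma has_wirtinger_logarithm: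
  assumes "open S" "z \<in> S" and cont: "continuous_on S F"
    and exp: "\<And>w. w \<in> S \<Longrightarrow> exp (F w) = \<phi> w" and \<phi>: "has_wirtinger \<phi> a b z"
  shows "has_wirtinger F (a / \<phi> z) (b / \<phi> z) z"
proof -
  have nz: "\<phi> w \<noteq> 0" if "w \<in> S" for w using exp[OF that] by (metis exp_not_eq_zero)
  have "((\<lambda>u. F z + Ln (u / \<phi> z)) has_field_derivative 1 / \<phi> z) (at (\<phi> z))"
    using nz[OF \<open>z \<in> S\<close>] by (auto intro!: derivative_eq_intros simp: complex_nonpos_Reals_iff)
  from has_wirtinger_holomorphic_compose[OF this \<phi>]
  have W: "has_wirtinger (\<lambda>w. F z + Ln (\<phi> w / \<phi> z)) (a / \<phi> z) (b / \<phi> z) z" by simp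
  have "isCont F z" using cont assms(1,2) by (simp add: continuous_on_eq_continuous_at)
  then obtain d where d: "d > 0" "\<And>w. dist w z < d \<Longrightarrow> dist (F w) (F z) < pi"
    using pi_gt_zero unfolding continuous_at_eps_delta by (metis dist_commute)
  have eq: "F z + Ln (\<phi> w / \<phi> z) = F w" if w: "w \<in> S \<inter> ball z d" for w
  proof -
    have "\<bar>Im (F w - F z)\<bar> < pi"
      using d(2)[of w] w abs_Im_le_cmod[of "F w - F z"] by (auto simp: dist_norm norm_minus_commute)
    then have "Ln (exp (F w - F z)) = F w - F z" by (intro Ln_exp) auto
    moreover have "exp (F w - F z) = \<phi> w / \<phi> z" using exp w \<open>z \<in> S\<close> by (simp add: exp_diff)
    ultimately show ?thesis by simp
  qed
  show ?thesis
    unfolding has_wirtinger_def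
    by (rule has_derivative_transform_within_open[OF W[unfolded has_wirtinger_def], of "S \<inter> ball z d"])
       (use assms(1,2) d eq in auto)
qed

text \<open>Without the division: the right-hand side is the squared stretch of \<open>f\<close> in
  the direction \<alpha>. In this form the dilatation is an admissible \<open>D\<close> in the
  length-area inequality.\<close>

lemma dir_dil_eq:
  assumes "jac fz fzb z > 0"
  shows "dir_dil fz fzb \<alpha> z * jac fz fzb z = (cmod (fz z + exp (- 2 * \<i> * of_real \<alpha>) * fzb z))\<^sup>2"
    and "dir_dil fz fzb \<alpha> z > 0"
proof -
  let ?e = "exp (- 2 * \<i> * complex_of_real \<alpha>)"
  have lt: "(cmod (fzb z))\<^sup>2 < (cmod (fz z))\<^sup>2" using assms by (simp add: jac_def)
  then have nz: "fz z \<noteq> 0" by auto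
  have e1: "cmod ?e = 1" by (simp add: norm_exp_eq_Re)
  have num: "1 + ?e * cdil fz fzb z = (fz z + ?e * fzb z) / fz z"
    using nz by (simp add: cdil_def add_divide_distrib)
  have den: "1 - (cmod (cdil fz fzb z))\<^sup>2 = jac fz fzb z / (cmod (fz z))\<^sup>2"
    using nz by (simp add: cdil_def jac_def norm_divide power_divide diff_divide_distrib)
  have eq: "dir_dil fz fzb \<alpha> z = (cmod (fz z + ?e * fzb z))\<^sup>2 / jac fz fzb z"
    unfolding dir_dil_def num den using nz by (simp add: norm_divide power_divide)
  show "dir_dil fz fzb \<alpha> z * jac fz fzb z = (cmod (fz z + ?e * fzb z))\<^sup>2"
    using assms by (simp add: eq)
  have "fz z + ?e * fzb z \<noteq> 0"
  proof
    assume "fz z + ?e * fzb z = 0"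
    then have "cmod (fz z) = cmod (?e * fzb z)" by (metis add_eq_0_iff norm_minus_cancel)
    then show False using lt e1 by (simp add: norm_mult)
  qed
  then show "dir_dil fz fzb \<alpha> z > 0" using assms by (simp add: eq)
qed

section \<open>Uniqueness of the module and the two bounds\<close>

text \<open>\<open>c\<close> is the logarithmic derivative of \<open>\<Gamma>\<close> at
  \<open>f (exp z)\<close>. It multiplies both Wirtinger derivatives, so it cancels from every
  dilatation and only its nonvanishing matters. Besides inverses of conformal maps,
  \<open>\<Gamma> v = v - p\<close> will be used.\<close>

lemma transition_C1_wirtinger:
  assumes F: "continuous_on (strip L) F" and V: "open V" and \<Gamma>: "\<Gamma> holomorphic_on V"
    and nz: "\<And>v. v \<in> V \<Longrightarrow> deriv \<Gamma> v \<noteq> 0 \<and> \<Gamma> v \<noteq> 0"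
    and exp: "\<And>z. z \<in> strip L \<Longrightarrow> f (exp z) \<in> V \<and> exp (F z) = \<Gamma> (f (exp z))"
    and f: "C1_wirtinger_on (open_annulus 1 (exp L)) f fz fzb"
  obtains c where "\<And>z. z \<in> strip L \<Longrightarrow> c z \<noteq> 0"
    "C1_wirtinger_on (strip L) F (\<lambda>z. c z * (fz (exp z) * exp z)) (\<lambda>z. c z * (fzb (exp z) * cnj (exp z)))"
proof
  define c where "c z = deriv \<Gamma> (f (exp z)) / \<Gamma> (f (exp z))" for z
  show "c z \<noteq> 0" if "z \<in> strip L" for z using nz exp[OF that] by (simp add: c_def)
  have comp: "continuous_on (strip L) (\<lambda>z. h (exp z))" if "continuous_on (open_annulus 1 (exp L)) h" for h :: "complex \<Rightarrow> complex"
    by (rule continuous_on_compose2[OF that]) (auto intro!: continuous_intros simp: exp_open_annulus)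
  have cf: "continuous_on (strip L) (\<lambda>z. f (exp z))" "continuous_on (strip L) (\<lambda>z. fz (exp z))"
    "continuous_on (strip L) (\<lambda>z. fzb (exp z))"
    using f C1_wirtinger_on_continuous[OF f] unfolding C1_wirtinger_on_def by (auto intro: comp)
  have c1: "continuous_on (strip L) (\<lambda>z. deriv \<Gamma> (f (exp z)))"
    using exp by (intro continuous_on_compose2[OF holomorphic_on_imp_continuous_on[OF holomorphic_deriv[OF \<Gamma> V]] cf(1)]) auto
  have c2: "continuous_on (strip L) (\<lambda>z. \<Gamma> (f (exp z)))"
    using exp by (intro continuous_on_compose2[OF holomorphic_on_imp_continuous_on[OF \<Gamma>] cf(1)]) auto
  have cc: "continuous_on (strip L) c"
    unfolding c_def using nz exp by (intro continuous_intros c1 c2) auto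
  show "C1_wirtinger_on (strip L) F (\<lambda>z. c z * (fz (exp z) * exp z)) (\<lambda>z. c z * (fzb (exp z) * cnj (exp z)))"
    unfolding C1_wirtinger_on_def
  proof (intro conjI ballI)
    show "continuous_on (strip L) (\<lambda>z. c z * (fz (exp z) * exp z))"
      "continuous_on (strip L) (\<lambda>z. c z * (fzb (exp z) * cnj (exp z)))"
      by (intro continuous_intros cc cf)+
    fix z assume z: "z \<in> strip L"
    have 1: "has_wirtinger f (fz (exp z)) (fzb (exp z)) (exp z)"
      using f z unfolding C1_wirtinger_on_def exp_open_annulus[symmetric] by blast
    have 2: "has_wirtinger (\<lambda>z. f (exp z)) (fz (exp z) * exp z) (fzb (exp z) * cnj (exp z)) z"
      by (rule has_wirtinger_compose_holomorphic[OF DERIV_exp 1])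
    have 3: "(\<Gamma> has_field_derivative deriv \<Gamma> (f (exp z))) (at (f (exp z)))"
      using \<Gamma> V exp[OF z] by (intro holomorphic_derivI) auto
    have "has_wirtinger F (deriv \<Gamma> (f (exp z)) * (fz (exp z) * exp z) / \<Gamma> (f (exp z)))
        (deriv \<Gamma> (f (exp z)) * (fzb (exp z) * cnj (exp z)) / \<Gamma> (f (exp z))) z"
      using exp by (intro has_wirtinger_logarithm[OF open_strip z F _ has_wirtinger_holomorphic_compose[OF 3 2]]) blast
    then show "has_wirtinger F (c z * (fz (exp z) * exp z)) (c z * (fzb (exp z) * cnj (exp z))) z"
      by (simp add: c_def)
  qed simp
qed

lemma jac_transition:
  "jac (\<lambda>z. c z * (fz (exp z) * exp z)) (\<lambda>z. c z * (fzb (exp z) * cnj (exp z))) z =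
    (cmod (c z * exp z))\<^sup>2 * jac fz fzb (exp z)"
  by (simp add: jac_def norm_mult power_mult_distrib algebra_simps)

text \<open>The transition map is holomorphic, so its squared stretch equals its Jacobian and
  \<open>D = 1\<close> is admissible; the upper bound then reads
  \<open>M * (2 * pi / L) \<le> 2 * pi\<close>. Exchanging the two maps gives the reverse
  inequality.\<close>

lemma conformal_module_le:
  assumes L: "L > 0" and M: "M > 0" and g1: "conformal_annulus_image R 1 (exp L) g1"
    and g2: "conformal_annulus_image R 1 (exp M) g2"
  shows "M \<le> L"
proof -
  obtain g1' where g: "homeomorphism (closed_annulus 1 (exp L)) R g1 g1'"
    and hol: "g1 holomorphic_on open_annulus 1 (exp L)"
    using g1 by (auto simp: conformal_annulus_image_def)
  obtain F G k V \<Gamma> where F: "strip_homeo L M F G k" and V: "open V" "\<Gamma> holomorphic_on V"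
    "\<And>v. v \<in> V \<Longrightarrow> deriv \<Gamma> v \<noteq> 0 \<and> \<Gamma> v \<noteq> 0"
    "\<And>z. z \<in> strip L \<Longrightarrow> g1 (exp z) \<in> V \<and> exp (F z) = \<Gamma> (g1 (exp z))"
    using conformal_transition[OF L M g g2] by blast
  have C1: "C1_wirtinger_on (open_annulus 1 (exp L)) g1 (deriv g1) (\<lambda>_. 0)"
    unfolding C1_wirtinger_on_def has_wirtinger_def
    using holomorphic_on_imp_continuous_on[OF holomorphic_deriv[OF hol open_open_annulus]]
      holomorphic_derivI[OF hol open_open_annulus]
    by (auto simp: open_open_annulus has_field_derivative_def)
  interpret strip_homeo L M F G k by (rule F)
  obtain c where c: "C1_wirtinger_on (strip L) F (\<lambda>z. c z * (deriv g1 (exp z) * exp z)) (\<lambda>z. c z * (0 * cnj (exp z)))"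
    using transition_C1_wirtinger[OF contF V C1] by metis
  have "M * integral {0..2*pi} (\<lambda>y. inverse (integral {0..L} (\<lambda>x. (\<lambda>_. 1) (Complex x y)))) \<le> 2 * pi"
  proof (rule upper_module_bound[OF c])
  qed (auto simp: jac_def)
  then have "M * (2 * pi / L) \<le> 2 * pi" using L by (simp add: field_simps)
  then have "(2 * pi) * M \<le> (2 * pi) * L" using L by (simp add: field_simps)
  then show ?thesis by simp
qed

lemma conformal_module_eq:
  assumes "conformal_annulus_image R a c g"
  shows "conformal_module R = ln (c / a) / (2 * pi)"
  unfolding conformal_module_def
proof (rule the_equality)
  show "\<exists>a' c' g. conformal_annulus_image R a' c' g \<and> ln (c / a) / (2 * pi) = ln (c' / a') / (2 * pi)"
    using assms by blast
  fix m assume "\<exists>a c g. conformal_annulus_image R a c g \<and> m = ln (c / a) / (2 * pi)"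
  then obtain a' c' g' where g': "conformal_annulus_image R a' c' g'" and m: "m = ln (c' / a') / (2 * pi)"
    by blast
  obtain L g1 where 1: "L > 0" "L = ln (c / a)" "conformal_annulus_image R 1 (exp L) g1"
    using conformal_annulus_image_normalized[OF assms] .
  obtain M g2 where 2: "M > 0" "M = ln (c' / a')" "conformal_annulus_image R 1 (exp M) g2"
    using conformal_annulus_image_normalized[OF g'] .
  have "M = L" using conformal_module_le 1 2 by (meson order_antisym)
  then show "m = ln (c / a) / (2 * pi)" using m 1 2 by simp
qed

lemma integral_exp_substitution:
  fixes q :: "real \<Rightarrow> real"
  assumes "b > 1" and q: "continuous_on {1..b} q"
  shows "integral {1..b} (\<lambda>r. q r / r) = integral {0..ln b} (\<lambda>x. q (exp x))"
proof -
  have "((\<lambda>x. exp x *\<^sub>R (q (exp x) / exp x)) has_integral integral {exp 0..exp (ln b)} (\<lambda>r. q r / r)) {0..ln b}"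
  proof (rule has_integral_substitution[where c = 1 and d = b])
    show "exp ` {0..ln b} \<subseteq> {1..b}" using assms(1) by (auto simp: ln_ge_iff)
    show "continuous_on {1..b} (\<lambda>r. q r / r)" by (intro continuous_intros q) auto
    show "(exp has_real_derivative exp x) (at x within {0..ln b})" for x
      by (auto intro!: derivative_eq_intros)
  qed (use assms(1) in auto)
  then have "((\<lambda>x. q (exp x)) has_integral integral {1..b} (\<lambda>r. q r / r)) {0..ln b}"
    using assms(1) by simp
  then show ?thesis by (simp add: integral_unique)
qed

text \<open>Under \<open>exp\<close> horizontal and vertical directions at \<open>z\<close> become
  radial and circular ones at \<open>exp z\<close>, turned by \<open>Im z\<close>. Hence
  \<open>D s z\<close> uses the angle \<open>Im z + s\<close>, with \<open>s = 0\<close> for the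
  upper and \<open>s = pi / 2\<close> for the lower bound. The factor \<open>c z * exp z\<close>
  multiplies the stretch and the square root of the Jacobian equally.\<close>

lemma conformal_annulus_image_bounds:
  fixes b :: real
  assumes b: "b > 1" and U: "open U" "closed_annulus 1 b \<subseteq> U"
    and homeo: "homeomorphism U (f ` U) f f'"
    and cont: "continuous_on U fz" "continuous_on U fzb"
    and der: "\<And>z. z \<in> U \<Longrightarrow> (f has_derivative (\<lambda>h. fz z * h + fzb z * cnj h)) (at z)"
    and jac: "\<And>z. z \<in> closed_annulus 1 b \<Longrightarrow> jac fz fzb z > 0"
    and g: "conformal_annulus_image (f ` closed_annulus 1 b) 1 (exp M) g" and M: "M > 0"
  shows "integral {1..b} (\<lambda>r. inverse (integral {0..2*pi}
            (\<lambda>\<theta>. dir_dil fz fzb (\<theta> + pi/2) (complex_of_real r * cis \<theta>))) / r) \<le> M / (2 * pi)"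
      (is "?lower \<le> _")
    and "M / (2 * pi) \<le> inverse (integral {0..2*pi} (\<lambda>\<theta>. inverse (integral {1..b}
            (\<lambda>r. dir_dil fz fzb \<theta> (complex_of_real r * cis \<theta>) / r))))"
      (is "_ \<le> ?upper")
proof -
  define L where "L = ln b"
  have L: "L > 0" and expL: "exp L = b" using b by (auto simp: L_def)
  have "homeomorphism (closed_annulus 1 (exp L)) (f ` closed_annulus 1 b) f f'"
    unfolding expL using homeo U(2) by (rule homeomorphism_of_subsets) auto
  then obtain F G k V \<Gamma> where F: "strip_homeo L M F G k" and V: "open V" "\<Gamma> holomorphic_on V"
    "\<And>v. v \<in> V \<Longrightarrow> deriv \<Gamma> v \<noteq> 0 \<and> \<Gamma> v \<noteq> 0"
    "\<And>z. z \<in> strip L \<Longrightarrow> f (exp z) \<in> V \<and> exp (F z) = \<Gamma> (f (exp z))"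
    using conformal_transition[OF L M _ g] by blast
  interpret strip_homeo L M F G k by (rule F)
  have ann: "open_annulus 1 (exp L) \<subseteq> U" using U(2) open_annulus_subset[of 1 b] by (simp add: expL)
  have C1f: "C1_wirtinger_on (open_annulus 1 (exp L)) f fz fzb"
    unfolding C1_wirtinger_on_def has_wirtinger_def
    using ann cont der open_open_annulus continuous_on_subset by blast
  obtain c where c: "\<And>z. z \<in> strip L \<Longrightarrow> c z \<noteq> 0" and
    C1: "C1_wirtinger_on (strip L) F (\<lambda>z. c z * (fz (exp z) * exp z)) (\<lambda>z. c z * (fzb (exp z) * cnj (exp z)))"
      (is "C1_wirtinger_on _ _ ?Fz ?Fzb")
    using transition_C1_wirtinger[OF contF V C1f] by blast
  have cs: "exp z \<in> closed_annulus 1 b" if "z \<in> cstrip 0 L" for z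
    using that unfolding exp_closed_annulus[symmetric] expL .
  have cs': "exp z \<in> closed_annulus 1 b" if "z \<in> strip L" for z
    using that by (intro cs) (auto simp: strip_def cstrip_def)
  have jacF: "jac ?Fz ?Fzb z \<ge> 0" if "z \<in> strip L" for z
    unfolding jac_transition using jac[OF cs'[OF that]] by simp
  define D where "D s z = dir_dil fz fzb (Im z + s) (exp z)" for s z
  have Dpos: "D s z > 0" if "z \<in> cstrip 0 L" for s z
    unfolding D_def using jac[OF cs[OF that]] by (rule dir_dil_eq(2))
  \<comment> \<open>The turn by \<open>Im z\<close> in the definition of \<open>D\<close> is exactly
    what converts \<open>exp z\<close> into the factor \<open>cnj (exp z)\<close> that the chain
    rule puts on \<open>?Fzb\<close>.\<close>
  have rot: "exp z * exp (- 2 * \<i> * of_real (Im z)) = cnj (exp z)" for z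
  proof -
    have "z + - 2 * \<i> * of_real (Im z) = cnj z" by (simp add: complex_eq_iff)
    then show ?thesis unfolding exp_add[symmetric] exp_cnj by simp
  qed
  have Djac: "D s z * jac ?Fz ?Fzb z = (cmod (?Fz z + exp (- 2 * \<i> * of_real s) * ?Fzb z))\<^sup>2"
    if "z \<in> strip L" for s z
  proof -
    have "D s z * jac ?Fz ?Fzb z = (cmod (c z * exp z))\<^sup>2 * (D s z * jac fz fzb (exp z))"
      unfolding jac_transition by (simp add: mult_ac)
    also have "\<dots> = (cmod (c z * exp z))\<^sup>2 * (cmod (fz (exp z) + exp (- 2 * \<i> * of_real (Im z + s)) * fzb (exp z)))\<^sup>2"
      unfolding D_def using dir_dil_eq(1)[OF jac[OF cs'[OF that]]] by simp
    also have "\<dots> = (cmod (c z * exp z * (fz (exp z) + exp (- 2 * \<i> * of_real (Im z + s)) * fzb (exp z))))\<^sup>2"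
      by (simp only: norm_mult power_mult_distrib)
    also have "exp (- 2 * \<i> * of_real (Im z + s)) = exp (- 2 * \<i> * of_real (Im z)) * exp (- 2 * \<i> * of_real s)"
      by (simp add: exp_add[symmetric] algebra_simps)
    also have "c z * exp z * (fz (exp z) + exp (- 2 * \<i> * of_real (Im z)) * exp (- 2 * \<i> * of_real s) * fzb (exp z))
       = c z * (fz (exp z) * exp z) + exp (- 2 * \<i> * of_real s) * (c z * (fzb (exp z) * (exp z * exp (- 2 * \<i> * of_real (Im z)))))"
      by (simp add: algebra_simps)
    finally show ?thesis unfolding rot .
  qed
  have ce: "continuous_on (cstrip 0 L) (\<lambda>z. fz (exp z))" "continuous_on (cstrip 0 L) (\<lambda>z. fzb (exp z))"
    using cs U(2) by (auto intro!: continuous_on_compose2[OF cont(1)] continuous_on_compose2[OF cont(2)] continuous_intros)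
  have contD: "continuous_on (cstrip 0 L) (D s)" for s
  proof -
    have *: "cmod (fzb (exp z)) < cmod (fz (exp z))" if "z \<in> cstrip 0 L" for z
      using jac[OF cs[OF that]] unfolding jac_def by (simp add: power_less_imp_less_base)
    then have 1: "fz (exp z) \<noteq> 0" if "z \<in> cstrip 0 L" for z using that by fastforce
    have 2: "1 - (cmod (cdil fz fzb (exp z)))\<^sup>2 \<noteq> 0" if "z \<in> cstrip 0 L" for z
    proof -
      have "cmod (cdil fz fzb (exp z)) < 1" using *[OF that] by (simp add: cdil_def norm_divide divide_less_eq)
      then have "(cmod (cdil fz fzb (exp z)))\<^sup>2 < 1" by (simp add: power_less_one_iff abs_square_less_1)
      then show ?thesis by simp
    qed
    have "continuous_on (cstrip 0 L) (\<lambda>z. cdil fz fzb (exp z))"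
      unfolding cdil_def using 1 by (intro continuous_intros ce) auto
    then show ?thesis unfolding D_def dir_dil_def using 2 by (intro continuous_intros) auto
  qed
  have DC: "D s (Complex x y) = dir_dil fz fzb (y + s) (complex_of_real (exp x) * cis y)" for s x y
    by (simp add: D_def exp_eq_polar)
  have S: "Complex x y \<in> cstrip 0 L" if "x \<in> {0..L}" for x y using that by (simp add: cstrip_def)
  have cann: "complex_of_real r * cis t \<in> closed_annulus 1 b" if "r \<in> {1..b}" for r t
    using that by (simp add: closed_annulus_def norm_mult)
  show "M / (2 * pi) \<le> ?upper"
  proof -
    have eq: "integral {1..b} (\<lambda>r. dir_dil fz fzb \<theta> (complex_of_real r * cis \<theta>) / r) =
        integral {0..L} (\<lambda>x. D 0 (Complex x \<theta>))" for \<theta>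
    proof -
      have "continuous_on {1..b} (\<lambda>r. D 0 (Complex (ln r) \<theta>))"
      proof (rule continuous_on_compose2[OF contD])
        show "continuous_on {1..b} (\<lambda>r. Complex (ln r) \<theta>)"
          unfolding Complex_eq by (intro continuous_intros) auto
        show "(\<lambda>r. Complex (ln r) \<theta>) ` {1..b} \<subseteq> cstrip 0 L"
          using b by (auto simp: cstrip_def L_def)
      qed
      then have "continuous_on {1..b} (\<lambda>r. dir_dil fz fzb \<theta> (complex_of_real r * cis \<theta>))"
        by (rule continuous_on_eq) (auto simp: DC)
      from integral_exp_substitution[OF b this] show ?thesis by (simp add: DC L_def)
    qed
    let ?Y = "integral {0..2*pi} (\<lambda>y. inverse (integral {0..L} (\<lambda>x. D 0 (Complex x y))))"
    have "M * ?Y \<le> 2 * pi"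
    proof (rule upper_module_bound[OF C1 jacF contD Dpos])
      show "(cmod (?Fz z + ?Fzb z))\<^sup>2 \<le> D 0 z * jac ?Fz ?Fzb z" if "z \<in> strip L" for z
        using Djac[OF that, of 0] by simp
    qed
    \<comment> \<open>Since \<open>inverse 0 = 0\<close>, the product inequality gives a bound by
      the reciprocal only once the integral is known to be nonzero.\<close>
    moreover have "?Y > 0"
    proof -
      have pos: "integral {0..L} (\<lambda>x. D 0 (Complex x y)) > 0" for y
      proof (rule length_area(2)[OF L, where \<phi> = "\<lambda>_. 0" and \<phi>' = "\<lambda>_. 0" and J = "\<lambda>_. 0"])
        show "continuous_on {0..L} (\<lambda>x. D 0 (Complex x y))"
          by (auto intro!: continuous_on_integral_Complex(5)[OF contD, where c = y and d = y] S)
      qed (use Dpos S in auto)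
      have "continuous_on {0..2*pi} (\<lambda>y. inverse (integral {0..L} (\<lambda>x. D 0 (Complex x y))))"
        using pos by (intro continuous_intros continuous_on_integral_Complex(2)[OF contD S]) (auto simp: less_le)
      then show ?thesis
        using pos by (intro length_area(2)[where \<phi> = "\<lambda>_. 0" and \<phi>' = "\<lambda>_. 0" and J = "\<lambda>_. 0"]) auto
    qed
    ultimately show ?thesis unfolding eq by (simp add: field_simps)
  qed
  define s where "s = pi / 2"
  define q where "q x = inverse (integral {0..2*pi} (\<lambda>y. D s (Complex x y)))" for x
  have es: "exp (- 2 * \<i> * complex_of_real s) = -1"
    by (simp add: s_def exp_minus)
  have qpos: "integral {0..2*pi} (\<lambda>y. D s (Complex x y)) > 0" if "x \<in> {0..L}" for x
  proof (rule length_area(2)[where \<phi> = "\<lambda>_. 0" and \<phi>' = "\<lambda>_. 0" and J = "\<lambda>_. 0"])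
    show "continuous_on {0..2*pi} (\<lambda>y. D s (Complex x y))"
      by (rule continuous_on_integral_Complex(4)[OF contD S that])
  qed (use Dpos S[OF that] in auto)
  have contq: "continuous_on {0..L} q"
    unfolding q_def using qpos
    by (intro continuous_intros continuous_on_integral_Complex(1)[OF contD S]) (auto simp: less_le)
  \<comment> \<open>Truncated because \<open>F\<close> is differentiable in the open strip only;
    continuity of the indefinite integral of \<open>q\<close> then restores the full
    interval.\<close>
  have lower: "2 * pi * integral {d..L-d} q \<le> M" if d: "0 < d" "2 * d < L" for d
    unfolding q_def
  proof (rule lower_module_bound[OF _ _ C1])
    have sub: "cstrip d (L - d) \<subseteq> strip L" and sub2: "cstrip d (L - d) \<subseteq> cstrip 0 L"
      using d by (auto simp: cstrip_def strip_def)
    show "cstrip d (L - d) \<subseteq> strip L" by (rule sub)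
    show "inj_on F (cstrip d (L - d))" using GF sub by (metis inj_onI subsetD)
    show "F (z + period) = F z + of_int k * period" if "z \<in> cstrip d (L - d)" for z
      using that sub by (intro per) auto
    show "0 \<le> Re (F z) \<and> Re (F z) \<le> M" if "z \<in> cstrip d (L - d)" for z
      using that sub F by (force simp: strip_def)
    show "continuous_on (cstrip d (L - d)) (D s)" by (rule continuous_on_subset[OF contD sub2])
    show "0 \<le> jac ?Fz ?Fzb z" if "z \<in> cstrip d (L - d)" for z using jacF that sub by blast
    show "0 < D s z" if "z \<in> cstrip d (L - d)" for z using Dpos that sub2 by blast
    show "(cmod (?Fz z - ?Fzb z))\<^sup>2 \<le> D s z * jac ?Fz ?Fzb z" if "z \<in> cstrip d (L - d)" for z
      using Djac[of z s] that sub unfolding es by auto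
    show "k = 1 \<or> k = -1" by (rule k)
  qed (use d M in auto)
  have "2 * pi * integral {0..L} q \<le> M"
  proof -
    have iq: "q integrable_on {0..L}" using contq by (rule integrable_continuous_real)
    define I where "I t = integral {0..t} q" for t
    have cI: "continuous_on {0..L} I" unfolding I_def by (rule indefinite_integral_continuous_1[OF iq])
    \<comment> \<open>With offset 3 the condition \<open>2 * d n < L\<close> holds already for
      \<open>n = 0\<close>.\<close>
    define d where "d n = L / (real n + 3)" for n
    have d: "0 < d n" "2 * d n < L" for n
      using L by (auto simp: d_def field_simps intro!: add_pos_nonneg)
    have d0: "d \<longlonglongrightarrow> 0"
    proof -
      have "(\<lambda>n. L * inverse (real (n + 3))) \<longlonglongrightarrow> L * 0"
        by (intro tendsto_intros LIMSEQ_ignore_initial_segment[OF lim_inverse_n])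
      then show ?thesis by (simp add: d_def[abs_def] divide_inverse)
    qed
    have "(\<lambda>n. I (L - d n)) \<longlonglongrightarrow> I L"
    proof (rule continuous_on_tendsto_compose[OF cI])
      show "(\<lambda>n. L - d n) \<longlonglongrightarrow> L" using tendsto_diff[OF tendsto_const[of L] d0] by simp
      have "L - d n \<in> {0..L}" for n using d[of n] by auto
      then show "\<forall>\<^sub>F n in sequentially. L - d n \<in> {0..L}" by simp
    qed (use L in auto)
    moreover have "(\<lambda>n. I (d n)) \<longlonglongrightarrow> I 0"
    proof (rule continuous_on_tendsto_compose[OF cI d0])
      show "\<forall>\<^sub>F n in sequentially. d n \<in> {0..L}"
        using d by (intro always_eventually) (smt (verit) atLeastAtMost_iff)
    qed (use L in auto)
    ultimately have "(\<lambda>n. 2 * pi * (I (L - d n) - I (d n))) \<longlonglongrightarrow> 2 * pi * (I L - I 0)"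
      by (intro tendsto_intros)
    moreover have "2 * pi * (I (L - d n) - I (d n)) \<le> M" for n
    proof -
      have "I (d n) + integral {d n..L - d n} q = I (L - d n)"
        unfolding I_def
      proof (rule Henstock_Kurzweil_Integration.integral_combine)
        show "q integrable_on {0..L - d n}"
          by (rule integrable_subinterval_real[OF iq]) (use d(1)[of n] in auto)
      qed (use d[of n] in auto)
      then show ?thesis using lower[OF d(1,2)[of n]] by (smt (verit))
    qed
    ultimately have "2 * pi * (I L - I 0) \<le> M" by (meson LIMSEQ_le_const2)
    then show ?thesis by (simp add: I_def)
  qed
  moreover have "?lower = integral {0..L} q"
  proof -
    let ?q = "\<lambda>r. inverse (integral {0..2*pi} (\<lambda>\<theta>. dir_dil fz fzb (\<theta> + pi/2) (complex_of_real r * cis \<theta>)))"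
    have q: "q x = ?q (exp x)" for x by (simp add: q_def DC s_def)
    have "continuous_on {1..b} (\<lambda>r. q (ln r))"
      by (intro continuous_on_compose2[OF contq] continuous_intros) (use b in \<open>auto simp: L_def\<close>)
    then have "continuous_on {1..b} ?q" by (rule continuous_on_eq) (simp add: q)
    from integral_exp_substitution[OF b this] show ?thesis unfolding q[symmetric] L_def by simp
  qed
  ultimately show "?lower \<le> M / (2 * pi)"
    by (simp add: field_simps)
qed

section \<open>Translations of simply connected domains\<close>

text \<open>Composing \<open>T\<close> with the Moebius map that sends \<open>T 0\<close> to 0 gives
  \<open>S\<close> with \<open>S 0 = 0\<close>. The Schwarz lemma for \<open>S\<close> and for its
  inverse gives equality of moduli at the point 1/2, so \<open>S\<close> is the rotation by
  \<open>\<kappa>\<close>; undoing the Moebius map yields the formula.\<close>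

lemma disc_automorphism:
  assumes hol: "T holomorphic_on ball 0 1" "T' holomorphic_on ball 0 1"
    and T: "\<And>z. cmod z < 1 \<Longrightarrow> cmod (T z) < 1 \<and> T' (T z) = z"
    and T': "\<And>z. cmod z < 1 \<Longrightarrow> cmod (T' z) < 1 \<and> T (T' z) = z"
  obtains \<kappa> where "cmod \<kappa> = 1" "\<And>z. cmod z < 1 \<Longrightarrow> T z = (\<kappa> * z + T 0) / (1 + cnj (T 0) * \<kappa> * z)"
proof -
  define t where "t = T 0"
  have t: "cmod t < 1" using T[of 0] by (simp add: t_def)
  define m where "m w z = (z - w) / (1 - cnj w * z)" for w z :: complex
  have m_eq: "m = Moebius_function 0" by (intro ext) (simp add: m_def Moebius_function_simple)
  have m1: "cmod (m w z) < 1" if "cmod w < 1" "cmod z < 1" for w z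
    using that by (simp add: m_eq Moebius_function_norm_lt_1)
  have mm: "m (- w) (m w z) = z" if "cmod w < 1" "cmod z < 1" for w z
    unfolding m_eq using that by (intro Moebius_function_compose) auto
  have mhol: "m w holomorphic_on ball 0 1" if "cmod w < 1" for w
    unfolding m_eq using that by (rule Moebius_function_holomorphic)
  define S where "S z = m t (T z)" for z
  define S' where "S' z = T' (m (- t) z)" for z
  have Sd: "cmod (S z) < 1" if "cmod z < 1" for z using m1 T t that by (simp add: S_def)
  have S'd: "cmod (S' z) < 1" if "cmod z < 1" for z using m1 T' t that by (simp add: S'_def)
  have S'S: "S' (S z) = z" if "cmod z < 1" for z using mm T t that by (simp add: S_def S'_def)
  have "S holomorphic_on ball 0 1" unfolding S_def
    using T by (intro holomorphic_on_compose_gen[OF hol(1) mhol[OF t], unfolded o_def]) auto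
  moreover have "S 0 = 0" by (simp add: S_def m_def t_def)
  ultimately have le1: "cmod (S z) \<le> cmod z" and rot: "(\<exists>z. cmod z < 1 \<and> z \<noteq> 0 \<and> cmod (S z) = cmod z)
      \<Longrightarrow> \<exists>\<alpha>. (\<forall>z. cmod z < 1 \<longrightarrow> S z = \<alpha> * z) \<and> cmod \<alpha> = 1" if "cmod z < 1" for z
    using Schwarz_Lemma[of S] Sd that by blast+
  have "S' holomorphic_on ball 0 1" unfolding S'_def
    using m1 t by (intro holomorphic_on_compose_gen[OF mhol hol(2), unfolded o_def]) auto
  moreover have "S' 0 = 0" using T[of 0] by (simp add: S'_def m_def t_def)
  ultimately have le2: "cmod (S' z) \<le> cmod z" if "cmod z < 1" for z
    using Schwarz_Lemma(1)[of S'] S'd that by blast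
  have half: "cmod (1 / 2) < 1" by simp
  have "cmod (S (1 / 2)) = cmod (1 / 2)"
    using le1[OF half] le2[OF Sd[OF half]] S'S[OF half] by simp
  moreover have "(1 / 2 :: complex) \<noteq> 0" by simp
  ultimately obtain \<kappa> where \<kappa>: "\<And>z. cmod z < 1 \<Longrightarrow> S z = \<kappa> * z" "cmod \<kappa> = 1"
    using rot[OF half] half by blast
  show ?thesis
  proof
    fix z assume z: "cmod z < 1"
    have "T z = m (- t) (S z)" using mm[OF t, of "T z"] T[OF z] by (simp add: S_def)
    then show "T z = (\<kappa> * z + T 0) / (1 + cnj (T 0) * \<kappa> * z)"
      by (simp add: \<kappa>(1)[OF z] m_def t_def mult_ac)
  qed (rule \<kappa>(2))
qed

text \<open>Fixed points are the roots of \<open>c * z\<^sup>2 + (1 - \<kappa>) * z - t\<close>, a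
  true quadratic as \<open>t \<noteq> 0\<close>. The product of the roots is \<open>- t / c\<close>,
  of modulus 1, so one root lies in the closed disc; the open disc is excluded by
  \<open>nofix\<close>. \<open>r'\<close> is the second root by Vieta.\<close>

lemma fixed_point_on_circle:
  assumes t: "t \<noteq> 0" "cmod t < 1" and \<kappa>: "cmod \<kappa> = 1"
    and nofix: "\<And>z. cmod z < 1 \<Longrightarrow> (\<kappa> * z + t) / (1 + cnj t * \<kappa> * z) \<noteq> z"
  obtains q where "cmod q = 1" "\<kappa> * q + t = q + cnj t * \<kappa> * q\<^sup>2"
proof -
  define c where "c = cnj t * \<kappa>"
  have c: "c \<noteq> 0" "cmod c = cmod t" using t \<kappa> by (auto simp: c_def norm_mult)
  define D where "D = csqrt ((1 - \<kappa>)\<^sup>2 + 4 * c * t)"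
  define r where "r = (\<kappa> - 1 + D) / (2 * c)"
  have D2: "D\<^sup>2 = (1 - \<kappa>)\<^sup>2 + 4 * c * t" by (simp add: D_def)
  have r: "c * r\<^sup>2 + (1 - \<kappa>) * r - t = 0"
  proof -
    have "2 * c * r = \<kappa> - 1 + D" using c by (simp add: r_def)
    then have "4 * c * (c * r\<^sup>2 + (1 - \<kappa>) * r - t) = 0" using D2 by algebra
    then show ?thesis using c by simp
  qed
  have r0: "r \<noteq> 0" using r t by auto
  define r' where "r' = - t / (c * r)"
  have "c * r'\<^sup>2 + (1 - \<kappa>) * r' - t = - (t / (c * r\<^sup>2)) * (c * r\<^sup>2 + (1 - \<kappa>) * r - t)"
    using c r0 by (simp add: r'_def power_divide power2_eq_square field_simps)
  then have r': "c * r'\<^sup>2 + (1 - \<kappa>) * r' - t = 0" using r by simp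
  have "cmod r * cmod r' = 1" using c r0 t by (simp add: r'_def norm_divide norm_mult)
  then have "cmod r \<le> 1 \<or> cmod r' \<le> 1" by (smt (verit) mult_less_cancel_left2 norm_ge_zero)
  then obtain q where q: "cmod q \<le> 1" "c * q\<^sup>2 + (1 - \<kappa>) * q - t = 0" using r r' by blast
  have eq: "\<kappa> * q + t = q + c * q\<^sup>2" using q(2) by (simp add: algebra_simps)
  have "cmod q = 1"
  proof (rule ccontr)
    assume "cmod q \<noteq> 1"
    then have q1: "cmod q < 1" using q(1) by simp
    have "cmod (c * q) < 1" using c t q1 by (metis mult_le_one norm_ge_zero norm_mult less_imp_le mult_left_le_one_le le_less_trans)
    then have "1 + c * q \<noteq> 0" by (metis add_eq_0_iff norm_minus_cancel norm_one less_irrefl)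
    moreover have "\<kappa> * q + t = q * (1 + c * q)" using eq by (simp add: algebra_simps power2_eq_square)
    ultimately have "(\<kappa> * q + t) / (1 + c * q) = q" by simp
    then show False using nofix[OF q1] by (simp add: c_def)
  qed
  then show ?thesis using that eq by (simp add: c_def)
qed

text \<open>The map of the unit disc onto the right half plane that sends the boundary point
  \<open>q\<close> to infinity and 0 to 1.\<close>

definition cayley :: "complex \<Rightarrow> complex \<Rightarrow> complex" where
  "cayley q z = (q + z) / (q - z)"

definition inv_cayley :: "complex \<Rightarrow> complex \<Rightarrow> complex" where
  "inv_cayley q w = q * (w - 1) / (w + 1)"

lemma Re_cayley_pos:
  assumes "cmod q = 1" "cmod z < 1" shows "Re (cayley q z) > 0"
proof -
  have nz: "q - z \<noteq> 0" using assms by auto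
  have "cayley q z = (q + z) * cnj (q - z) / of_real ((cmod (q - z))\<^sup>2)"
    unfolding cayley_def complex_norm_square using nz by simp
  then have "Re (cayley q z) = Re ((q + z) * cnj (q - z)) / (cmod (q - z))\<^sup>2"
    by (simp only: Re_divide_of_real)
  also have "Re ((q + z) * cnj (q - z)) = (cmod q)\<^sup>2 - (cmod z)\<^sup>2"
    unfolding cmod_power2 by (simp add: power2_eq_square algebra_simps)
  finally have "Re (cayley q z) = ((cmod q)\<^sup>2 - (cmod z)\<^sup>2) / (cmod (q - z))\<^sup>2" .
  moreover have "(cmod z)\<^sup>2 < 1" using assms(2) by (simp add: abs_square_less_1)
  ultimately show ?thesis using assms(1) nz by simp
qed

lemma inv_cayley_in_disc:
  assumes "cmod q = 1" "Re w > 0" shows "cmod (inv_cayley q w) < 1"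
proof -
  have "(cmod (w - 1))\<^sup>2 < (cmod (w + 1))\<^sup>2"
    unfolding cmod_power2 using assms(2) by (simp add: power2_eq_square algebra_simps)
  then have "cmod (w - 1) < cmod (w + 1)" by (rule power_less_imp_less_base) simp
  then show ?thesis using assms(1)
    by (simp add: inv_cayley_def norm_divide norm_mult divide_less_eq)
qed

lemma cayley_inv_cayley: "cmod q = 1 \<Longrightarrow> Re w > 0 \<Longrightarrow> cayley q (inv_cayley q w) = w"
proof -
  assume q: "cmod q = 1" and w: "Re w > 0"
  have "q \<noteq> 0" using q by auto
  moreover have "w + 1 \<noteq> 0" using w by (auto simp: complex_eq_iff)
  moreover have "q + inv_cayley q w = 2 * q * w / (w + 1)" "q - inv_cayley q w = 2 * q / (w + 1)"
    using calculation by (simp_all add: inv_cayley_def field_simps)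
  ultimately show ?thesis by (simp add: cayley_def)
qed

lemma inv_cayley_cayley: "cmod q = 1 \<Longrightarrow> cmod z < 1 \<Longrightarrow> inv_cayley q (cayley q z) = z"
proof -
  assume q: "cmod q = 1" and z: "cmod z < 1"
  have "q \<noteq> 0" "q - z \<noteq> 0" using q z by auto
  moreover have "cayley q z - 1 = 2 * z / (q - z)" "cayley q z + 1 = 2 * q / (q - z)"
    using calculation by (simp_all add: cayley_def field_simps)
  ultimately show ?thesis by (simp add: inv_cayley_def)
qed

text \<open>The conjugated automorphism of the half plane fixes infinity, so it has the form
  \<open>\<alpha> * w + \<i> * \<beta>\<close> with real coefficients. They are read off from the
  orbit point 0: \<open>cayley q 0 = 1\<close> must go to \<open>cayley q t\<close>.\<close>

lemma cayley_conjugates_to_affine: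
  assumes q: "cmod q = 1" and t: "cmod t < 1" and \<kappa>: "cmod \<kappa> = 1" and z: "cmod z < 1"
    and fixq: "\<kappa> * q + t = q + cnj t * \<kappa> * q\<^sup>2"
  shows "cayley q ((\<kappa> * z + t) / (1 + cnj t * \<kappa> * z)) =
    of_real (Re (cayley q t)) * cayley q z + \<i> * of_real (Im (cayley q t))"
proof -
  let ?c = "cnj t * \<kappa>" and ?\<tau> = "cayley q t"
  have q0: "q \<noteq> 0" and qt: "q - t \<noteq> 0" and qz: "q - z \<noteq> 0" using q t z by auto
  have qq: "q * cnj q = 1" using q by (simp add: complex_norm_square[symmetric])
  have qt': "cnj q - cnj t \<noteq> 0" using qt by (metis complex_cnj_cnj complex_cnj_diff complex_cnj_zero)
  have "cmod (?c * z) < 1"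
    using t \<kappa> z by (simp add: norm_mult) (metis mult_strict_mono norm_ge_zero mult_1 zero_less_one)
  then have nz: "1 + ?c * z \<noteq> 0" by (metis add_eq_0_iff norm_minus_cancel norm_one less_irrefl)
  have den: "q * (1 + ?c * z) - (\<kappa> * z + t) = (q - t) * (q - z) / q"
  proof -
    have "q * (q * (1 + ?c * z) - (\<kappa> * z + t)) = (q - t) * (q - z)" using fixq by algebra
    then show ?thesis using q0 by (simp add: eq_divide_eq mult.commute)
  qed
  have \<kappa>eq: "\<kappa> * q\<^sup>2 * (cnj q - cnj t) = q - t" using fixq qq by algebra
  have num: "q * (1 + ?c * z) + (\<kappa> * z + t) = (q - t) * (q * ?\<tau> + z * cnj ?\<tau>) / q"
  proof -
    have \<tau>: "(q - t) * ?\<tau> = q + t" using qt by (simp add: cayley_def)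
    have \<tau>': "(cnj q - cnj t) * cnj ?\<tau> = cnj q + cnj t" using qt' by (simp add: cayley_def)
    have "(cnj q - cnj t) * (q * (q * (1 + ?c * z) + (\<kappa> * z + t))) =
        (cnj q - cnj t) * ((q - t) * (q * ?\<tau> + z * cnj ?\<tau>))"
      using \<tau> \<tau>' \<kappa>eq qq by algebra
    then have "q * (q * (1 + ?c * z) + (\<kappa> * z + t)) = (q - t) * (q * ?\<tau> + z * cnj ?\<tau>)"
      using qt' by simp
    then show ?thesis using q0 by (simp add: eq_divide_eq mult.commute)
  qed
  have "cayley q ((\<kappa> * z + t) / (1 + ?c * z)) =
      (q * (1 + ?c * z) + (\<kappa> * z + t)) / (q * (1 + ?c * z) - (\<kappa> * z + t))"
  proof -
    let ?n = "\<kappa> * z + t" and ?d = "1 + ?c * z"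
    have "q + ?n / ?d = (q * ?d + ?n) / ?d" "q - ?n / ?d = (q * ?d - ?n) / ?d"
      using nz by (simp_all add: add_divide_distrib diff_divide_distrib)
    then show ?thesis using nz by (simp add: cayley_def)
  qed
  also have "\<dots> = (q * ?\<tau> + z * cnj ?\<tau>) / (q - z)"
    unfolding num den using qt q0 by simp
  also have "\<dots> = of_real (Re ?\<tau>) * cayley q z + \<i> * of_real (Im ?\<tau>)"
  proof -
    have "q * ?\<tau> + z * cnj ?\<tau> = of_real (Re ?\<tau>) * (q + z) + \<i> * of_real (Im ?\<tau>) * (q - z)"
      by (simp add: complex_eq_iff algebra_simps)
    moreover have "(x * (q + z) + y * (q - z)) / (q - z) = x * cayley q z + y" for x y
      using qz by (simp add: cayley_def field_simps)
    ultimately show ?thesis by metis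
  qed
  finally show ?thesis .
qed

text \<open>The Riemann map turns the translation into a fixed point free automorphism of the disc;
  a fixed point on the circle is sent to infinity.\<close>
lemma translation_to_affine:
  assumes \<Omega>: "open \<Omega>" "simply_connected \<Omega>" "\<Omega> \<noteq> {}" "\<Omega> \<noteq> UNIV"
    and c: "c \<noteq> 0" "\<And>w. w \<in> \<Omega> \<longleftrightarrow> w + c \<in> \<Omega>"
  obtains H H' \<alpha> \<beta> where "H holomorphic_on \<Omega>" "H' holomorphic_on {w. Re w > 0}"
    "\<And>w. w \<in> \<Omega> \<Longrightarrow> Re (H w) > 0 \<and> H' (H w) = w" "\<And>w. Re w > 0 \<Longrightarrow> H' w \<in> \<Omega> \<and> H (H' w) = w"
    "\<alpha> > 0" "\<And>w. w \<in> \<Omega> \<Longrightarrow> H (w + c) = of_real \<alpha> * H w + \<i> * of_real \<beta>"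
proof -
  obtain \<Phi> \<Psi> where \<Phi>: "\<Phi> holomorphic_on \<Omega>" "\<Psi> holomorphic_on ball 0 1"
    "\<And>z. z \<in> \<Omega> \<Longrightarrow> cmod (\<Phi> z) < 1 \<and> \<Psi> (\<Phi> z) = z" "\<And>z. cmod z < 1 \<Longrightarrow> \<Psi> z \<in> \<Omega> \<and> \<Phi> (\<Psi> z) = z"
    using Riemann_mapping_theorem[of \<Omega>] \<Omega> by (auto simp: Ball_def)
  have c': "w \<in> \<Omega> \<longleftrightarrow> w - c \<in> \<Omega>" for w using c(2)[of "w - c"] by simp
  define T where "T z = \<Phi> (\<Psi> z + c)" for z
  define T' where "T' z = \<Phi> (\<Psi> z - c)" for z
  have TT': "cmod (T z) < 1 \<and> T' (T z) = z" "cmod (T' z) < 1 \<and> T (T' z) = z" if "cmod z < 1" for z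
    using \<Phi>(3,4) c(2) c' that by (auto simp: T_def T'_def)
  have holT: "T holomorphic_on ball 0 1" unfolding T_def
    using \<Phi>(4) c by (intro holomorphic_on_compose_gen[OF _ \<Phi>(1), unfolded o_def] holomorphic_intros \<Phi>(2)) auto
  have holT': "T' holomorphic_on ball 0 1" unfolding T'_def
    using \<Phi>(4) c' by (intro holomorphic_on_compose_gen[OF _ \<Phi>(1), unfolded o_def] holomorphic_intros \<Phi>(2)) auto
  have nofix: "T z \<noteq> z" if "cmod z < 1" for z
  proof
    assume "T z = z"
    then have "\<Psi> z + c = \<Psi> z" using \<Phi>(3,4) c(2) that unfolding T_def by metis
    then show False using c(1) by simp
  qed
  define t where "t = T 0"
  obtain \<kappa> where \<kappa>: "cmod \<kappa> = 1" "\<And>z. cmod z < 1 \<Longrightarrow> T z = (\<kappa> * z + t) / (1 + cnj t * \<kappa> * z)"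
    using disc_automorphism[OF holT holT' TT'] unfolding t_def by metis
  have t: "cmod t < 1" "t \<noteq> 0" using TT'(1)[of 0] nofix[of 0] by (auto simp: t_def)
  obtain q where q: "cmod q = 1" "\<kappa> * q + t = q + cnj t * \<kappa> * q\<^sup>2"
    using fixed_point_on_circle[OF t(2,1) \<kappa>(1)] nofix \<kappa>(2) by metis
  show ?thesis
  proof
    show "(\<lambda>w. cayley q (\<Phi> w)) holomorphic_on \<Omega>"
      unfolding cayley_def using q(1) \<Phi>(1,3) by (intro holomorphic_intros) force+
    have *: "w + 1 \<noteq> 0" if "Re w > 0" for w using that by (auto simp: complex_eq_iff)
    have "inv_cayley q holomorphic_on {w. Re w > 0}"
      unfolding inv_cayley_def using * by (intro holomorphic_intros) auto
    then show "(\<lambda>w. \<Psi> (inv_cayley q w)) holomorphic_on {w. Re w > 0}"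
      using inv_cayley_in_disc[OF q(1)] by (intro holomorphic_on_compose_gen[OF _ \<Phi>(2), unfolded o_def]) auto
    show "0 < Re (cayley q (\<Phi> w)) \<and> \<Psi> (inv_cayley q (cayley q (\<Phi> w))) = w" if "w \<in> \<Omega>" for w
      using \<Phi>(3)[OF that] by (simp add: Re_cayley_pos inv_cayley_cayley q)
    show "\<Psi> (inv_cayley q w) \<in> \<Omega> \<and> cayley q (\<Phi> (\<Psi> (inv_cayley q w))) = w" if "Re w > 0" for w
      using \<Phi>(4)[OF inv_cayley_in_disc[OF q(1) that]] that by (simp add: cayley_inv_cayley q)
    show "Re (cayley q t) > 0" using q(1) t(1) by (rule Re_cayley_pos)
    show "cayley q (\<Phi> (w + c)) = of_real (Re (cayley q t)) * cayley q (\<Phi> w) + \<i> * of_real (Im (cayley q t))"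
      if "w \<in> \<Omega>" for w
    proof -
      have "\<Phi> (w + c) = T (\<Phi> w)" using \<Phi>(3)[OF that] by (simp add: T_def)
      then show ?thesis
        using cayley_conjugates_to_affine[OF q(1) t(1) \<kappa>(1) _ q(2)] \<kappa>(2) \<Phi>(3)[OF that] by simp
    qed
  qed
qed

text \<open>The sign \<open>l\<close> is kept because upward and downward translations of the half
  plane are not conjugate under its holomorphic automorphisms; for a strip a half turn makes
  \<open>l = 1\<close> possible.\<close>

definition conjugates_translation ::
    "complex set \<Rightarrow> complex set \<Rightarrow> int \<Rightarrow> (complex \<Rightarrow> complex) \<Rightarrow> (complex \<Rightarrow> complex) \<Rightarrow> bool" where
  "conjugates_translation \<Omega> W l H H' \<longleftrightarrow> H holomorphic_on \<Omega> \<and> H' holomorphic_on W \<and>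
     (\<forall>w\<in>\<Omega>. H w \<in> W \<and> H' (H w) = w) \<and> (\<forall>w\<in>W. H' w \<in> \<Omega> \<and> H (H' w) = w) \<and>
     (\<forall>w\<in>\<Omega>. H (w + period) = H w + of_int l * period)"

text \<open>If \<open>\<alpha> = 1\<close> the affine map is a translation, nontrivial because
  \<open>H\<close> is injective, and scaling makes its length 2 pi: the half plane model. If
  \<open>\<alpha> \<noteq> 1\<close> it has a fixed point on the imaginary axis, and a logarithm
  centred there turns multiplication by \<alpha> into a translation of a strip.\<close>

lemma translation_model:
  assumes \<Omega>: "open \<Omega>" "simply_connected \<Omega>" "\<Omega> \<noteq> {}" "\<Omega> \<noteq> UNIV"
    and c: "\<And>w. w \<in> \<Omega> \<longleftrightarrow> w + period \<in> \<Omega>"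
  shows "(\<exists>H H' M. M > 0 \<and> conjugates_translation \<Omega> (strip M) 1 H H') \<or>
    (\<exists>H H' l. (l = 1 \<or> l = -1) \<and> conjugates_translation \<Omega> {w. Re w > 0} l H H')"
    (is "?strip \<or> ?half")
proof -
  have nz: "period \<noteq> 0" by simp
  obtain H H' \<alpha> \<beta> where H: "H holomorphic_on \<Omega>" "H' holomorphic_on {w. Re w > 0}"
    "\<And>w. w \<in> \<Omega> \<Longrightarrow> Re (H w) > 0 \<and> H' (H w) = w" "\<And>w. Re w > 0 \<Longrightarrow> H' w \<in> \<Omega> \<and> H (H' w) = w"
    and \<alpha>: "\<alpha> > 0" and per: "\<And>w. w \<in> \<Omega> \<Longrightarrow> H (w + period) = of_real \<alpha> * H w + \<i> * of_real \<beta>"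
    using translation_to_affine[OF \<Omega> nz c] by blast
  show ?thesis
  proof (cases "\<alpha> = 1")
    case True
    have \<beta>: "\<beta> \<noteq> 0"
    proof
      assume "\<beta> = 0"
      obtain w where w: "w \<in> \<Omega>" using \<Omega>(3) by auto
      then have "H (w + period) = H w" using per[OF w] True \<open>\<beta> = 0\<close> by simp
      then have "w + period = w" using H(3) w c by metis
      then show False by simp
    qed
    define s where "s = 2 * pi / \<bar>\<beta>\<bar>"
    have s: "s > 0" using \<beta> by (simp add: s_def)
    define k :: int where "k = (if \<beta> > 0 then 1 else -1)"
    have k\<beta>: "s * \<beta> = of_int k * (2 * pi)" using \<beta> by (auto simp: s_def k_def abs_if)
    have ?half
      unfolding conjugates_translation_def
    proof (rule exI[of _ "\<lambda>w. of_real s * H w"], rule exI[of _ "\<lambda>w. H' (w / of_real s)"], rule exI[of _ k],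
        intro conjI ballI)
      show "(\<lambda>w. H' (w / of_real s)) holomorphic_on {w. Re w > 0}"
        using s by (intro holomorphic_on_compose_gen[OF _ H(2), unfolded o_def] holomorphic_intros) auto
      show "of_real s * H (w + period) = of_real s * H w + of_int k * period" if "w \<in> \<Omega>" for w
      proof -
        have "of_real s * H (w + period) = of_real s * H w + of_real (s * \<beta>) * \<i>"
          using per[OF that] True by (simp add: algebra_simps)
        then show ?thesis unfolding k\<beta> by (simp add: mult_ac)
      qed
      show "k = 1 \<or> k = -1" by (simp add: k_def)
      show "(\<lambda>w. of_real s * H w) holomorphic_on \<Omega>" by (intro holomorphic_intros H(1))
      show "of_real s * H w \<in> {w. Re w > 0}" if "w \<in> \<Omega>" for w using H(3)[OF that] s by simp
      show "H' (of_real s * H w / of_real s) = w" if "w \<in> \<Omega>" for w using H(3)[OF that] s by simp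
      show "H' (w / of_real s) \<in> \<Omega>" "of_real s * H (H' (w / of_real s)) = w" if "w \<in> {w. Re w > 0}" for w
        using H(4)[of "w / of_real s"] that s by simp_all
    qed
    then show ?thesis ..
  next
    case False
    define l where "l = ln \<alpha>"
    have l: "l \<noteq> 0" using \<alpha> False by (simp add: l_def)
    \<comment> \<open>The fixed point is \<open>- e\<close>, so \<open>H w + e\<close> is multiplied
      by \<alpha>. Its logarithm moves by \<open>l\<close> in the strip where the imaginary part is
      below \<open>pi / 2\<close> in modulus; multiplication by \<open>u\<close> makes the step
      equal to \<open>period\<close> and the half width equal to \<open>m\<close>, and adding
      \<open>m\<close> places the left side at 0. A negative \<open>l\<close> is absorbed by
      \<open>u\<close>.\<close>
    define e where "e = \<i> * complex_of_real (\<beta> / (\<alpha> - 1))"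
    define m where "m = pi\<^sup>2 / \<bar>l\<bar>"
    have m: "m > 0" using l by (simp add: m_def)
    define u where "u = period / complex_of_real l"
    have u: "u \<noteq> 0" using l by (simp add: u_def)
    define h where "h w = u * Ln (H w + e) + of_real m" for w
    define h' where "h' \<zeta> = H' (exp ((\<zeta> - of_real m) / u) - e)" for \<zeta>
    have Ree: "Re (w + e) = Re w" "Re (w - e) = Re w" for w by (simp_all add: e_def)
    have Reu: "Re (u * x) = - 2 * pi * Im x / l" for x by (simp add: u_def)
    have Imu: "Im (x / u) = - l * Re x / (2 * pi)" for x
    proof -
      have "x / u = - \<i> * x * of_real l / of_real (2 * pi)"
        using l by (simp add: u_def field_simps)
      then show ?thesis by (simp del: of_real_mult)
    qed
    have bound: "\<bar>x\<bar> < pi / 2 \<longleftrightarrow> \<bar>- 2 * pi * x / l\<bar> < m" for x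
      using l by (simp add: m_def abs_mult power2_eq_square divide_less_cancel) (simp add: field_simps)
    have strip_iff: "\<zeta> \<in> strip (2 * m) \<longleftrightarrow> \<bar>Re \<zeta> - m\<bar> < m" for \<zeta> by (auto simp: strip_def)
    have hs: "h w \<in> strip (2 * m)" if "w \<in> \<Omega>" for w
    proof -
      have "Re (H w + e) > 0" unfolding Ree using H(3)[OF that] by simp
      then have "\<bar>Im (Ln (H w + e))\<bar> < pi / 2" by (rule Re_Ln_pos_lt_imp)
      moreover have "Re (h w) - m = - 2 * pi * Im (Ln (H w + e)) / l"
        unfolding h_def plus_complex.sel Reu by simp
      ultimately show ?thesis unfolding strip_iff bound by simp
    qed
    have h's: "Re (exp ((\<zeta> - of_real m) / u)) > 0" "\<bar>Im ((\<zeta> - of_real m) / u)\<bar> < pi / 2"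
      if "\<zeta> \<in> strip (2 * m)" for \<zeta>
    proof -
      have "Re \<zeta> - m = - 2 * pi * Im ((\<zeta> - of_real m) / u) / l"
        using l by (simp add: Imu)
      then show *: "\<bar>Im ((\<zeta> - of_real m) / u)\<bar> < pi / 2"
        using that unfolding strip_iff bound by simp
      show "Re (exp ((\<zeta> - of_real m) / u)) > 0"
        using * by (auto simp: Re_exp intro!: mult_pos_pos cos_gt_zero_pi)
    qed
    have ?strip
      unfolding conjugates_translation_def
    proof (rule exI[of _ h], rule exI[of _ h'], rule exI[of _ "2 * m"], intro conjI ballI)
      show "2 * m > 0" using m by simp
      have "H w + e \<notin> \<real>\<^sub>\<le>\<^sub>0" if "w \<in> \<Omega>" for w
        using H(3)[OF that] Ree(1)[of "H w"] by (auto simp: complex_nonpos_Reals_iff)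
      then show "h holomorphic_on \<Omega>" unfolding h_def by (intro holomorphic_intros H(1))
      show "h' holomorphic_on strip (2 * m)" unfolding h'_def
        using h's(1) Ree(2) u by (intro holomorphic_on_compose_gen[OF _ H(2), unfolded o_def] holomorphic_intros) auto
      fix w assume w: "w \<in> \<Omega>"
      have pos: "Re (H w + e) > 0" unfolding Ree using H(3)[OF w] by simp
      show "h w \<in> strip (2 * m)" by (rule hs[OF w])
      show "h' (h w) = w"
      proof -
        have "H w + e \<noteq> 0" using pos by (metis less_irrefl zero_complex.sel(1))
        then show ?thesis using u H(3)[OF w] by (simp add: h'_def h_def)
      qed
      show "h (w + period) = h w + of_int 1 * period"
      proof -
        have e': "e * of_real (\<alpha> - 1) = \<i> * of_real \<beta>" using False by (simp add: e_def)
        have "H (w + period) + e = of_real \<alpha> * (H w + e)"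
          using per[OF w] e' by (simp add: algebra_simps)
        moreover have "Ln (of_real \<alpha> * (H w + e)) = of_real l + Ln (H w + e)"
        proof -
          have "H w + e \<noteq> 0" using pos by (metis less_irrefl zero_complex.sel(1))
          then show ?thesis using \<alpha> by (simp add: l_def Ln_times_of_real Ln_of_real)
        qed
        ultimately have "Ln (H (w + period) + e) = of_real l + Ln (H w + e)" by simp
        moreover have "u * of_real l = period" using l by (simp add: u_def)
        ultimately show ?thesis by (simp add: h_def distrib_left)
      qed
    next
      fix \<zeta> assume \<zeta>: "\<zeta> \<in> strip (2 * m)"
      have *: "Re (exp ((\<zeta> - of_real m) / u) - e) > 0" unfolding Ree by (rule h's(1)[OF \<zeta>])
      show "h' \<zeta> \<in> \<Omega>" unfolding h'_def using H(4)[OF *] by simp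
      have "\<bar>Im ((\<zeta> - of_real m) / u)\<bar> < pi" using h's(2)[OF \<zeta>] pi_gt_zero by linarith
      then have "Ln (exp ((\<zeta> - of_real m) / u)) = (\<zeta> - of_real m) / u" by (intro Ln_exp) auto
      then show "h (h' \<zeta>) = \<zeta>" using H(4)[OF *] u by (simp add: h_def h'_def)
    qed
    then show ?thesis ..
  qed
qed

section \<open>Existence of the conformal map\<close>

text \<open>\<open>f\<close> may turn the ring inside out, so either boundary circle may surround
  the hole. The rest of the ring is connected, hence inside or outside each of the two Jordan
  curves. If it is outside one of them, any point inside that curve will do. It cannot be inside
  both: each curve would then lie inside the other.\<close>

lemma point_in_hole:
  assumes b: "b > 1" and cont: "continuous_on (closed_annulus 1 b) f" and inj: "inj_on f (closed_annulus 1 b)"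
  obtains r p where "r = 1 \<or> r = b" "p \<notin> f ` closed_annulus 1 b"
    "winding_number (f \<circ> circlepath 0 r) p = 1 \<or> winding_number (f \<circ> circlepath 0 r) p = -1"
proof -
  note witness = that
  define \<gamma> where "\<gamma> r = f \<circ> circlepath 0 r" for r :: real
  have sub: "sphere 0 r \<subseteq> closed_annulus 1 b" if "r = 1 \<or> r = b" for r
    using that b by (auto simp: closed_annulus_def)
  have pim: "path_image (\<gamma> r) = f ` sphere 0 r" if "r = 1 \<or> r = b" for r
    using that b by (auto simp: \<gamma>_def path_image_compose)
  have simple: "simple_path (\<gamma> r)" "pathfinish (\<gamma> r) = pathstart (\<gamma> r)" if r: "r = 1 \<or> r = b" for r
  proof -
    have r': "path_image (circlepath 0 r) = sphere 0 r" using r b by auto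
    show "simple_path (\<gamma> r)" unfolding \<gamma>_def
      using r b continuous_on_subset[OF cont sub[OF r]] inj_on_subset[OF inj sub[OF r]] r'
      by (intro simple_path_continuous_image) (auto simp: simple_path_circlepath)
    show "pathfinish (\<gamma> r) = pathstart (\<gamma> r)" by (simp add: \<gamma>_def pathfinish_compose pathstart_compose)
  qed
  note J = Jordan_inside_outside[OF simple]
  have rest: "connected (f ` (closed_annulus 1 b - sphere 0 r))" if r: "r = 1 \<or> r = b" for r
  proof -
    \<comment> \<open>In logarithmic coordinates, the ring without one bounding circle is a half
      open strip, which is convex; hence the connectedness.\<close>
    define I where "I = (if r = 1 then {0<..ln b} else {0..<ln b})"
    have "closed_annulus 1 b - sphere 0 r = exp ` (Re -` I)"
    proof (intro set_eqI iffI)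
      fix z assume z: "z \<in> closed_annulus 1 b - sphere 0 r"
      then have z0: "z \<noteq> 0" by (auto simp: closed_annulus_def)
      then have "Re (Ln z) \<in> I" using z r b by (auto simp: I_def closed_annulus_def)
      then show "z \<in> exp ` (Re -` I)" using z0 by (intro image_eqI[of _ _ "Ln z"]) auto
    next
      fix z assume "z \<in> exp ` (Re -` I)"
      then obtain w where "z = exp w" "Re w \<in> I" by auto
      moreover have "exp x \<le> b \<longleftrightarrow> x \<le> ln b" "exp x < b \<longleftrightarrow> x < ln b" for x
        using b exp_le_cancel_iff[of x "ln b"] exp_less_cancel_iff[of x "ln b"] by simp_all
      ultimately have "1 \<le> cmod z" "cmod z \<le> b" "cmod z \<noteq> r"
        using r b by (force simp: I_def norm_exp_eq_Re split: if_splits)+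
      then show "z \<in> closed_annulus 1 b - sphere 0 r" by (simp add: closed_annulus_def)
    qed
    moreover have "connected (exp ` (Re -` I))"
    proof (intro connected_continuous_image convex_connected continuous_intros)
      show "convex (Re -` I)"
        by (intro convex_linear_vimage bounded_linear.linear[OF bounded_linear_Re]) (simp add: I_def)
    qed
    ultimately show ?thesis
      by (intro connected_continuous_image continuous_on_subset[OF cont]) auto
  qed
  have disj: "f ` (closed_annulus 1 b - sphere 0 r) \<inter> path_image (\<gamma> r) = {}" if "r = 1 \<or> r = b" for r
    using inj sub[OF that] by (auto simp: pim[OF that] inj_on_def)
  have split: "f ` (closed_annulus 1 b - sphere 0 r) \<subseteq> inside (path_image (\<gamma> r)) \<or>
      f ` (closed_annulus 1 b - sphere 0 r) \<subseteq> outside (path_image (\<gamma> r))" if r: "r = 1 \<or> r = b" for r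
  proof -
    let ?S = "f ` (closed_annulus 1 b - sphere 0 r)" and ?i = "inside (path_image (\<gamma> r))"
      and ?o = "outside (path_image (\<gamma> r))"
    have "open ?i" "open ?o" "?i \<inter> ?o = {}" "?i \<union> ?o = - path_image (\<gamma> r)"
      using J[OF r r] by simp_all
    moreover have "?S \<subseteq> ?i \<union> ?o" using disj[OF r] calculation(4) by blast
    ultimately have "?i \<inter> ?S = {} \<or> ?o \<inter> ?S = {}"
      using connectedD[OF rest[OF r], of ?i ?o] by simp
    then show ?thesis using \<open>?S \<subseteq> ?i \<union> ?o\<close> by blast
  qed
  have found: thesis if r: "r = 1 \<or> r = b" and out: "f ` (closed_annulus 1 b - sphere 0 r) \<subseteq> outside (path_image (\<gamma> r))" for r
  proof -
    have ne: "inside (path_image (\<gamma> r)) \<noteq> {}" using J[OF r r] by simp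
    then obtain p where p: "p \<in> inside (path_image (\<gamma> r))" by blast
    have "p \<notin> f ` closed_annulus 1 b"
    proof
      assume "p \<in> f ` closed_annulus 1 b"
      then have "p \<in> f ` (closed_annulus 1 b - sphere 0 r) \<or> p \<in> path_image (\<gamma> r)"
        by (auto simp: pim[OF r])
      moreover have "inside (path_image (\<gamma> r)) \<inter> outside (path_image (\<gamma> r)) = {}" using J[OF r r] by simp
      ultimately show False using out p inside_no_overlap[of "path_image (\<gamma> r)"] by blast
    qed
    moreover have "winding_number (\<gamma> r) p = 1 \<or> winding_number (\<gamma> r) p = -1"
      by (rule simple_closed_path_winding_number_inside[OF simple(1)[OF r]]) (use p in blast)+
    ultimately show thesis using r unfolding \<gamma>_def by (intro witness[of r p])
  qed
  show thesis
  proof (rule ccontr)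
    assume "\<not> thesis"
    have in': "f ` (closed_annulus 1 b - sphere 0 r) \<subseteq> inside (path_image (\<gamma> r))" if "r = 1 \<or> r = b" for r
      using split[OF that]
    proof
      assume "f ` (closed_annulus 1 b - sphere 0 r) \<subseteq> outside (path_image (\<gamma> r))"
      then have thesis by (rule found[OF that])
      then show ?thesis using \<open>\<not> thesis\<close> by contradiction
    qed
    have in1: "f ` (closed_annulus 1 b - sphere 0 1) \<subseteq> inside (path_image (\<gamma> 1))"
      and inb: "f ` (closed_annulus 1 b - sphere 0 b) \<subseteq> inside (path_image (\<gamma> b))"
      by (rule in', simp)+
    let ?o1 = "outside (path_image (\<gamma> 1))" and ?ob = "outside (path_image (\<gamma> b))"
      and ?i1 = "inside (path_image (\<gamma> 1))" and ?ib = "inside (path_image (\<gamma> b))"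
    have J1: "open ?o1" "connected ?o1" "\<not> bounded ?o1" "?i1 \<inter> ?o1 = {}" "frontier ?o1 = path_image (\<gamma> 1)"
      using J[of 1] by simp_all
    have Jb: "open ?ib" "open ?ob" "bounded ?ib" "?ib \<inter> ?ob = {}" "?ib \<union> ?ob = - path_image (\<gamma> b)"
      using J[of b] by simp_all
    have "sphere 0 b \<subseteq> closed_annulus 1 b - sphere 0 1" "sphere 0 1 \<subseteq> closed_annulus 1 b - sphere 0 b"
      using b by (auto simp: closed_annulus_def)
    then have "f ` sphere 0 b \<subseteq> ?i1" "f ` sphere 0 1 \<subseteq> ?ib"
      using in1 inb by blast+
    then have "path_image (\<gamma> b) \<subseteq> ?i1" "path_image (\<gamma> 1) \<subseteq> ?ib"
      by (simp_all only: pim simp_thms)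
    then have cover: "?o1 \<subseteq> ?ib \<union> ?ob" using J1(4) Jb(5) by blast
    then have "?ib \<inter> ?o1 = {} \<or> ?ob \<inter> ?o1 = {}"
      using connectedD[OF J1(2) Jb(1,2)] Jb(4) by simp
    then have "?o1 \<subseteq> ?ib \<or> ?o1 \<subseteq> ?ob" using cover by blast
    \<comment> \<open>The outside of the inner curve is connected and unbounded, so it lies outside
      the other curve. But its frontier is the inner curve, which lies in the open inside of the
      other one.\<close>
    then have o: "?o1 \<subseteq> ?ob" using J1(3) Jb(3) bounded_subset by blast
    have "path_image (\<gamma> 1) \<noteq> {}" by simp
    then obtain x where "x \<in> path_image (\<gamma> 1)" by blast
    then have "x \<in> ?ib" "x \<in> closure ?o1"
      using \<open>path_image (\<gamma> 1) \<subseteq> ?ib\<close> J1(5) by (auto simp: frontier_def)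
    then have "?ib \<inter> ?o1 \<noteq> {}" using open_Int_closure_eq_empty[OF Jb(1)] by blast
    then show False using o Jb(4) by blast
  qed
qed

text \<open>Two continuous logarithms along the same closed curve have the same increment: that of
  \<open>q\<close> is 2 pi i times the winding number, that of \<open>F\<close> along the vertical
  segment \<open>s\<close> is \<open>k\<close> periods. This is how \<open>k\<close> is known to be
  plus or minus 1 before \<open>F\<close> is known to be injective.\<close>

lemma winding_number_eq_period:
  assumes r: "1 \<le> r" "r \<le> exp L" and cont: "continuous_on (closed_annulus 1 (exp L)) f"
    and p: "p \<notin> f ` closed_annulus 1 (exp L)"
    and F: "continuous_on (cstrip 0 L) F" "\<And>z. z \<in> cstrip 0 L \<Longrightarrow> exp (F z) = f (exp z) - p"
    and per: "\<And>z. z \<in> cstrip 0 L \<Longrightarrow> F (z + period) = F z + of_int k * period"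
  shows "winding_number (f \<circ> circlepath 0 r) p = of_int k"
proof -
  define \<gamma> where "\<gamma> = f \<circ> circlepath 0 r"
  have sub: "sphere 0 r \<subseteq> closed_annulus 1 (exp L)" using r by (auto simp: closed_annulus_def)
  have im: "path_image (circlepath 0 r) = sphere 0 r" using r by simp
  have path: "path \<gamma>" unfolding \<gamma>_def
    by (rule path_continuous_image) (simp_all only: path_circlepath im continuous_on_subset[OF cont sub])
  have pn: "p \<notin> path_image \<gamma>" using p sub im by (auto simp: \<gamma>_def path_image_compose)
  obtain q where q: "path q" "pathfinish q - pathstart q = 2 * of_real pi * \<i> * winding_number \<gamma> p"
    "\<And>t. t \<in> {0..1} \<Longrightarrow> \<gamma> t = p + exp (q t)"
    apply (rule winding_number_as_continuous_log[OF path pn])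
    subgoal premises prems for q by (rule that) (fact prems)+
    done
  define s where "s t = Complex (ln r) (2 * pi * t)" for t
  have "ln r \<le> ln (exp L)" using r by (subst ln_le_cancel_iff) auto
  then have s: "s t \<in> cstrip 0 L" for t using r by (simp add: s_def cstrip_def)
  have exps: "exp (s t) = circlepath 0 r t" for t :: real
  proof -
    have "s t = of_real (ln r) + 2 * of_real pi * \<i> * of_real t" by (simp add: s_def complex_eq_iff)
    then have "exp (s t) = exp (of_real (ln r)) * exp (2 * of_real pi * \<i> * of_real t)" by (simp only: exp_add)
    also have "exp (of_real (ln r)) = complex_of_real r" using r by (simp add: exp_of_real)
    finally show ?thesis by (simp add: circlepath)
  qed
  have "continuous_on {0..1} (\<lambda>t. q t - F (s t))"
  proof (intro continuous_intros continuous_on_compose2[OF F(1)])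
    show "continuous_on {0..1} q" using q(1) by (simp add: path_def)
    show "continuous_on {0..1} s" unfolding s_def Complex_eq by (intro continuous_intros)
  qed (use s in auto)
  moreover have "exp (q t - F (s t)) = 1" if "t \<in> {0..1}" for t
  proof -
    have "exp (q t) = f (exp (s t)) - p" using q(3)[OF that] by (simp add: \<gamma>_def exps)
    then have "exp (q t) = exp (F (s t))" using F(2)[OF s[of t]] by simp
    then show ?thesis by (simp add: exp_diff)
  qed
  ultimately obtain n :: int where n: "\<forall>t\<in>{0..1}. q t - F (s t) = of_int n * period"
    using integer_period_constant[of "{0..1::real}" "\<lambda>t. q t - F (s t)"] connected_Icc by blast
  have "q 1 - F (s 1) = q 0 - F (s 0)" using n by simp
  moreover have "s 1 = s 0 + period" by (simp add: s_def complex_eq_iff)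
  ultimately have "q 1 - q 0 = of_int k * period" using per[OF s[of 0]] by (simp add: algebra_simps)
  moreover have "q 1 - q 0 = 2 * of_real pi * \<i> * winding_number \<gamma> p"
    using q(2) by (simp add: pathfinish_def pathstart_def)
  ultimately have "2 * of_real pi * \<i> * winding_number \<gamma> p = 2 * of_real pi * \<i> * of_int k" by (simp add: mult_ac)
  then show ?thesis by (simp add: \<gamma>_def)
qed

text \<open>Both sides of the distortion inequality acquire the factor
  \<open>(cmod (deriv H (F z)))\<^sup>2\<close>, which is nonzero because \<open>H\<close> is
  injective.\<close>

lemma qc_on_holomorphic_compose:
  assumes F: "qc_on K S F" and H: "H holomorphic_on \<Omega>" "open \<Omega>" "inj_on H \<Omega>"
    and im: "\<And>z. z \<in> S \<Longrightarrow> F z \<in> \<Omega>"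
  shows "qc_on K S (\<lambda>z. H (F z))"
proof -
  obtain fz fzb where C1: "C1_wirtinger_on S F fz fzb"
    and qc: "\<And>z. z \<in> S \<Longrightarrow> jac fz fzb z > 0"
      "\<And>z. z \<in> S \<Longrightarrow> (cmod (fz z) + cmod (fzb z))\<^sup>2 \<le> K * jac fz fzb z"
    using F by (auto simp: qc_on_def)
  let ?c = "\<lambda>z. deriv H (F z)"
  have cc: "continuous_on S ?c"
    using im by (intro continuous_on_compose2[OF holomorphic_on_imp_continuous_on[OF holomorphic_deriv[OF H(1,2)]]
        C1_wirtinger_on_continuous[OF C1]]) auto
  have nz: "?c z \<noteq> 0" if "z \<in> S" for z
    using holomorphic_injective_imp_regular[OF H im[OF that]] .
  have jac: "jac (\<lambda>z. ?c z * fz z) (\<lambda>z. ?c z * fzb z) z = (cmod (?c z))\<^sup>2 * jac fz fzb z" for z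
    by (simp add: jac_def norm_mult power_mult_distrib algebra_simps)
  show ?thesis unfolding qc_on_def
  proof (rule exI[of _ "\<lambda>z. ?c z * fz z"], rule exI[of _ "\<lambda>z. ?c z * fzb z"], intro conjI ballI)
    show "C1_wirtinger_on S (\<lambda>z. H (F z)) (\<lambda>z. ?c z * fz z) (\<lambda>z. ?c z * fzb z)"
      unfolding C1_wirtinger_on_def
    proof (intro conjI ballI)
      show "open S" "continuous_on S (\<lambda>z. ?c z * fz z)" "continuous_on S (\<lambda>z. ?c z * fzb z)"
        using C1 cc unfolding C1_wirtinger_on_def by (auto intro: continuous_on_mult)
      fix z assume z: "z \<in> S"
      show "has_wirtinger (\<lambda>z. H (F z)) (?c z * fz z) (?c z * fzb z) z"
        using C1 z H im unfolding C1_wirtinger_on_def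
        by (intro has_wirtinger_holomorphic_compose holomorphic_derivI) auto
    qed
    fix z assume z: "z \<in> S"
    show "jac (\<lambda>z. ?c z * fz z) (\<lambda>z. ?c z * fzb z) z > 0"
      unfolding jac using qc(1)[OF z] nz[OF z] by simp
    have "(cmod (?c z * fz z) + cmod (?c z * fzb z))\<^sup>2 = (cmod (?c z))\<^sup>2 * (cmod (fz z) + cmod (fzb z))\<^sup>2"
      by (simp add: norm_mult power_mult_distrib[symmetric] algebra_simps)
    also have "\<dots> \<le> (cmod (?c z))\<^sup>2 * (K * jac fz fzb z)"
      using qc(2)[OF z] by (intro mult_left_mono) auto
    finally show "(cmod (?c z * fz z) + cmod (?c z * fzb z))\<^sup>2 \<le> K * jac (\<lambda>z. ?c z * fz z) (\<lambda>z. ?c z * fzb z) z"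
      unfolding jac by (simp add: mult_ac)
  qed
qed

text \<open>The strips \<open>1 \<le> Re w \<le> \<beta>\<close> have module proportional to \<open>\<beta> - 1\<close>, which is unbounded.\<close>
lemma no_qc_half_plane_to_strip:
  assumes qc: "qc_on K {w. Re w > 0} G" "K > 0" and im: "\<And>w. Re w > 0 \<Longrightarrow> G w \<in> strip L"
    and inj: "inj_on G {w. Re w > 0}" and "L > 0"
    and per: "\<And>w. Re w > 0 \<Longrightarrow> G (w + period) = G w + of_int k * period"
    and k: "k = 1 \<or> k = -1"
  shows False
proof -
  obtain gz gzb where C1: "C1_wirtinger_on {w. Re w > 0} G gz gzb"
    and qc': "\<And>w. Re w > 0 \<Longrightarrow> jac gz gzb w > 0"
      "\<And>w. Re w > 0 \<Longrightarrow> (cmod (gz w) + cmod (gzb w))\<^sup>2 \<le> K * jac gz gzb w"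
    using qc(1) by (auto simp: qc_on_def)
  \<comment> \<open>Chosen so that \<open>(\<beta> - 1) / K = L + 1 / K\<close>, which exceeds the
    bound \<open>L\<close> provided by \<open>lower_module_bound\<close> with
    \<open>D = K\<close>.\<close>
  define \<beta> where "\<beta> = 2 + K * L"
  have \<beta>: "\<beta> > 1" using qc(2) \<open>L > 0\<close> by (simp add: \<beta>_def add_pos_pos)
  have pos: "Re z > 0" if "z \<in> cstrip 1 \<beta>" for z using that by (simp add: cstrip_def)
  have "2 * pi * integral {1..\<beta>} (\<lambda>x. inverse (integral {0..2*pi} (\<lambda>y. (\<lambda>_. K) (Complex x y)))) \<le> L"
  proof (rule lower_module_bound[OF \<beta> _ C1])
    show "cstrip 1 \<beta> \<subseteq> {w. Re w > 0}" using pos by blast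
    show "inj_on G (cstrip 1 \<beta>)" using pos by (intro inj_on_subset[OF inj]) auto
    show "0 \<le> Re (G z) \<and> Re (G z) \<le> L" if "z \<in> cstrip 1 \<beta>" for z
      using im[OF pos[OF that]] by (simp add: strip_def)
    show "(cmod (gz z - gzb z))\<^sup>2 \<le> K * jac gz gzb z" if "z \<in> cstrip 1 \<beta>" for z
    proof -
      have "(cmod (gz z - gzb z))\<^sup>2 \<le> (cmod (gz z) + cmod (gzb z))\<^sup>2"
        by (intro power_mono norm_triangle_ineq4) simp
      then show ?thesis using qc'(2)[OF pos[OF that]] by linarith
    qed
    show "jac gz gzb z \<ge> 0" if "z \<in> cstrip 1 \<beta>" for z using qc'(1)[OF pos[OF that]] by simp
    show "G (z + period) = G z + of_int k * period" if "z \<in> cstrip 1 \<beta>" for z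
      using per pos that by blast
  qed (use k qc(2) \<open>L > 0\<close> in auto)
  moreover have "integral {1..\<beta>} (\<lambda>x. inverse (integral {0..2*pi} (\<lambda>y. (\<lambda>_. K) (Complex x y)))) = (\<beta> - 1) * inverse (2 * pi * K)"
    using \<beta> by simp
  moreover have "2 * pi * ((\<beta> - 1) * inverse (2 * pi * K)) = (\<beta> - 1) / K"
    using qc(2) by (simp add: field_simps)
  ultimately have "(\<beta> - 1) / K \<le> L" by metis
  then show False using qc(2) by (simp add: \<beta>_def field_simps)
qed

text \<open>The Jacobian is positive up to and including the bounding circles, so the distortion
  quotient is continuous on a compact set.\<close>

lemma annulus_dilatation_bound:
  assumes cont: "continuous_on U fz" "continuous_on U fzb" and U: "closed_annulus 1 b \<subseteq> U"
    and jac: "\<And>z. z \<in> closed_annulus 1 b \<Longrightarrow> jac fz fzb z > 0"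
  obtains K where "K > 0" "\<And>z. z \<in> closed_annulus 1 b \<Longrightarrow> (cmod (fz z) + cmod (fzb z))\<^sup>2 \<le> K * jac fz fzb z"
proof -
  let ?A = "closed_annulus 1 b" and ?q = "\<lambda>z. (cmod (fz z) + cmod (fzb z))\<^sup>2 / jac fz fzb z"
  have c: "continuous_on ?A fz" "continuous_on ?A fzb" using cont U continuous_on_subset by blast+
  have "continuous_on ?A ?q"
    using jac by (intro continuous_intros continuous_on_jac c) force
  then have "bounded (?q ` ?A)"
    by (intro compact_imp_bounded compact_continuous_image compact_closed_annulus)
  then obtain K where K: "K > 0" "\<forall>x\<in>?q ` ?A. norm x \<le> K" using bounded_pos by blast
  have "(cmod (fz z) + cmod (fzb z))\<^sup>2 \<le> K * jac fz fzb z" if "z \<in> ?A" for z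
  proof -
    have "\<bar>?q z\<bar> \<le> K" using K(2) that by auto
    then have "?q z \<le> K" by linarith
    then show ?thesis using jac[OF that] by (simp add: divide_le_eq)
  qed
  then show ?thesis using that K(1) by blast
qed

section \<open>Descent to the annulus and construction of the conformal map\<close>

lemma exp_eq_period: "exp z = exp w \<longleftrightarrow> (\<exists>n::int. z = w + of_int n * period)"
  unfolding exp_eq by (simp add: mult_ac)

text \<open>\<open>s a\<close> is a logarithm that is holomorphic near \<open>a\<close>, also on the
  cut of \<open>Ln\<close>, because \<open>z / a\<close> is close to 1 there. As
  \<open>g (exp w) = Q w\<close> for every logarithm \<open>w\<close>, \<open>g\<close> may be
  written with \<open>s a\<close> near \<open>a\<close>.\<close>

lemma descend_to_annulus:
  assumes Q: "\<And>w. w \<in> cstrip 0 M \<Longrightarrow> g (exp w) = Q w"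
  shows "continuous_on (cstrip 0 M) Q \<Longrightarrow> continuous_on (closed_annulus 1 (exp M)) g"
    and "Q holomorphic_on strip M \<Longrightarrow> g holomorphic_on open_annulus 1 (exp M)"
proof -
  let ?C = "closed_annulus 1 (exp M)" and ?O = "open_annulus 1 (exp M)"
  define s where "s a z = Ln a + Ln (z / a)" for a z :: complex
  have exps: "exp (s a z) = z" if "a \<in> ?C" "z \<in> ?C" for a z
  proof -
    have "a \<noteq> 0" "z \<noteq> 0" using that by (auto simp: closed_annulus_def)
    then show ?thesis by (simp add: s_def exp_add)
  qed
  have sC: "s a z \<in> cstrip 0 M" if "a \<in> ?C" "z \<in> ?C" for a z
    using that(2) exp_closed_annulus[of "s a z" M] exps[OF that] by simp
  have sO: "s a z \<in> strip M" if "a \<in> ?O" "z \<in> ?O" for a z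
  proof -
    have "exp (s a z) = z" using that open_annulus_subset by (intro exps) blast+
    then show ?thesis using that(2) exp_open_annulus[of "s a z" M] by simp
  qed
  have gs: "g z = Q (s a z)" if "a \<in> ?C" "z \<in> ?C" for a z
    using Q[OF sC[OF that]] by (simp add: exps[OF that])
  have ders: "(s a has_field_derivative 1 / a) (at a)" if "a \<in> ?C" for a
  proof -
    have "a \<noteq> 0" using that by (auto simp: closed_annulus_def)
    then show ?thesis unfolding s_def by (auto intro!: derivative_eq_intros simp: complex_nonpos_Reals_iff)
  qed
  show "continuous_on ?C g" if cQ: "continuous_on (cstrip 0 M) Q"
    unfolding continuous_on_def
  proof
    fix a assume a: "a \<in> ?C"
    have "(s a \<longlongrightarrow> s a a) (at a within ?C)"
      using DERIV_isCont[OF ders[OF a]] by (meson isCont_def tendsto_within_subset subset_UNIV)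
    moreover have ev: "eventually (\<lambda>z. z \<in> ?C) (at a within ?C)" by (simp add: eventually_at_filter)
    then have "eventually (\<lambda>z. s a z \<in> cstrip 0 M) (at a within ?C)"
      by (rule eventually_mono) (rule sC[OF a])
    ultimately have "((\<lambda>z. Q (s a z)) \<longlongrightarrow> Q (s a a)) (at a within ?C)"
      by (intro continuous_on_tendsto_compose[OF cQ] sC[OF a a])
    moreover have "eventually (\<lambda>z. Q (s a z) = g z) (at a within ?C)"
      using ev by (rule eventually_mono) (simp add: gs[OF a])
    ultimately show "(g \<longlongrightarrow> g a) (at a within ?C)"
      unfolding gs[OF a a] by (rule Lim_transform_eventually)
  qed
  show "g holomorphic_on ?O" if hQ: "Q holomorphic_on strip M"
    unfolding holomorphic_on_open[OF open_open_annulus]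
  proof (intro ballI)
    fix a assume a: "a \<in> ?O"
    have aC: "a \<in> ?C" using a open_annulus_subset by blast
    have "(Q has_field_derivative deriv Q (s a a)) (at (s a a))"
      using hQ sO[OF a a] by (intro holomorphic_derivI) auto
    from DERIV_chain2[OF this ders[OF aC]]
    have "((\<lambda>z. Q (s a z)) has_field_derivative deriv Q (s a a) * (1 / a)) (at a)" .
    then have "(g has_field_derivative deriv Q (s a a) * (1 / a)) (at a)"
    proof (rule has_field_derivative_transform_within_open[OF _ open_open_annulus a])
      show "Q (s a z) = g z" if "z \<in> ?O" for z using gs[OF aC] that open_annulus_subset by (metis subsetD)
    qed
    then show "\<exists>d. (g has_field_derivative d) (at a)" by blast
  qed
qed

lemma conformal_annulus_image_exists:
  fixes b :: real
  assumes b: "b > 1" and U: "open U" "closed_annulus 1 b \<subseteq> U"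
    and homeo: "homeomorphism U (f ` U) f f'"
    and cont: "continuous_on U fz" "continuous_on U fzb"
    and der: "\<And>z. z \<in> U \<Longrightarrow> (f has_derivative (\<lambda>h. fz z * h + fzb z * cnj h)) (at z)"
    and jac: "\<And>z. z \<in> closed_annulus 1 b \<Longrightarrow> jac fz fzb z > 0"
  obtains M g where "M > 0" "conformal_annulus_image (f ` closed_annulus 1 b) 1 (exp M) g"
proof -
  note result = that
  define L where "L = ln b"
  have L: "L > 0" and expL: "exp L = b" using b by (auto simp: L_def)
  let ?A = "closed_annulus 1 b"
  have contf: "continuous_on ?A f" using homeo U(2) by (auto simp: homeomorphism_def intro: continuous_on_subset)
  have injf: "inj_on f ?A" using homeo U(2) by (auto simp: homeomorphism_def intro!: inj_on_inverseI[of _ f'])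
  obtain r p where r: "r = 1 \<or> r = b" and p: "p \<notin> f ` ?A"
    and wn: "winding_number (f \<circ> circlepath 0 r) p = 1 \<or> winding_number (f \<circ> circlepath 0 r) p = -1"
    by (rule point_in_hole[OF b contf injf])
  have cs: "exp z \<in> ?A" if "z \<in> cstrip 0 L" for z
    using that unfolding exp_closed_annulus[symmetric] expL .
  have ss: "strip L \<subseteq> cstrip 0 L" by (auto simp: strip_def cstrip_def)
  have csh: "z + period \<in> cstrip 0 L" if "z \<in> cstrip 0 L" for z
    using that by (simp add: cstrip_def)
  have "\<exists>F k. continuous_on (cstrip 0 L) F \<and> (\<forall>z\<in>cstrip 0 L. exp (F z) = f (exp z) - p) \<and>
    (\<forall>z\<in>cstrip 0 L. F (z + period) = F z + of_int k * period)"
  proof (rule periodic_logarithm[OF convex_cstrip csh])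
    show "continuous_on (cstrip 0 L) (\<lambda>z. f (exp z) - p)"
      by (intro continuous_intros continuous_on_compose2[OF contf]) (use cs in auto)
    show "f (exp z) - p \<noteq> 0" if "z \<in> cstrip 0 L" for z using p cs[OF that] by auto
    show "f (exp (z + period)) - p = f (exp z) - p" for z by (simp add: exp_add)
  qed
  then obtain F k where "continuous_on (cstrip 0 L) F \<and> (\<forall>z\<in>cstrip 0 L. exp (F z) = f (exp z) - p) \<and>
    (\<forall>z\<in>cstrip 0 L. F (z + period) = F z + of_int k * period)"
    by blast
  then have F: "continuous_on (cstrip 0 L) F"
    and expF: "\<And>z. z \<in> cstrip 0 L \<Longrightarrow> exp (F z) = f (exp z) - p"
    and per: "\<And>z. z \<in> cstrip 0 L \<Longrightarrow> F (z + period) = F z + of_int k * period"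
    by blast+
  have "winding_number (f \<circ> circlepath 0 r) p = of_int k"
    by (rule winding_number_eq_period[OF _ _ _ _ F expF per]) (use r b contf p expL in auto)
  then have "complex_of_int k = of_int 1 \<or> complex_of_int k = of_int (-1)" using wn by simp
  then have k: "k = 1 \<or> k = -1" unfolding of_int_eq_iff .
  then have kk: "k * k = 1" by auto
  have perF: "F (z + of_int n * period) = F z + of_int n * (of_int k * period)"
    if "z \<in> cstrip 0 L" for z n
    by (rule periodic_int(2)[where S = "cstrip 0 L" and F = F, OF per strip_shift(2) that])
  \<comment> \<open>Equal values give \<open>z = w + n * period\<close> through \<open>f\<close> and
    \<open>exp\<close>; then \<open>F\<close> differs by \<open>n * k\<close> periods, and
    \<open>k \<noteq> 0\<close> forces \<open>n = 0\<close>.\<close>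
  have injF: "z = w" if z: "z \<in> cstrip 0 L" and w: "w \<in> cstrip 0 L" and eq: "F z = F w" for z w
  proof -
    have "f (exp z) = f (exp w)" using expF[OF z] expF[OF w] eq by simp
    then have "exp z = exp w" using inj_onD[OF injf] cs z w by blast
    then obtain n :: int where n: "z = w + of_int n * period" using exp_eq_period by blast
    then have "of_int n * (of_int k * period) = 0" using perF[OF w, of n] eq by simp
    then show ?thesis using n k by auto
  qed
  define \<Omega> where "\<Omega> = F ` strip L"
  have cF: "continuous_on (strip L) F" by (rule continuous_on_subset[OF F ss])
  have iF: "inj_on F (strip L)" using injF ss by (intro inj_onI) blast
  obtain G where G: "homeomorphism (strip L) \<Omega> F G"
    using invariance_of_domain_homeomorphism[OF open_strip cF _ iF] unfolding \<Omega>_def by auto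
  have GF: "G (F z) = z" if "z \<in> strip L" for z using homeomorphism_apply1[OF G that] .
  have FG: "F (G w) = w" if "w \<in> \<Omega>" for w using homeomorphism_apply2[OF G that] .
  have G\<Omega>: "G w \<in> strip L" if "w \<in> \<Omega>" for w using G that by (auto simp: homeomorphism_def)
  have F\<Omega>: "F z \<in> \<Omega>" if "z \<in> strip L" for z using that by (simp add: \<Omega>_def)
  have open\<Omega>: "open \<Omega>" unfolding \<Omega>_def by (rule invariance_of_domain[OF cF open_strip iF])
  have sc\<Omega>: "simply_connected \<Omega>"
    using G homeomorphic_simply_connected convex_imp_simply_connected[OF convex_strip] homeomorphic_def by blast
  have ne\<Omega>: "\<Omega> \<noteq> {}"
  proof -
    have "complex_of_real (L / 2) \<in> strip L" using L by (simp add: strip_def)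
    then show ?thesis using F\<Omega> by blast
  qed
  \<comment> \<open>On \<open>\<Omega>\<close> the exponential is bounded by some \<open>B\<close>,
    as \<open>f - p\<close> is bounded on the compact ring. The real point \<open>B\<close> cannot
    belong to \<open>\<Omega>\<close>, since \<open>exp B > B\<close>.\<close>
  have nu\<Omega>: "\<Omega> \<noteq> UNIV"
  proof
    assume *: "\<Omega> = UNIV"
    have "bounded ((\<lambda>z. f z - p) ` ?A)"
      by (intro compact_imp_bounded compact_continuous_image compact_closed_annulus continuous_intros contf)
    then obtain B where B: "\<forall>x\<in>(\<lambda>z. f z - p) ` ?A. norm x \<le> B" using bounded_iff by blast
    obtain z where z: "z \<in> strip L" "F z = of_real B" using * unfolding \<Omega>_def by (metis UNIV_I imageE)
    have "exp B = norm (exp (F z))" by (simp add: z(2))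
    also have "\<dots> = norm (f (exp z) - p)" using expF z(1) ss by (metis subsetD)
    also have "\<dots> \<le> B" using B cs z(1) ss by blast
    finally show False using exp_ge_add_one_self[of B] by linarith
  qed
  have shift: "w + of_int n * period \<in> \<Omega>" if w: "w \<in> \<Omega>" for w n
  proof -
    obtain z where z: "z \<in> strip L" "w = F z" using w by (auto simp: \<Omega>_def)
    have "F (z + of_int (n * k) * period) = w + of_int (n * (k * k)) * period"
      using perF[of z "n * k"] z ss by (auto simp: mult_ac)
    moreover have "z + of_int (n * k) * period \<in> strip L" using z by (simp add: strip_def)
    ultimately show ?thesis using F\<Omega> unfolding kk by (metis mult.right_neutral)
  qed
  have shift_iff: "w \<in> \<Omega> \<longleftrightarrow> w + period \<in> \<Omega>" for w
    using shift[of w 1] shift[of "w + period" "-1"] by auto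
  have ann: "open_annulus 1 (exp L) \<subseteq> U" using U(2) open_annulus_subset[of 1 b] by (simp add: expL)
  have C1f: "C1_wirtinger_on (open_annulus 1 (exp L)) f fz fzb"
    unfolding C1_wirtinger_on_def has_wirtinger_def
    using ann cont der open_open_annulus continuous_on_subset by blast
  obtain K where K: "K > 0" "\<And>z. z \<in> ?A \<Longrightarrow> (cmod (fz z) + cmod (fzb z))\<^sup>2 \<le> K * jac fz fzb z"
    using annulus_dilatation_bound[OF cont U(2) jac] by blast
  have qcF: "qc_on K (strip L) F"
  proof -
    \<comment> \<open>Here \<open>\<Gamma> v = v - p\<close> on the complement of \<open>p\<close>;
      no conformal parametrisation of the ring exists yet.\<close>
    obtain c where c: "\<And>z. z \<in> strip L \<Longrightarrow> c z \<noteq> 0" and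
      C1: "C1_wirtinger_on (strip L) F (\<lambda>z. c z * (fz (exp z) * exp z)) (\<lambda>z. c z * (fzb (exp z) * cnj (exp z)))"
    proof (rule transition_C1_wirtinger[OF cF _ _ _ _ C1f])
      show "open (- {p})" "(\<lambda>v. v - p) holomorphic_on (- {p})" by (auto intro!: holomorphic_intros)
      have "deriv (\<lambda>v. v - p) v = 1" for v by (rule DERIV_imp_deriv) (auto intro!: derivative_eq_intros)
      then show "deriv (\<lambda>v. v - p) v \<noteq> 0 \<and> v - p \<noteq> 0" if "v \<in> - {p}" for v using that by simp
      show "f (exp z) \<in> - {p} \<and> exp (F z) = f (exp z) - p" if "z \<in> strip L" for z
        using p cs expF that ss by blast
    qed blast
    show ?thesis unfolding qc_on_def
    proof (rule exI, rule exI, intro conjI ballI, rule C1)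
      fix z assume z: "z \<in> strip L"
      then have zA: "exp z \<in> ?A" using cs ss by blast
      show "0 < jac (\<lambda>z. c z * (fz (exp z) * exp z)) (\<lambda>z. c z * (fzb (exp z) * cnj (exp z))) z"
        unfolding jac_transition using jac[OF zA] c[OF z] by simp
      have "(cmod (c z * (fz (exp z) * exp z)) + cmod (c z * (fzb (exp z) * cnj (exp z))))\<^sup>2
        = (cmod (c z * exp z))\<^sup>2 * (cmod (fz (exp z)) + cmod (fzb (exp z)))\<^sup>2"
        unfolding norm_mult complex_mod_cnj power_mult_distrib[symmetric] by (simp add: algebra_simps)
      also have "\<dots> \<le> (cmod (c z * exp z))\<^sup>2 * (K * jac fz fzb (exp z))"
        using K(2)[OF zA] by (intro mult_left_mono) auto
      finally show "(cmod (c z * (fz (exp z) * exp z)) + cmod (c z * (fzb (exp z) * cnj (exp z))))\<^sup>2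
        \<le> K * jac (\<lambda>z. c z * (fz (exp z) * exp z)) (\<lambda>z. c z * (fzb (exp z) * cnj (exp z))) z"
        unfolding jac_transition by (simp add: mult_ac)
    qed
  qed
  \<comment> \<open>What both models share; \<open>W\<close> is the strip or the half plane, and the
    degrees of \<open>F\<close> and \<open>H\<close> multiply.\<close>
  have comp: "continuous_on (strip L) (\<lambda>z. H (F z))" "continuous_on W (\<lambda>w. G (H' w))"
    "qc_on K (strip L) (\<lambda>z. H (F z))"
    "\<And>z. z \<in> strip L \<Longrightarrow> H (F (z + period)) = H (F z) + of_int (k * l) * period"
    if conj: "conjugates_translation \<Omega> W l H H'" for W H H' l
  proof -
    have H: "H holomorphic_on \<Omega>" "H' holomorphic_on W" "\<And>w. w \<in> \<Omega> \<Longrightarrow> H' (H w) = w" "\<And>w. w \<in> W \<Longrightarrow> H' w \<in> \<Omega>"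
      and Hper: "\<And>w. w \<in> \<Omega> \<Longrightarrow> H (w + period) = H w + of_int l * period"
      using conj unfolding conjugates_translation_def by blast+
    show "continuous_on (strip L) (\<lambda>z. H (F z))"
      using F\<Omega> by (intro continuous_on_compose2[OF holomorphic_on_imp_continuous_on[OF H(1)] cF]) auto
    show "continuous_on W (\<lambda>w. G (H' w))"
      using H(4) by (intro continuous_on_compose2[OF homeomorphism_cont2[OF G] holomorphic_on_imp_continuous_on[OF H(2)]]) auto
    show "qc_on K (strip L) (\<lambda>z. H (F z))"
      by (rule qc_on_holomorphic_compose[OF qcF H(1) open\<Omega> _ F\<Omega>]) (rule inj_on_inverseI[of _ H'], rule H(3))
    fix z assume z: "z \<in> strip L"
    have "H (F z + of_int k * period) = H (F z) + of_int k * (of_int l * period)"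
      by (rule periodic_int(2)[where S = \<Omega> and F = H, OF Hper shift_iff[symmetric] F\<Omega>[OF z]])
    moreover have "F (z + period) = F z + of_int k * period" using z ss per by blast
    ultimately show "H (F (z + period)) = H (F z) + of_int (k * l) * period" by (simp add: mult_ac)
  qed
  from translation_model[OF open\<Omega> sc\<Omega> ne\<Omega> nu\<Omega> shift_iff] show thesis
  proof
    assume "\<exists>H H' l. (l = 1 \<or> l = -1) \<and> conjugates_translation \<Omega> {w. Re w > 0} l H H'"
    then obtain H H' l where l: "l = 1 \<or> l = -1" and conj: "conjugates_translation \<Omega> {w. Re w > 0} l H H'"
      by blast
    then have H: "\<And>w. w \<in> \<Omega> \<Longrightarrow> Re (H w) > 0" "\<And>w. w \<in> \<Omega> \<Longrightarrow> H' (H w) = w"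
        "\<And>w. w \<in> {w. Re w > 0} \<Longrightarrow> H' w \<in> \<Omega>" "\<And>w. w \<in> {w. Re w > 0} \<Longrightarrow> H (H' w) = w"
      unfolding conjugates_translation_def by blast+
    note c = comp[OF conj]
    \<comment> \<open>In the half plane case \<open>?G\<close> is an injective quasiconformal map of
      the half plane into a strip of finite width \<open>L\<close>, compatible with the
      translations; \<open>no_qc_half_plane_to_strip\<close> excludes it.\<close>
    let ?G = "\<lambda>w. G (H' w)" and ?R = "{w::complex. Re w > 0}"
    have inv: "H (F (?G w)) = w" "?G w \<in> strip L" if "w \<in> ?R" for w
      using that H(3,4) FG G\<Omega> by auto
    have inv': "?G (H (F z)) = z" if "z \<in> strip L" for z using that H(2) F\<Omega> GF by simp
    have qcG: "qc_on K ?R ?G"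
      by (rule qc_on_inverse[OF open_strip c(1) inv' _ c(2) inv(2) inv(1) c(3)])
        (simp_all add: open_halfspace_Re_gt)
    have injG: "inj_on ?G ?R" using inv(1) by (intro inj_on_inverseI[of _ "\<lambda>z. H (F z)"])
    have kl: "k * l = 1 \<or> k * l = -1" using k l by auto
    have perG: "?G (w + period) = ?G w + of_int (k * l) * period" if w: "Re w > 0" for w
    proof -
      have w': "w \<in> ?R" "w + period \<in> ?R" using w by auto
      have "H (F (?G w + of_int (k * l) * period)) = w + period"
        using kl
      proof
        assume kl: "k * l = 1"
        then show ?thesis using c(4)[OF inv(2)[OF w'(1)]] inv(1)[OF w'(1)] by simp
      next
        assume kl: "k * l = -1"
        have "?G w - period \<in> strip L" using inv(2)[OF w'(1)] by (simp add: strip_def)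
        from c(4)[OF this] have "H (F (?G w)) = H (F (?G w - period)) - period"
          by (simp add: kl)
        then have "H (F (?G w - period)) = w + period"
          unfolding inv(1)[OF w'(1)] by (metis diff_add_cancel)
        then show ?thesis by (simp add: kl)
      qed
      moreover have "?G w + of_int (k * l) * period \<in> strip L"
        using inv(2)[OF w'(1)] by (simp add: strip_def)
      ultimately show ?thesis using inv' by metis
    qed
    have False
      using no_qc_half_plane_to_strip[OF qcG K(1) _ injG L perG kl] inv(2) by blast
    then show thesis ..
  next
    assume "\<exists>H H' M. M > 0 \<and> conjugates_translation \<Omega> (strip M) 1 H H'"
    then obtain H H' M where M: "M > 0" and conj: "conjugates_translation \<Omega> (strip M) 1 H H'"
      by blast
    then have hol: "H' holomorphic_on strip M"
      and H: "\<And>w. w \<in> \<Omega> \<Longrightarrow> H w \<in> strip M" "\<And>w. w \<in> \<Omega> \<Longrightarrow> H' (H w) = w"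
        "\<And>w. w \<in> strip M \<Longrightarrow> H' w \<in> \<Omega>" "\<And>w. w \<in> strip M \<Longrightarrow> H (H' w) = w"
      unfolding conjugates_translation_def by blast+
    note c = comp[OF conj]
    interpret s: strip_homeo L M "\<lambda>z. H (F z)" "\<lambda>w. G (H' w)" k
    proof
      show "H (F (z + period)) = H (F z) + of_int k * period" if "z \<in> strip L" for z
        using c(4)[OF that] by simp
    qed (use L M c(1,2) H F\<Omega> G\<Omega> GF FG k in auto)
    obtain Fb Gb where "continuous_on (cstrip 0 M) Gb \<and> (\<forall>w\<in>strip M. Gb w = G (H' w)) \<and>
      (\<forall>z\<in>cstrip 0 L. Fb z \<in> cstrip 0 M \<and> Gb (Fb z) = z) \<and>
      (\<forall>w\<in>cstrip 0 M. Gb w \<in> cstrip 0 L \<and> Fb (Gb w) = w) \<and>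
      (\<forall>w\<in>cstrip 0 M. Gb (w + period) = Gb w + of_int k * period)"
      using s.qc_boundary_extension[OF c(3) K(1)] by blast
    then have cGb: "continuous_on (cstrip 0 M) Gb"
      and Gb_eq: "\<And>w. w \<in> strip M \<Longrightarrow> Gb w = G (H' w)"
      and Fb: "\<And>z. z \<in> cstrip 0 L \<Longrightarrow> Fb z \<in> cstrip 0 M \<and> Gb (Fb z) = z"
      and Gb: "\<And>w. w \<in> cstrip 0 M \<Longrightarrow> Gb w \<in> cstrip 0 L \<and> Fb (Gb w) = w"
      and Gb_per: "\<And>w. w \<in> cstrip 0 M \<Longrightarrow> Gb (w + period) = Gb w + of_int k * period"
      by blast+
    have Gb_int: "w + of_int n * period \<in> cstrip 0 M"
      "Gb (w + of_int n * period) = Gb w + of_int n * (of_int k * period)"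
      if "w \<in> cstrip 0 M" for w n
      subgoal by (rule periodic_int(1)[where S = "cstrip 0 M" and F = Gb, OF Gb_per strip_shift(2) that])
      subgoal by (rule periodic_int(2)[where S = "cstrip 0 M" and F = Gb, OF Gb_per strip_shift(2) that])
      done
    have exp_int: "exp (z + of_int n * period) = exp z" for z n
      using exp_eq_period by blast
    let ?C = "closed_annulus 1 (exp M)"
    \<comment> \<open>The principal logarithm is an arbitrary choice: another one changes
      \<open>Gb\<close> by a multiple of the period, which \<open>exp\<close> does not see.\<close>
    define g where "g \<omega> = f (exp (Gb (Ln \<omega>)))" for \<omega>
    have g_exp: "g (exp w) = f (exp (Gb w))" if w: "w \<in> cstrip 0 M" for w
    proof -
      have "exp (Ln (exp w)) = exp w" by simp
      then obtain n :: int where n: "Ln (exp w) = w + of_int n * period" using exp_eq_period by blast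
      have "Gb (Ln (exp w)) = Gb w + of_int (n * k) * period"
        using Gb_int(2)[OF w, of n] unfolding n by (simp add: mult_ac)
      then show ?thesis unfolding g_def by (simp only: exp_int)
    qed
    have cQ: "continuous_on (cstrip 0 M) (\<lambda>w. f (exp (Gb w)))"
      using cs Gb by (intro continuous_on_compose2[OF contf] continuous_intros cGb) auto
    have cg: "continuous_on ?C g" by (rule descend_to_annulus(1)[OF g_exp cQ])
    \<comment> \<open>In the open strip \<open>Gb w = G (H' w)\<close> and
      \<open>exp (F z) = f (exp z) - p\<close>, so \<open>F\<close> and \<open>G\<close> cancel and
      the C1 map \<open>f\<close> disappears from the formula.\<close>
    have hQ: "(\<lambda>w. f (exp (Gb w))) holomorphic_on strip M"
    proof (rule holomorphic_transform)
      show "(\<lambda>w. exp (H' w) + p) holomorphic_on strip M" by (intro holomorphic_intros hol)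
      fix w assume w: "w \<in> strip M"
      have "G (H' w) \<in> cstrip 0 L" using G\<Omega>[OF H(3)[OF w]] ss by blast
      from expF[OF this] show "exp (H' w) + p = f (exp (Gb w))"
        by (simp add: FG[OF H(3)[OF w]] Gb_eq[OF w])
    qed
    have hg: "g holomorphic_on open_annulus 1 (exp M)" by (rule descend_to_annulus(2)[OF g_exp hQ])
    have Ln_strip: "Ln \<omega> \<in> cstrip 0 N" "exp (Ln \<omega>) = \<omega>" if "\<omega> \<in> closed_annulus 1 (exp N)" for \<omega> N
    proof -
      have "\<omega> \<noteq> 0" using that by (auto simp: closed_annulus_def)
      then show "exp (Ln \<omega>) = \<omega>" by simp
      then show "Ln \<omega> \<in> cstrip 0 N" using that by (simp flip: exp_closed_annulus)
    qed
    have img: "g ` ?C = f ` ?A"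
    proof (intro set_eqI iffI)
      fix v assume "v \<in> g ` ?C"
      then obtain \<omega> where \<omega>: "\<omega> \<in> ?C" "v = g \<omega>" by blast
      then have "v = f (exp (Gb (Ln \<omega>)))" by (simp add: g_def)
      then show "v \<in> f ` ?A" using cs Gb Ln_strip(1)[OF \<omega>(1)] by blast
    next
      fix v assume "v \<in> f ` ?A"
      then obtain a where a: "a \<in> closed_annulus 1 (exp L)" "v = f a" unfolding expL by blast
      let ?w = "Fb (Ln a)"
      have w: "?w \<in> cstrip 0 M" "Gb ?w = Ln a" using Fb[OF Ln_strip(1)[OF a(1)]] by auto
      then have "g (exp ?w) = v" using g_exp[OF w(1)] Ln_strip(2)[OF a(1)] a(2) by simp
      moreover have "exp ?w \<in> ?C" using w(1) by (simp add: exp_closed_annulus)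
      ultimately show "v \<in> g ` ?C" by blast
    qed
    have injg: "inj_on g ?C"
    proof (rule inj_onI)
      fix \<omega> \<xi> assume \<omega>: "\<omega> \<in> ?C" and \<xi>: "\<xi> \<in> ?C" and eq: "g \<omega> = g \<xi>"
      let ?w = "Ln \<omega>" and ?x = "Ln \<xi>"
      have w: "?w \<in> cstrip 0 M" and x: "?x \<in> cstrip 0 M" using Ln_strip(1) \<omega> \<xi> by blast+
      have "f (exp (Gb ?w)) = f (exp (Gb ?x))" using eq by (simp add: g_def)
      then have "exp (Gb ?w) = exp (Gb ?x)" using inj_onD[OF injf] cs Gb w x by blast
      then obtain n :: int where n: "Gb ?w = Gb ?x + of_int n * period" using exp_eq_period by blast
      \<comment> \<open>Shifting by \<open>n * k\<close> periods moves \<open>Gb\<close> by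
        \<open>n * k * k = n\<close> periods, as required.\<close>
      have "Gb (?x + of_int (n * k) * period) = Gb ?x + of_int (n * (k * k)) * period"
        using Gb_int(2)[OF x, of "n * k"] by (simp add: mult_ac)
      then have "Gb (?x + of_int (n * k) * period) = Gb ?w" unfolding kk n by simp
      then have "?x + of_int (n * k) * period = ?w" using Gb Gb_int(1)[OF x, of "n * k"] w by metis
      then have "exp ?w = exp ?x" using exp_int by metis
      then show "\<omega> = \<xi>" using Ln_strip(2) \<omega> \<xi> by simp
    qed
    have "\<exists>g'. homeomorphism ?C (f ` ?A) g g'"
      using homeomorphism_compact[OF compact_closed_annulus cg img injg] by blast
    then have "conformal_annulus_image (f ` ?A) 1 (exp M) g"
      using hg M by (simp add: conformal_annulus_image_def)
    then show thesis using result M by blast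
  qed
qed

theorem theorem2p11:
  fixes b :: real and f fz fzb :: "complex \<Rightarrow> complex" and U :: "complex set"
  assumes "b > 1"
    and "open U" and "closed_annulus 1 b \<subseteq> U"
    and "\<exists>g. homeomorphism U (f ` U) f g"
    and "continuous_on U fz" and "continuous_on U fzb"
    and "\<And>z. z \<in> U \<Longrightarrow> (f has_derivative (\<lambda>h. fz z * h + fzb z * cnj h)) (at z)"
    and "\<And>z. z \<in> closed_annulus 1 b \<Longrightarrow> jac fz fzb z > 0"
  shows "(integral {1..b} (\<lambda>r. inverse (integral {0..2*pi}
            (\<lambda>\<theta>. dir_dil fz fzb (\<theta> + pi/2) (complex_of_real r * cis \<theta>))) / r)
           \<le> conformal_module (f ` closed_annulus 1 b)) \<and>
         (conformal_module (f ` closed_annulus 1 b)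
           \<le> inverse (integral {0..2*pi} (\<lambda>\<theta>. inverse (integral {1..b}
            (\<lambda>r. dir_dil fz fzb \<theta> (complex_of_real r * cis \<theta>) / r)))))"
proof -
  obtain f' where f': "homeomorphism U (f ` U) f f'" using assms(4) by blast
  obtain M g where M: "M > 0" and g: "conformal_annulus_image (f ` closed_annulus 1 b) 1 (exp M) g"
    using conformal_annulus_image_exists[OF assms(1-3) f' assms(5-8)] by blast
  have "conformal_module (f ` closed_annulus 1 b) = M / (2 * pi)"
    using conformal_module_eq[OF g] by simp
  then show ?thesis
    using conformal_annulus_image_bounds[OF assms(1-3) f' assms(5-8) g M] by simp
qed

end
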